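(* There exists a $(1,4)$-approximation algorithm for the Bounded Cost Minimum Diameter Edge Addition problem with running time $O((3^B B^3+n+\log(Bn))Bn^2)$, where $n$ is the number of vertices of the input graph.
   Context: Bounded Cost Minimum Diameter Edge Addition: input is an undirected graph $G=(V,E)$, a weight function $w:[V]^2\to\mathbb{N}$, a cost function $c:[V]^2\to\mathbb{N}^*$ (where $[V]^2$ is the set of unordered vertex pairs) and an integer $B$; the goal is a set $F$ of non-edges of $G$ (elements of $[V]^2\setminus E$) with $\sum_{e\in F}c(e)\le B$ minimizing the diameter (largest shortest-path distance, path weight = sum of edge weights under $w$) of $(V,E\cup F)$. $D^B_{opt}$ denotes this minimum diameter. For $\alpha,\beta\ge1$, an $(\alpha,\beta)$-approximation algorithm computes a set $F$ of non-edges of $G$ of total cost at most $\alpha\cdot B$ such that the diameter of $(V,E\cup F)$ is at most $\beta\cdot D^B_{opt}$. *)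

theory Defs
  imports Complex_Main "HOL-Library.Extended_Real" "HOL-Library.Ramsey"
begin

section \<open>Edge-weighted graphs, distances and diameter\<close>

text \<open>
  The set of unordered pairs over \<open>V\<close> is the set \<^term>\<open>[V]\<^bsup>2\<^esup>\<close> of two-element subsets
  of \<open>V\<close>; a graph is given by \<open>V\<close> and a set of edges contained in \<^term>\<open>[V]\<^bsup>2\<^esup>\<close>.
\<close>

definition path_between :: "'a set \<Rightarrow> 'a set set \<Rightarrow> 'a \<Rightarrow> 'a \<Rightarrow> 'a list \<Rightarrow> bool" where
  "path_between V E u v p \<longleftrightarrow>
     p \<noteq> [] \<and> hd p = u \<and> last p = v \<and> distinct p \<and> set p \<subseteq> V \<and>
     (\<forall>i. Suc i < length p \<longrightarrow> {p ! i, p ! Suc i} \<in> E)"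

definition path_weight :: "('a set \<Rightarrow> nat) \<Rightarrow> 'a list \<Rightarrow> nat" where
  "path_weight w p = (\<Sum>i<length p - 1. w {p ! i, p ! Suc i})"

text \<open>The distance of two vertices is \<open>\<infinity>\<close> if no path joins them, since \<open>Inf {} = \<infinity>\<close>.\<close>

definition graph_dist :: "'a set \<Rightarrow> 'a set set \<Rightarrow> ('a set \<Rightarrow> nat) \<Rightarrow> 'a \<Rightarrow> 'a \<Rightarrow> enat" where
  "graph_dist V E w u v = (INF p \<in> {p. path_between V E u v p}. enat (path_weight w p))"

definition diameter :: "'a set \<Rightarrow> 'a set set \<Rightarrow> ('a set \<Rightarrow> nat) \<Rightarrow> enat" where
  "diameter V E w = (SUP u\<in>V. SUP v\<in>V. graph_dist V E w u v)"


section \<open>Bounded Cost Minimum Diameter Edge Addition\<close>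

definition bcmd_instance ::
    "'a set \<Rightarrow> 'a set set \<Rightarrow> ('a set \<Rightarrow> nat) \<Rightarrow> ('a set \<Rightarrow> nat) \<Rightarrow> bool" where
  "bcmd_instance V E w c \<longleftrightarrow>
     finite V \<and> V \<noteq> {} \<and> E \<subseteq> [V]\<^bsup>2\<^esup> \<and> (\<forall>e\<in>[V]\<^bsup>2\<^esup>. c e > 0)"

definition bcmd_feasible ::
    "'a set \<Rightarrow> 'a set set \<Rightarrow> ('a set \<Rightarrow> nat) \<Rightarrow> nat \<Rightarrow> 'a set set \<Rightarrow> bool" where
  "bcmd_feasible V E c B F \<longleftrightarrow> F \<subseteq> [V]\<^bsup>2\<^esup> - E \<and> (\<Sum>e\<in>F. c e) \<le> B"

definition D_opt ::
    "'a set \<Rightarrow> 'a set set \<Rightarrow> ('a set \<Rightarrow> nat) \<Rightarrow> ('a set \<Rightarrow> nat) \<Rightarrow> nat \<Rightarrow> enat" where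
  "D_opt V E w c B = (INF F \<in> {F. bcmd_feasible V E c B F}. diameter V (E \<union> F) w)"

text \<open>The infimum is a minimum.\<close>

lemma D_opt_attained: "\<exists>F. bcmd_feasible V E c B F \<and> diameter V (E \<union> F) w = D_opt V E w c B"
proof -
  have "bcmd_feasible V E c B {}"
    by (simp add: bcmd_feasible_def)
  then have "D_opt V E w c B \<in> (\<lambda>F. diameter V (E \<union> F) w) ` {F. bcmd_feasible V E c B F}"
    unfolding D_opt_def by (intro wellorder_InfI[of "diameter V (E \<union> {}) w"]) blast
  then show ?thesis
    by auto
qed

definition bcmd_approx_solution ::
    "real \<Rightarrow> real \<Rightarrow> 'a set \<Rightarrow> 'a set set \<Rightarrow> ('a set \<Rightarrow> nat) \<Rightarrow> ('a set \<Rightarrow> nat) \<Rightarrow> nat \<Rightarrow>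
     'a set set \<Rightarrow> bool" where
  "bcmd_approx_solution \<alpha> \<beta> V E w c B F \<longleftrightarrow>
     F \<subseteq> [V]\<^bsup>2\<^esup> - E \<and>
     real (\<Sum>e\<in>F. c e) \<le> \<alpha> * real B \<and>
     ereal_of_enat (diameter V (E \<union> F) w) \<le> ereal \<beta> * ereal_of_enat (D_opt V E w c B)"


section \<open>Random access machine with uniform cost\<close>

text \<open>
  Programs of a RAM in structured form. A state consists of natural-number registers and
  arrays of natural numbers. A program mentions only finitely many registers and arrays, so the
  named arrays amount to interleaved regions of one random access memory.
  Every operation costs one time unit. The only arithmetic operations are addition and
  truncated subtraction: there is no unit-cost multiplication, shift or bitwise operation, so
  that the uniform cost measure is a realistic one.
\<close>

datatype aexp =
    Const nat
  | Reg string
  | Read string aexp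
  | Plus aexp aexp
  | Minus aexp aexp

datatype bexp =
    Less aexp aexp
  | Neg bexp
  | Conj bexp bexp

datatype com =
    Skip
  | Assign string aexp
  | Write string aexp aexp
  | Seq com com
  | If bexp com com
  | While bexp com

type_synonym state = "(string \<Rightarrow> nat) \<times> (string \<Rightarrow> nat \<Rightarrow> nat)"

fun aval :: "aexp \<Rightarrow> state \<Rightarrow> nat" where
  "aval (Const k) s = k"
| "aval (Reg x) s = fst s x"
| "aval (Read a e) s = snd s a (aval e s)"
| "aval (Plus e1 e2) s = aval e1 s + aval e2 s"
| "aval (Minus e1 e2) s = aval e1 s - aval e2 s"

fun acost :: "aexp \<Rightarrow> nat" where
  "acost (Const k) = 1"
| "acost (Reg x) = 1"
| "acost (Read a e) = 1 + acost e"
| "acost (Plus e1 e2) = 1 + acost e1 + acost e2"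
| "acost (Minus e1 e2) = 1 + acost e1 + acost e2"

fun bval :: "bexp \<Rightarrow> state \<Rightarrow> bool" where
  "bval (Less e1 e2) s \<longleftrightarrow> aval e1 s < aval e2 s"
| "bval (Neg b) s \<longleftrightarrow> \<not> bval b s"
| "bval (Conj b1 b2) s \<longleftrightarrow> bval b1 s \<and> bval b2 s"

fun bcost :: "bexp \<Rightarrow> nat" where
  "bcost (Less e1 e2) = 1 + acost e1 + acost e2"
| "bcost (Neg b) = 1 + bcost b"
| "bcost (Conj b1 b2) = 1 + bcost b1 + bcost b2"

text \<open>
  \<open>exec p s t s'\<close>: started in \<open>s\<close>, program \<open>p\<close> halts in \<open>s'\<close> after \<open>t\<close> time units.
  A diverging run has no derivation.
\<close>

inductive exec :: "com \<Rightarrow> state \<Rightarrow> nat \<Rightarrow> state \<Rightarrow> bool" where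
  Skip: "exec Skip s 1 s"
| Assign: "exec (Assign x e) s (1 + acost e) ((fst s)(x := aval e s), snd s)"
| Write: "exec (Write a i e) s (1 + acost i + acost e)
            (fst s, (snd s)(a := (snd s a)(aval i s := aval e s)))"
| Seq: "exec p1 s1 t1 s2 \<Longrightarrow> exec p2 s2 t2 s3 \<Longrightarrow> exec (Seq p1 p2) s1 (t1 + t2) s3"
| IfTrue: "bval b s \<Longrightarrow> exec p1 s t s' \<Longrightarrow> exec (If b p1 p2) s (1 + bcost b + t) s'"
| IfFalse: "\<not> bval b s \<Longrightarrow> exec p2 s t s' \<Longrightarrow> exec (If b p1 p2) s (1 + bcost b + t) s'"
| WhileFalse: "\<not> bval b s \<Longrightarrow> exec (While b p) s (1 + bcost b) s"
| WhileTrue: "bval b s1 \<Longrightarrow> exec p s1 t1 s2 \<Longrightarrow> exec (While b p) s2 t2 s3 \<Longrightarrow>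
    exec (While b p) s1 (1 + bcost b + t1 + t2) s3"

inductive_cases exec_SkipE: "exec Skip s t s'"
  and exec_AssignE: "exec (Assign x e) s t s'"
  and exec_WriteE: "exec (Write a i e) s t s'"
  and exec_SeqE: "exec (Seq p1 p2) s t s'"
  and exec_IfE: "exec (If b p1 p2) s t s'"
  and exec_WhileE: "exec (While b p) s t s'"

lemma exec_deterministic:
  "exec p s t s' \<Longrightarrow> exec p s u s'' \<Longrightarrow> t = u \<and> s' = s''"
proof (induction arbitrary: u s'' rule: exec.induct)
  case (Skip s)
  then show ?case by (rule exec_SkipE) simp
next
  case (Assign x e s)
  then show ?case by (rule exec_AssignE) simp
next
  case (Write a i e s)
  then show ?case by (rule exec_WriteE) simp
next
  case (Seq p1 s1 t1 s2 p2 t2 s3)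
  from Seq.prems show ?case
    by (rule exec_SeqE) (metis Seq.IH)
next
  case (IfTrue b s p1 t s' p2)
  from IfTrue.prems show ?case
    by (rule exec_IfE) (use IfTrue.hyps(1) in \<open>auto dest!: IfTrue.IH\<close>)
next
  case (IfFalse b s p2 t s' p1)
  from IfFalse.prems show ?case
    by (rule exec_IfE) (use IfFalse.hyps(1) in \<open>auto dest!: IfFalse.IH\<close>)
next
  case (WhileFalse b s p)
  from WhileFalse.prems show ?case
    by (rule exec_WhileE) (use WhileFalse.hyps in simp_all)
next
  case (WhileTrue b s1 p t1 s2 t2 s3)
  from WhileTrue.prems show ?case
    by (rule exec_WhileE) (use WhileTrue.hyps(1) in simp, metis WhileTrue.IH add_Suc plus_1_eq_Suc)
qed


section \<open>Approximation algorithms for the problem and their running time\<close>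

text \<open>
  The machine receives a graph with vertices \<open>0, \<dots>, n - 1\<close>: the numbers \<open>n\<close> and \<open>B\<close> in
  registers, and the edges, weights and costs as \<open>n \<times> n\<close> matrices stored row by row.
  All other memory is zero, and so are the diagonals, on which \<open>w\<close> and \<open>c\<close> are not defined.
  The result is read off from an array \<open>F\<close> in the same layout.
\<close>

definition row_major :: "nat \<Rightarrow> (nat \<Rightarrow> nat \<Rightarrow> nat) \<Rightarrow> nat \<Rightarrow> nat" where
  "row_major n f k = (if k < n * n then f (k div n) (k mod n) else 0)"

definition pair_matrix :: "nat \<Rightarrow> (nat set \<Rightarrow> nat) \<Rightarrow> nat \<Rightarrow> nat" where
  "pair_matrix n f = row_major n (\<lambda>i j. if i = j then 0 else f {i, j})"

definition bcmd_input ::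
    "nat \<Rightarrow> nat set set \<Rightarrow> (nat set \<Rightarrow> nat) \<Rightarrow> (nat set \<Rightarrow> nat) \<Rightarrow> nat \<Rightarrow> state" where
  "bcmd_input n E w c B =
     ((\<lambda>_. 0)(''n'' := n, ''B'' := B),
      (\<lambda>_ _. 0)(''E'' := pair_matrix n (\<lambda>e. if e \<in> E then 1 else 0),
               ''w'' := pair_matrix n w,
               ''c'' := pair_matrix n c))"

definition bcmd_output :: "nat \<Rightarrow> state \<Rightarrow> nat set set" where
  "bcmd_output n s = {{i, j} |i j. i < n \<and> j < n \<and> snd s ''F'' (i * n + j) \<noteq> 0}"

definition bcmd_approx_algorithm :: "real \<Rightarrow> real \<Rightarrow> com \<Rightarrow> bool" where
  "bcmd_approx_algorithm \<alpha> \<beta> p \<longleftrightarrow>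
     \<alpha> \<ge> 1 \<and> \<beta> \<ge> 1 \<and>
     (\<forall>n E w c B. bcmd_instance {..<n} E w c \<longrightarrow>
        (\<exists>t s. exec p (bcmd_input n E w c B) t s \<and>
               bcmd_approx_solution \<alpha> \<beta> {..<n} E w c B (bcmd_output n s)))"

text \<open>
  Worst-case running time \<open>O(T n B)\<close>, with one constant for all \<open>n \<ge> 1\<close> and \<open>B \<ge> 1\<close>
  (an instance has \<open>n \<ge> 1\<close>). The budget \<open>B = 0\<close> is excluded here, because bounds such as
  \<open>log (B n)\<close> are meaningful only for positive \<open>B\<close>.
\<close>

definition bcmd_running_time :: "com \<Rightarrow> (nat \<Rightarrow> nat \<Rightarrow> real) \<Rightarrow> bool" where
  "bcmd_running_time p T \<longleftrightarrow>
     (\<exists>C. \<forall>n E w c B t s. bcmd_instance {..<n} E w c \<longrightarrow> B \<ge> 1 \<longrightarrow>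
        exec p (bcmd_input n E w c B) t s \<longrightarrow> real t \<le> C * T n B)"

end

theory Submission
  imports Defs "HOL-Library.Nat_Bijection"
begin

text \<open>
  Adding one edge to a graph brings a set of pairs of far-apart vertices closer than \<open>D\<close> only if
  these pairs form a star, so among \<open>B + 2\<close> vertices two have distance at most \<open>D\<^sub>o\<^sub>p\<^sub>t\<close> in the
  original graph. Farthest-first traversal hence yields a root and \<open>B\<close> terminals such that every
  vertex is within \<open>D\<^sub>o\<^sub>p\<^sub>t\<close> of one of them. A shortest-path tree of an optimal solution shows that
  the root can be joined to all terminals by a tree of height \<open>D\<^sub>o\<^sub>p\<^sub>t\<close> with new edges of cost \<open>B\<close>;
  a tree of minimum height is found by a dynamic program over root, cost and set of terminals, in
  the style of Dreyfus and Wagner. Its new edges give every vertex distance at most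
  \<open>2 D\<^sub>o\<^sub>p\<^sub>t\<close> from the root.
\<close>


section \<open>Shortest paths\<close>

text \<open>Two obstacles shape the proof. Weights may be zero, so shortest paths for
  \<open>w\<close> need not fit into a tree: the vertex in front of a new edge could also lie behind
  it. The existence proof therefore uses the positive weights n * w + 1; a path has at most n - 1
  edges, so division by n gives back bounds for \<open>w\<close>. Moreover, the machine knows
  neither \<open>D_opt\<close> nor optimal edges, and it can neither multiply nor operate on bits.
  The table is not described by equations but by two inequalities: each finite entry is witnessed by
  an edge set within its budget, and after r rounds it is at most the height of every tree assembled
  in r rounds. Both survive in-place updates that run ahead of the rounds. The factor 3 ^ B counts
  ordered pairs of disjoint terminal sets, for which union is addition of binary codes. The factor 4
  arises because two vertices are connected via the root, each at distance at most twice the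
  optimum.\<close>

lemma path_weight_simps [simp]:
  "path_weight w [] = 0"
  "path_weight w [a] = 0"
  "path_weight w (a # b # p) = w {a, b} + path_weight w (b # p)"
  by (simp_all add: path_weight_def sum.lessThan_Suc_shift del: sum.lessThan_Suc)

lemma path_weight_append:
  "path_weight w (xs @ y # zs) = path_weight w (xs @ [y]) + path_weight w (y # zs)"
  by (induction xs rule: induct_list012) simp_all

lemma path_weight_rev: "path_weight w (rev p) = path_weight w p"
  by (induction p rule: induct_list012)
     (simp_all add: path_weight_append[of _ _ _ "[_]"] insert_commute)

text \<open>Without distinctness, walks can be concatenated freely; \<open>walk_shorten\<close>
  leads back to paths.\<close>

definition walk :: "'a set \<Rightarrow> 'a set set \<Rightarrow> 'a \<Rightarrow> 'a \<Rightarrow> 'a list \<Rightarrow> bool" where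
  "walk V E u v p \<longleftrightarrow>
     p \<noteq> [] \<and> hd p = u \<and> last p = v \<and> set p \<subseteq> V \<and> successively (\<lambda>a b. {a, b} \<in> E) p"

lemma path_between_iff_walk: "path_between V E u v p \<longleftrightarrow> walk V E u v p \<and> distinct p"
  by (auto simp: path_between_def walk_def successively_conv_nth)

text \<open>Cutting out a closed piece between two occurrences of a vertex cannot increase the
  weight, since weights are natural numbers.\<close>

lemma walk_shorten:
  assumes "walk V E u v p"
  shows "\<exists>q. path_between V E u v q \<and> path_weight w q \<le> path_weight w p"
  using assms
proof (induction "length p" arbitrary: p rule: less_induct)
  case less
  show ?case
  proof (cases "distinct p")
    case True
    then show ?thesis
      using less.prems by (auto simp: path_between_iff_walk)
  next
    case False
    then obtain xs ys zs y where p: "p = xs @ [y] @ ys @ [y] @ zs"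
      using not_distinct_decomp by blast
    let ?q = "xs @ y # zs"
    have "walk V E u v ?q"
      using less.prems unfolding walk_def p
      by (cases xs; cases zs) (auto simp: successively_append_iff successively_Cons hd_append)
    moreover have "path_weight w ?q \<le> path_weight w p"
      unfolding p using path_weight_append[of w xs y "ys @ [y] @ zs"]
        path_weight_append[of w "y # ys" y zs] path_weight_append[of w xs y zs]
      by simp
    ultimately show ?thesis
      using less.hyps[of ?q] by (fastforce simp: p)
  qed
qed

lemma graph_dist_le_path: "path_between V E u v p \<Longrightarrow> graph_dist V E w u v \<le> enat (path_weight w p)"
  unfolding graph_dist_def by (rule INF_lower) simp

lemma graph_dist_le_walk:
  assumes "walk V E u v p"
  shows "graph_dist V E w u v \<le> enat (path_weight w p)"
proof -
  obtain q where "path_between V E u v q" "path_weight w q \<le> path_weight w p"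
    using walk_shorten[OF assms] by blast
  then show ?thesis
    by (meson enat_ord_simps(1) graph_dist_le_path order_trans)
qed

lemma graph_dist_attained:
  assumes "graph_dist V E w u v = enat k"
  obtains p where "path_between V E u v p" "path_weight w p = k"
proof -
  have ne: "{p. path_between V E u v p} \<noteq> {}"
  proof
    assume "{p. path_between V E u v p} = {}"
    then show False
      using assms unfolding graph_dist_def by (simp only: image_empty) (simp add: top_enat_def)
  qed
  then have "graph_dist V E w u v \<in> (\<lambda>p. enat (path_weight w p)) ` {p. path_between V E u v p}"
    unfolding graph_dist_def by (metis (mono_tags) ex_in_conv image_is_empty wellorder_InfI)
  then show ?thesis
    using assms that by auto
qed

lemma path_between_ends: "path_between V E u v p \<Longrightarrow> u \<in> V \<and> v \<in> V"
  unfolding path_between_def by (metis hd_in_set last_in_set subset_iff)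

lemma graph_dist_finite_ends: "graph_dist V E w u v = enat k \<Longrightarrow> u \<in> V \<and> v \<in> V"
  by (meson graph_dist_attained path_between_ends)

lemma graph_dist_self [simp]:
  assumes "v \<in> V"
  shows "graph_dist V E w v v = 0"
proof -
  have "path_between V E v v [v]"
    using assms by (simp add: path_between_def)
  then show ?thesis
    using graph_dist_le_path[of V E v v "[v]" w] by (simp add: zero_enat_def[symmetric])
qed

lemma graph_dist_edge:
  assumes "{u, v} \<in> E" "u \<in> V" "v \<in> V"
  shows "graph_dist V E w u v \<le> enat (w {u, v})"
  using graph_dist_le_walk[of V E u v "[u, v]" w] assms by (simp add: walk_def)

lemma graph_dist_triangle: "graph_dist V E w u v \<le> graph_dist V E w u x + graph_dist V E w x v"
proof (cases "graph_dist V E w u x = \<infinity> \<or> graph_dist V E w x v = \<infinity>")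
  case False
  then obtain k l where kl: "graph_dist V E w u x = enat k" "graph_dist V E w x v = enat l"
    by auto
  obtain p q where p: "path_between V E u x p" "path_weight w p = k"
    and q: "path_between V E x v q" "path_weight w q = l"
    using kl graph_dist_attained by metis
  obtain p' where p': "p = p' @ [x]"
    using p(1) by (metis append_butlast_last_id path_between_def)
  obtain q' where q': "q = x # q'"
    using q(1) by (metis list.collapse path_between_def)
  have "walk V E u v (p' @ x # q')"
    using p(1) q(1) unfolding path_between_iff_walk walk_def p' q'
    by (cases p'; cases q') (auto simp: successively_append_iff successively_Cons hd_append)
  from graph_dist_le_walk[OF this, of w] show ?thesis
    using p(2) q(2) by (simp add: kl path_weight_append[of w p' x q'] p' q')
qed auto

lemma path_between_rev: "path_between V E u v p \<Longrightarrow> path_between V E v u (rev p)"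
  unfolding path_between_iff_walk walk_def
  by (auto simp: hd_rev last_rev insert_commute)

lemma graph_dist_commute: "graph_dist V E w u v = graph_dist V E w v u"
proof -
  have "graph_dist V E w u v \<le> graph_dist V E w v u" for u v
    unfolding graph_dist_def[of V E w v u]
    by (rule INF_greatest) (metis graph_dist_le_path mem_Collect_eq path_between_rev path_weight_rev)
  then show ?thesis
    by (simp add: order_antisym)
qed

lemma walk_mono: "walk V E u v p \<Longrightarrow> E \<subseteq> E' \<Longrightarrow> walk V E' u v p"
  unfolding walk_def by (auto elim: successively_mono)

lemma graph_dist_mono: "E \<subseteq> E' \<Longrightarrow> graph_dist V E' w u v \<le> graph_dist V E w u v"
  unfolding graph_dist_def
  by (rule INF_superset_mono) (auto simp: path_between_iff_walk intro: walk_mono)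

lemma walk_split:
  assumes "walk V E u v (xs @ x # ys)"
  shows "walk V E u x (xs @ [x])" "walk V E x v (x # ys)"
  using assms unfolding walk_def
  by (auto simp: successively_append_iff successively_Cons hd_append)

lemma walk_split_edge:
  assumes "walk V E u v (xs @ x # y # ys)"
  shows "walk V E u x (xs @ [x])" "{x, y} \<in> E" "walk V E y v (y # ys)"
  using assms unfolding walk_def
  by (auto simp: successively_append_iff successively_Cons hd_append)

text \<open>The cut is at the first edge that \<open>E\<close> lacks, so the prefix needs no new
  edge; this is how shortest paths before and after an addition are compared.\<close>

lemma first_new_edge:
  assumes "walk V (E \<union> F) u v p" "\<not> walk V E u v p"
  obtains xs x y ys where "p = xs @ x # y # ys" "{x, y} \<in> F" "walk V E u x (xs @ [x])"
proof -
  have "successively (\<lambda>a b. {a, b} \<in> E) p \<or>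
    (\<exists>xs x y ys. p = xs @ x # y # ys \<and> {x, y} \<in> F \<and> successively (\<lambda>a b. {a, b} \<in> E) (xs @ [x]))"
    using assms(1) unfolding walk_def
  proof (induction p arbitrary: u rule: induct_list012)
    case (3 a b p)
    show ?case
    proof (cases "{a, b} \<in> E")
      case True
      from 3(2)[of b] 3(3) have "successively (\<lambda>a b. {a, b} \<in> E) (b # p) \<or>
        (\<exists>xs x y ys. b # p = xs @ x # y # ys \<and> {x, y} \<in> F \<and> successively (\<lambda>a b. {a, b} \<in> E) (xs @ [x]))"
        by auto
      then show ?thesis
      proof (elim disjE exE conjE)
        fix xs x y ys
        assume *: "b # p = xs @ x # y # ys" "{x, y} \<in> F" "successively (\<lambda>a b. {a, b} \<in> E) (xs @ [x])"
        then have "a # b # p = (a # xs) @ x # y # ys" "successively (\<lambda>a b. {a, b} \<in> E) ((a # xs) @ [x])"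
          using True by (cases xs; simp)+
        with *(2) show ?thesis by blast
      qed (use True in simp)
    next
      case False
      then have "{a, b} \<in> F" using 3(3) by auto
      moreover have "a # b # p = [] @ a # b # p" "successively (\<lambda>a b. {a, b} \<in> E) ([] @ [a])"
        by simp_all
      ultimately show ?thesis by blast
    qed
  qed auto
  with assms obtain xs x y ys where *: "p = xs @ x # y # ys" "{x, y} \<in> F"
    "successively (\<lambda>a b. {a, b} \<in> E) (xs @ [x])"
    unfolding walk_def by blast
  moreover have "walk V E u x (xs @ [x])"
    using *(3) walk_split[of V "E \<union> F" u v xs x "y # ys"] assms(1) unfolding *(1) walk_def by auto
  ultimately show ?thesis using that by blast
qed

text \<open>An edge used by a walk has both ends on it, so new edges not contained in the vertex set
  of the walk can be withdrawn.\<close>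

lemma walk_avoid:
  assumes "walk V (E \<union> F) u v p" "\<And>f. f \<in> F - F' \<Longrightarrow> \<not> f \<subseteq> set p"
  shows "walk V (E \<union> F') u v p"
proof -
  have "successively (\<lambda>a b. {a, b} \<in> E \<union> F') p"
    by (rule successively_mono[of "\<lambda>a b. {a, b} \<in> E \<union> F"])
       (use assms in \<open>auto simp: walk_def\<close>)
  then show ?thesis
    using assms(1) by (simp add: walk_def)
qed


text \<open>A shortest path that is not yet available in \<open>E\<close> crosses the new edge exactly once.\<close>

lemma graph_dist_insert_edge:
  assumes "graph_dist V (insert {p, q} E) w a b \<le> D" "graph_dist V E w a b > D"
  shows "graph_dist V E w a p + graph_dist V E w q b \<le> D \<or>
         graph_dist V E w a q + graph_dist V E w p b \<le> D"
proof -
  obtain l where l: "graph_dist V (insert {p, q} E) w a b = enat l"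
    using assms by (metis enat_ord_simps(6) not_infinity_eq order_le_less_trans)
  then obtain r where r: "path_between V (E \<union> {{p, q}}) a b r" "path_weight w r = l"
    using graph_dist_attained[of V "E \<union> {{p, q}}" w a b] by auto
  then have walk: "walk V (E \<union> {{p, q}}) a b r" and "distinct r"
    by (auto simp: path_between_iff_walk)
  have "\<not> walk V E a b r"
    using graph_dist_le_walk[of V E a b r w] r(2) assms l by auto
  with walk obtain xs x y ys where 1: "r = xs @ x # y # ys" "{x, y} \<in> {{p, q}}" "walk V E a x (xs @ [x])"
    by (rule first_new_edge)
  have "walk V (E \<union> {{p, q}}) y b (y # ys)"
    using walk unfolding 1(1) by (rule walk_split_edge)
  \<comment> \<open>\<open>r\<close> is distinct, so x does not recur on the rest of the path and
    {p, q} cannot be used again.\<close>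
  then have "walk V (E \<union> {}) y b (y # ys)"
    by (rule walk_avoid) (use \<open>distinct r\<close> 1 in auto)
  then have "graph_dist V E w a x + graph_dist V E w y b
    \<le> enat (path_weight w (xs @ [x])) + enat (path_weight w (y # ys))"
    using 1(3) by (intro add_mono graph_dist_le_walk) simp_all
  also have "\<dots> \<le> enat l"
    using r(2) unfolding 1(1) path_weight_append[of w xs x "y # ys"] by simp
  finally have "graph_dist V E w a x + graph_dist V E w y b \<le> enat l" .
  then have "graph_dist V E w a x + graph_dist V E w y b \<le> D"
    using assms(1) l by auto
  then show ?thesis
    using 1(2) by (auto simp: doubleton_eq_iff)
qed

section \<open>Sets of pairwise far vertices under edge addition\<close>

definition far_apart :: "'a set \<Rightarrow> 'a set set \<Rightarrow> ('a set \<Rightarrow> nat) \<Rightarrow> enat \<Rightarrow> 'a set \<Rightarrow> bool" where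
  "far_apart V E w D U \<longleftrightarrow> (\<forall>a\<in>U. \<forall>b\<in>U. a \<noteq> b \<longrightarrow> graph_dist V E w a b > D)"

text \<open>The sum of all four numbers is at most 2 D when grouped one way and exceeds 2 D when
  grouped the other way.\<close>

lemma enat_two_pairs:
  fixes a b c d D :: enat
  assumes "a + b \<le> D" "c + d \<le> D" "D < a + c" "D < b + d"
  shows False
  using assms by (cases a; cases b; cases c; cases d; cases D) auto

text \<open>A pair brought close has one end on the side of p and one on the side of q. For two
  disjoint pairs, regrouping the four distances by side gives two sums above \<open>D\<close>,
  because the ends on one side are distinct elements of \<open>U\<close>.\<close>

lemma close_pairs_share:
  assumes far: "far_apart V E w D U"
    and U: "a \<in> U" "b \<in> U" "c \<in> U" "d \<in> U"
    and ne: "a \<noteq> c" "a \<noteq> d" "b \<noteq> c" "b \<noteq> d" "a \<noteq> b" "c \<noteq> d"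
    and ab: "graph_dist V (insert {p, q} E) w a b \<le> D"
    and cd: "graph_dist V (insert {p, q} E) w c d \<le> D"
  shows False
proof -
  let ?d = "graph_dist V E w"
  have sep: "D < ?d x z + ?d z y" if "x \<in> U" "y \<in> U" "x \<noteq> y" for x y z
    using graph_dist_triangle[of V E w x y z] far that unfolding far_apart_def
    by (metis order_less_le_trans)
  note sym = graph_dist_commute[of V E w]
  have s1: "D < ?d a z + ?d c z" "D < ?d b z + ?d d z" "D < ?d a z + ?d d z" "D < ?d b z + ?d c z" for z
    using sep[of a c z] sep[of b d z] sep[of a d z] sep[of b c z] U ne sym by metis+
  have "?d a p + ?d b q \<le> D \<or> ?d a q + ?d b p \<le> D"
    using graph_dist_insert_edge[OF ab] far U ne sym unfolding far_apart_def by metis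
  moreover have "?d c p + ?d d q \<le> D \<or> ?d c q + ?d d p \<le> D"
    using graph_dist_insert_edge[OF cd] far U ne sym unfolding far_apart_def by metis
  ultimately show False
    using s1 enat_two_pairs by (metis add.commute)
qed

text \<open>Each close pair assigns one of its vertices to p and the other to q. By
  \<open>enat_two_pairs\<close> no vertex is assigned differently by its two pairs, so a triangle
  would be properly coloured with two colours.\<close>

lemma enat_three_pairs:
  fixes ap aq bp bq cp cq D :: enat
  assumes "D < ap + bp" "D < ap + cp" "D < bp + cp" "D < aq + bq" "D < aq + cq" "D < bq + cq"
    and "ap + bq \<le> D \<or> aq + bp \<le> D" "ap + cq \<le> D \<or> aq + cp \<le> D" "bp + cq \<le> D \<or> bq + cp \<le> D"
  shows False
proof -
  have "\<not> (ap + bq \<le> D \<and> bp + cq \<le> D)" "\<not> (aq + bp \<le> D \<and> bq + cp \<le> D)"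
    using enat_two_pairs[of ap bq D bp cq] enat_two_pairs[of aq bp D bq cp] assms(1-6) by blast+
  moreover have "\<not> (aq + bp \<le> D \<and> ap + cq \<le> D)" "\<not> (ap + bq \<le> D \<and> aq + cp \<le> D)"
    using enat_two_pairs[of bp aq D ap cq] enat_two_pairs[of bq ap D aq cp] assms(1-6)
    by (simp_all add: add.commute) blast+
  moreover have "\<not> (ap + cq \<le> D \<and> bq + cp \<le> D)" "\<not> (aq + cp \<le> D \<and> bp + cq \<le> D)"
    using enat_two_pairs[of ap cq D cp bq] enat_two_pairs[of aq cp D cq bp] assms(1-6)
    by (simp_all add: add.commute) blast+
  ultimately show False
    using assms(7-9) by blast
qed

lemma no_close_triangle:
  assumes far: "far_apart V E w D U"
    and U: "a \<in> U" "b \<in> U" "c \<in> U" and ne: "a \<noteq> b" "a \<noteq> c" "b \<noteq> c"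
    and close: "graph_dist V (insert {p, q} E) w a b \<le> D"
      "graph_dist V (insert {p, q} E) w a c \<le> D"
      "graph_dist V (insert {p, q} E) w b c \<le> D"
  shows False
proof -
  let ?d = "graph_dist V E w"
  have sep: "D < ?d x z + ?d y z" if "x \<in> U" "y \<in> U" "x \<noteq> y" for x y z
    using graph_dist_triangle[of V E w x y z] far that unfolding far_apart_def
    by (metis order_less_le_trans graph_dist_commute)
  have edge: "?d x p + ?d y q \<le> D \<or> ?d x q + ?d y p \<le> D"
    if "x \<in> U" "y \<in> U" "x \<noteq> y" "graph_dist V (insert {p, q} E) w x y \<le> D" for x y
    using graph_dist_insert_edge[OF that(4)] far that unfolding far_apart_def
    by (metis graph_dist_commute)
  show False
    by (rule enat_three_pairs[of D "?d a p" "?d b p" "?d c p" "?d a q" "?d b q" "?d c q"])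
       (use sep edge[OF U(1,2) ne(1) close(1)] edge[OF U(1,3) ne(2) close(2)]
            edge[OF U(2,3) ne(3) close(3)] U ne in \<open>simp_all add: add.commute\<close>)
qed

text \<open>
  By the two preceding lemmas the pairs brought close together by one new edge pairwise intersect
  and form no triangle, hence form a star, whose centre is dropped.
\<close>

lemma far_apart_insert_edge:
  assumes far: "far_apart V E w D U" and "finite U"
  obtains u where "far_apart V (insert {p, q} E) w D (U - {u})"
proof (cases "far_apart V (insert {p, q} E) w D U")
  case True
  then have "far_apart V (insert {p, q} E) w D (U - {u})" for u
    by (simp add: far_apart_def)
  then show ?thesis using that by blast
next
  case False
  let ?c = "\<lambda>a b. graph_dist V (insert {p, q} E) w a b \<le> D"
  have sym: "?c a b \<longleftrightarrow> ?c b a" for a b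
    by (metis graph_dist_commute)
  obtain a b where ab: "a \<in> U" "b \<in> U" "a \<noteq> b" "?c a b"
    using False by (auto simp: far_apart_def not_less)
  have sh: "x = a \<or> x = b \<or> y = a \<or> y = b" if "x \<in> U" "y \<in> U" "x \<noteq> y" "?c x y" for x y
    using close_pairs_share[OF far ab(1,2) that(1,2)] ab that by metis
  show ?thesis
  \<comment> \<open>If neither a nor b could be dropped, there would be close pairs {b, d} and {a,
    e}: disjoint for d \<noteq> e, and otherwise two sides of a triangle with {a, b}.\<close>
  proof (cases "far_apart V (insert {p, q} E) w D (U - {a})")
    case False
    then obtain x y where xy: "x \<in> U" "y \<in> U" "x \<noteq> y" "x \<noteq> a" "y \<noteq> a" "?c x y"
      by (auto simp: far_apart_def not_less)
    then obtain d where d: "d \<in> U" "d \<noteq> a" "d \<noteq> b" "?c b d"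
      using sh sym by metis
    have "far_apart V (insert {p, q} E) w D (U - {b})"
    proof (rule ccontr)
      assume "\<not> ?thesis"
      then obtain x y where xy: "x \<in> U" "y \<in> U" "x \<noteq> y" "x \<noteq> b" "y \<noteq> b" "?c x y"
        by (auto simp: far_apart_def not_less)
      then obtain e where e: "e \<in> U" "e \<noteq> a" "e \<noteq> b" "?c a e"
        using sh sym by metis
      show False
      proof (cases "d = e")
        case True
        then show False
          using no_close_triangle[OF far ab(1,2) d(1)] ab d e by metis
      next
        case False
        then show False
          using close_pairs_share[OF far ab(2) d(1) ab(1) e(1)] ab d e by metis
      qed
    qed
    then show ?thesis using that by blast
  qed (use that in blast)
qed

text \<open>Each new edge costs at most one vertex of the set.\<close>

lemma far_apart_Un:
  assumes "finite F" "F \<subseteq> [V]\<^bsup>2\<^esup>" "far_apart V E w D U" "finite U"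
  obtains U' where "U' \<subseteq> U" "card U \<le> card U' + card F" "far_apart V (E \<union> F) w D U'"
  using assms
proof (induction F arbitrary: thesis rule: finite_induct)
  case empty
  then show ?case by (metis Un_empty_right add_increasing2 order_refl subset_refl zero_le)
next
  case (insert f F)
  then obtain U' where U': "U' \<subseteq> U" "card U \<le> card U' + card F" "far_apart V (E \<union> F) w D U'"
    by auto
  obtain p q where f: "f = {p, q}"
    using insert.prems by (auto simp: nsets_2_eq)
  have fin: "finite U'"
    using U'(1) insert.prems by (auto intro: finite_subset)
  obtain u where u: "far_apart V (insert {p, q} (E \<union> F)) w D (U' - {u})"
    using far_apart_insert_edge[OF U'(3) fin] by blast
  have "card U' \<le> Suc (card (U' - {u}))"
    using fin by (metis card_Suc_Diff1 Diff_empty Diff_insert0 le_Suc_eq order_refl)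
  then have "card U \<le> card (U' - {u}) + card (insert f F)"
    using U'(2) insert.hyps by simp
  moreover have "U' - {u} \<subseteq> U"
    using U'(1) by blast
  moreover have "E \<union> insert f F = insert {p, q} (E \<union> F)"
    by (simp add: f)
  ultimately show ?case
    using insert.prems(1) u by metis
qed

lemma graph_dist_le_diameter: "u \<in> V \<Longrightarrow> v \<in> V \<Longrightarrow> graph_dist V E w u v \<le> diameter V E w"
  unfolding diameter_def by (meson SUP_upper2 order_refl)

text \<open>What survives all edges of \<open>F\<close> is far apart in a graph of diameter at most
  \<open>D\<close>, hence a single vertex at most.\<close>

lemma far_apart_card_le:
  assumes "finite F" "F \<subseteq> [V]\<^bsup>2\<^esup>" "far_apart V E w D U" "finite U" "U \<subseteq> V"
    and diam: "diameter V (E \<union> F) w \<le> D"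
  shows "card U \<le> Suc (card F)"
proof -
  obtain U' where U': "U' \<subseteq> U" "card U \<le> card U' + card F" "far_apart V (E \<union> F) w D U'"
    using far_apart_Un[OF assms(1-4)] by blast
  have "finite U'"
    using U' assms finite_subset by blast
  have "a = b" if "a \<in> U'" "b \<in> U'" for a b
    using U' assms that graph_dist_le_diameter[of a V b "E \<union> F" w] unfolding far_apart_def
    by (metis leD order_trans subset_iff)
  then have "card U' \<le> 1"
    using \<open>finite U'\<close> by (metis One_nat_def card_le_Suc0_iff_eq)
  then show ?thesis using U'(2) by simp
qed

text \<open>Positive integral costs turn the budget into a bound on the number of new edges; this is
  why \<open>B\<close> governs the numbers of terminals and rounds.\<close>

lemma bcmd_feasible_card:
  assumes "bcmd_instance V E w c" "bcmd_feasible V E c B F"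
  shows "finite F" "card F \<le> B"
proof -
  have "finite ([V]\<^bsup>2\<^esup>)"
    using assms by (simp add: bcmd_instance_def finite_imp_finite_nsets)
  then show "finite F"
    using assms(2) by (meson Diff_subset bcmd_feasible_def finite_subset)
  have "(\<Sum>e\<in>F. 1) \<le> (\<Sum>e\<in>F. c e)"
  proof (rule sum_mono)
    fix e
    assume "e \<in> F"
    then have "e \<in> [V]\<^bsup>2\<^esup>"
      using assms(2) unfolding bcmd_feasible_def by blast
    then show "1 \<le> c e"
      using assms(1) by (simp add: bcmd_instance_def Suc_le_eq)
  qed
  then show "card F \<le> B"
    using assms(2) by (simp add: bcmd_feasible_def)
qed

text \<open>Farthest-first traversal therefore covers the graph with \<open>B + 1\<close> balls of radius \<open>D\<^sub>o\<^sub>p\<^sub>t\<close>.\<close>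

lemma far_apart_D_opt:
  assumes inst: "bcmd_instance V E w c" and "U \<subseteq> V" "far_apart V E w (D_opt V E w c B) U"
  shows "card U \<le> Suc B"
proof -
  obtain F where F: "bcmd_feasible V E c B F" "diameter V (E \<union> F) w = D_opt V E w c B"
    using D_opt_attained by blast
  then have "F \<subseteq> [V]\<^bsup>2\<^esup>"
    by (auto simp: bcmd_feasible_def)
  moreover have "finite U"
    using inst assms(2) by (auto simp: bcmd_instance_def intro: finite_subset)
  ultimately have "card U \<le> Suc (card F)"
    using far_apart_card_le[of F V E w _ U] bcmd_feasible_card[OF inst F(1)] assms F(2) by simp
  then show ?thesis
    using bcmd_feasible_card[OF inst F(1)] by simp
qed

section \<open>Splitting a shortest-path tree at a new edge\<close>

lemma shortest_path_parts:
  assumes p: "path_between V E u v (xs @ x # ys)" and opt: "graph_dist V E w u v = enat (path_weight w (xs @ x # ys))"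
  shows "graph_dist V E w u x = enat (path_weight w (xs @ [x]))"
    and "graph_dist V E w x v = enat (path_weight w (x # ys))"
    and "graph_dist V E w u v = graph_dist V E w u x + graph_dist V E w x v"
proof -
  have "walk V E u v (xs @ x # ys)"
    using p by (simp add: path_between_iff_walk)
  note * = walk_split[OF this]
  have 1: "graph_dist V E w u x \<le> enat (path_weight w (xs @ [x]))"
    "graph_dist V E w x v \<le> enat (path_weight w (x # ys))"
    using graph_dist_le_walk[OF *(1)] graph_dist_le_walk[OF *(2)] by simp_all
  obtain k l where kl: "graph_dist V E w u x = enat k" "graph_dist V E w x v = enat l"
    using 1 by (metis enat_ord_simps(5) not_infinity_eq)
  have "path_weight w (xs @ [x]) + path_weight w (x # ys) \<le> k + l"
    using graph_dist_triangle[of V E w u v x] unfolding opt kl path_weight_append[of w xs x ys] by simp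
  moreover have "k \<le> path_weight w (xs @ [x])" "l \<le> path_weight w (x # ys)"
    using 1 unfolding kl by simp_all
  ultimately have "k = path_weight w (xs @ [x])" "l = path_weight w (x # ys)"
    by linarith+
  then show "graph_dist V E w u x = enat (path_weight w (xs @ [x]))"
    "graph_dist V E w x v = enat (path_weight w (x # ys))"
    "graph_dist V E w u v = graph_dist V E w u x + graph_dist V E w x v"
    unfolding kl opt path_weight_append[of w xs x ys] by simp_all
qed

text \<open>
  Cutting a shortest-path tree with root \<open>v\<close> at the first new edge \<open>{x, y}\<close> of a branch:
  \<open>Y\<close> consists of the vertices with a shortest path from \<open>v\<close> through \<open>y\<close>. Paths to
  vertices in \<open>Y\<close> and paths to vertices outside use disjoint sets of new edges.
\<close>

lemma shortest_path_cut:
  fixes V :: "'a set"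
  assumes pos: "\<And>f. f \<in> F \<Longrightarrow> w f > 0"
    and t: "graph_dist V (E \<union> F) w v t < graph_dist V E w v t"
  obtains x y Y where "{x, y} \<in> F" "x \<in> V" "y \<in> V" "x \<notin> Y" "y \<in> Y" "t \<in> Y"
    "graph_dist V E w v x + enat (w {x, y}) \<le> graph_dist V (E \<union> F) w v y"
    "\<And>u. u \<in> Y \<Longrightarrow> graph_dist V (E \<union> F) w v y + graph_dist V (E \<union> {f \<in> F. f \<subseteq> Y}) w y u
        \<le> graph_dist V (E \<union> F) w v u"
    "\<And>u. u \<in> V - Y \<Longrightarrow> graph_dist V (E \<union> {f \<in> F. f \<inter> Y = {}}) w v u \<le> graph_dist V (E \<union> F) w v u"
proof -
  let ?d = "graph_dist V (E \<union> F) w"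
  obtain k where k: "?d v t = enat k"
    using t by (metis enat_ord_simps(6) not_infinity_eq)
  then obtain p where p: "path_between V (E \<union> F) v t p" "path_weight w p = k"
    by (rule graph_dist_attained)
  have "\<not> walk V E v t p"
    using graph_dist_le_walk[of V E v t p w] t k p(2) by auto
  with p(1) obtain xs x y ys where *: "p = xs @ x # y # ys" "{x, y} \<in> F" "walk V E v x (xs @ [x])"
    unfolding path_between_iff_walk using first_new_edge by metis
  have p_x: "path_between V (E \<union> F) v t (xs @ x # y # ys)" "?d v t = enat (path_weight w (xs @ x # y # ys))"
    using p k * by simp_all
  have p_y: "path_between V (E \<union> F) v t ((xs @ [x]) @ y # ys)" "?d v t = enat (path_weight w ((xs @ [x]) @ y # ys))"
    using p k * by simp_all
  have dx: "?d v x = enat (path_weight w (xs @ [x]))"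
    using shortest_path_parts[OF p_x] by simp
  have dy: "?d v y = enat (path_weight w (xs @ [x]) + w {x, y})"
    using shortest_path_parts(1)[OF p_y] path_weight_append[of w xs x "[y]"] by simp
  \<comment> \<open>Unreachable vertices would satisfy the equation as \<infinity> = \<infinity>;
    they are kept out so that distances can be cancelled.\<close>
  define Y where "Y = {z \<in> V. ?d v z = ?d v y + ?d y z \<and> ?d v z \<noteq> \<infinity>}"
  have V: "x \<in> V" "y \<in> V" "t \<in> V"
    using graph_dist_finite_ends dx dy k by metis+
  show ?thesis
  proof
    show "{x, y} \<in> F" "x \<in> V" "y \<in> V"
      using * V by simp_all
    \<comment> \<open>Here positive weights enter: with weight zero on {x, y}, x could itself lie
      behind y on a shortest path.\<close>
    show "x \<notin> Y"
    proof
      assume "x \<in> Y"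
      then have "?d v y \<le> ?d v x"
        unfolding Y_def by simp
      then show False
        unfolding dx dy using pos[OF *(2)] by simp
    qed
    show "y \<in> Y"
      using V dy by (simp add: Y_def)
    show "t \<in> Y"
      using V k shortest_path_parts(3)[OF p_y] by (simp add: Y_def)
    show "graph_dist V E w v x + enat (w {x, y}) \<le> ?d v y"
      unfolding dy plus_enat_simps(1)[symmetric] using graph_dist_le_walk[OF *(3), of w]
      by (rule add_right_mono)
  next
    fix u
    assume u: "u \<in> Y"
    then obtain l where l: "?d y u = enat l"
      unfolding Y_def by (cases "?d y u") auto
    then obtain q where q: "path_between V (E \<union> F) y u q" "path_weight w q = l"
      by (rule graph_dist_attained)
    \<comment> \<open>A vertex on a shortest path from y to u is itself reached optimally through y,
      so this path needs only new edges inside \<open>Y\<close>.\<close>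
    have "set q \<subseteq> Y"
    proof
      fix z
      assume z: "z \<in> set q"
      then obtain as bs where q_eq: "q = as @ z # bs"
        by (meson split_list)
      then have "path_between V (E \<union> F) y u (as @ z # bs)" "?d y u = enat (path_weight w (as @ z # bs))"
        using q l by simp_all
      note parts = shortest_path_parts[OF this]
      have "?d v u = ?d v y + (?d y z + ?d z u)"
        using u parts(3) unfolding Y_def by simp
      moreover have "?d v u \<le> ?d v z + ?d z u" "?d v z \<le> ?d v y + ?d y z"
        by (rule graph_dist_triangle)+
      moreover have "z \<in> V"
        using q(1) z by (auto simp: path_between_def)
      ultimately show "z \<in> Y"
        unfolding Y_def using parts(1,2) dy
        by (cases "?d v z") (auto simp: plus_enat_simps)
    qed
    moreover have "walk V (E \<union> F) y u q"
      using q(1) by (simp add: path_between_iff_walk)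
    ultimately have "walk V (E \<union> {f \<in> F. f \<subseteq> Y}) y u q"
      by (elim walk_avoid) blast
    then have "graph_dist V (E \<union> {f \<in> F. f \<subseteq> Y}) w y u \<le> ?d y u"
      unfolding l q(2)[symmetric] by (rule graph_dist_le_walk)
    then show "?d v y + graph_dist V (E \<union> {f \<in> F. f \<subseteq> Y}) w y u \<le> ?d v u"
      using u unfolding Y_def by (simp add: add_left_mono)
  next
    fix u
    assume u: "u \<in> V - Y"
    show "graph_dist V (E \<union> {f \<in> F. f \<inter> Y = {}}) w v u \<le> ?d v u"
    proof (cases "?d v u")
      case (enat l)
      then obtain q where q: "path_between V (E \<union> F) v u q" "path_weight w q = l"
        by (rule graph_dist_attained)
      \<comment> \<open>A shortest path from v that met \<open>Y\<close> could be rerouted through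
        y, which would put its end u into \<open>Y\<close>.\<close>
      have "set q \<inter> Y = {}"
      proof (rule ccontr)
        assume "set q \<inter> Y \<noteq> {}"
        then obtain z where z: "z \<in> set q" "z \<in> Y"
          by blast
        then obtain as bs where "q = as @ z # bs"
          by (meson split_list)
        then have "path_between V (E \<union> F) v u (as @ z # bs)" "?d v u = enat (path_weight w (as @ z # bs))"
          using q enat by simp_all
        from shortest_path_parts(3)[OF this] have "?d v u = ?d v y + (?d y z + ?d z u)"
          using z(2) unfolding Y_def by (simp add: add.assoc)
        then have "?d v y + ?d y u \<le> ?d v u"
          using add_left_mono[OF graph_dist_triangle[of V "E \<union> F" w y u z], of "?d v y"] by simp
        with graph_dist_triangle[of V "E \<union> F" w v u y] have "?d v u = ?d v y + ?d y u"
          by (rule order_antisym)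
        then show False
          using u enat by (simp add: Y_def)
      qed
      moreover have "walk V (E \<union> F) v u q"
        using q(1) by (simp add: path_between_iff_walk)
      ultimately have "walk V (E \<union> {f \<in> F. f \<inter> Y = {}}) v u q"
        by (elim walk_avoid) blast
      then show ?thesis
        unfolding enat q(2)[symmetric] by (rule graph_dist_le_walk)
    qed simp
  qed
qed

lemma path_weight_scaled: "path_weight (\<lambda>e. k * w e + 1) p = k * path_weight w p + (length p - 1)"
  unfolding path_weight_def sum.distrib sum_distrib_left by simp


section \<open>Trees of bounded height and cost\<close>

locale bcmd =
  fixes n :: nat and E :: "nat set set" and w c :: "nat set \<Rightarrow> nat" and B :: nat
  assumes inst: "bcmd_instance {..<n} E w c"
begin

text \<open>A bound for every finite distance, whatever edges are added, since a path meets each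
  ordered pair of vertices at most once. Hence \<open>Suc total_weight\<close> can represent
  infinity.\<close>

definition total_weight :: nat where
  "total_weight = (\<Sum>u<n. \<Sum>v<n. if u = v then 0 else w {u, v})"

lemma n_pos: "0 < n"
  using inst by (auto simp: bcmd_instance_def)

lemma path_weight_le_total:
  assumes "path_between {..<n} E' u v p"
  shows "path_weight w p \<le> total_weight"
proof -
  let ?g = "\<lambda>i. (p ! i, p ! Suc i)"
  let ?w = "\<lambda>(u, v). if u = v then 0 else w {u, v}"
  have p: "distinct p" "set p \<subseteq> {..<n}"
    using assms by (simp_all add: path_between_def)
  have nth: "p ! i < n" if "i < length p" for i
    using p that nth_mem by blast
  have ne: "p ! i \<noteq> p ! Suc i" if "i < length p - 1" for i
    using p(1) that by (simp add: nth_eq_iff_index_eq)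
  have "path_weight w p = (\<Sum>i<length p - 1. ?w (?g i))"
    unfolding path_weight_def by (rule sum.cong) (use ne in auto)
  also have "\<dots> = sum ?w (?g ` {..<length p - 1})"
    by (subst sum.reindex) (use p(1) in \<open>auto simp: inj_on_def nth_eq_iff_index_eq\<close>)
  also have "\<dots> \<le> sum ?w ({..<n} \<times> {..<n})"
    by (rule sum_mono2) (use nth in auto)
  also have "\<dots> = total_weight"
    by (simp add: total_weight_def sum.cartesian_product)
  finally show ?thesis .
qed

lemma graph_dist_le_total: "graph_dist {..<n} E' w u v = enat k \<Longrightarrow> k \<le> total_weight"
  using graph_dist_attained path_weight_le_total by metis

lemma path_length_le:
  assumes "path_between {..<n} E' u v p"
  shows "length p \<le> n"
  using assms card_mono[of "{..<n}" "set p"] by (auto simp: path_between_def distinct_card)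

end

text \<open>The existence of cheap trees rests on \<open>D\<close> not overestimating distances in
  the original graph. The opposite inequality serves the soundness of the table and is added in
  \<open>bcmd_table\<close>.\<close>

locale bcmd_terminals = bcmd +
  fixes D :: "nat \<Rightarrow> nat \<Rightarrow> nat" and U :: "nat \<Rightarrow> nat"
  assumes U_less: "i < B \<Longrightarrow> U i < n"
    and D_le: "u < n \<Longrightarrow> v < n \<Longrightarrow> enat (D u v) \<le> graph_dist {..<n} E w u v"
begin

text \<open>
  \<open>tree r b v S x\<close>: within \<open>r\<close> rounds of the dynamic program a tree of height \<open>x\<close> with root \<open>v\<close>
  is assembled that reaches the terminals \<open>U i\<close>, \<open>i \<in> S\<close>, and uses new edges of cost at most \<open>b\<close>.
\<close>

inductive tree :: "nat \<Rightarrow> nat \<Rightarrow> nat \<Rightarrow> nat set \<Rightarrow> nat \<Rightarrow> bool" where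
  base: "b \<le> B \<Longrightarrow> v < n \<Longrightarrow> i < B \<Longrightarrow> tree 0 b v {i} (D v (U i))"
| keep: "tree r b v S x \<Longrightarrow> tree (Suc r) b v S x"
| merge: "tree r b1 v S1 x \<Longrightarrow> tree r b2 v S2 y \<Longrightarrow> b1 + b2 \<le> B \<Longrightarrow> S1 \<inter> S2 = {} \<Longrightarrow>
    tree (Suc r) (b1 + b2) v (S1 \<union> S2) (max x y)"
| edge: "tree r b u S x \<Longrightarrow> {v, u} \<in> [{..<n}]\<^bsup>2\<^esup> - E \<Longrightarrow> b + c {v, u} \<le> B \<Longrightarrow>
    tree (Suc r) (b + c {v, u}) v S (w {v, u} + x)"
| move: "tree r b u S x \<Longrightarrow> v < n \<Longrightarrow> tree (Suc r) b v S (D v u + x)"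

lemma tree_bounds: "tree r b v S x \<Longrightarrow> b \<le> B \<and> v < n \<and> S \<subseteq> {..<B}"
  by (induction rule: tree.induct) auto

lemma tree_mono:
  assumes "tree r b v S x" "r \<le> r'"
  shows "tree r' b v S x"
  using assms(2) by (induction r' rule: dec_induct) (auto intro: assms(1) keep)

text \<open>A path of at most \<open>n\<close> vertices that is shortest for \<open>w1\<close> is shortest for \<open>w\<close>, but \<open>w1\<close> is positive.\<close>

abbreviation w1 :: "nat set \<Rightarrow> nat" where
  "w1 e \<equiv> n * w e + 1"

lemma D_le_w1:
  assumes "u < n" "v < n"
  shows "enat (n * D u v) \<le> graph_dist {..<n} E w1 u v"
proof (cases "graph_dist {..<n} E w1 u v")
  case (enat k)
  then obtain p where p: "path_between {..<n} E u v p" "path_weight w1 p = k"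
    by (rule graph_dist_attained)
  have "enat (D u v) \<le> enat (path_weight w p)"
    using D_le[OF assms] graph_dist_le_path[OF p(1)] by (rule order_trans)
  then show ?thesis
    unfolding enat p(2)[symmetric] path_weight_scaled by (simp add: trans_le_add1)
qed simp

text \<open>The induction measure 2 * card F + card S also bounds the rounds: an \<open>edge\<close>
  step followed by a \<open>move\<close> uses up one new edge, which pays for two rounds, and a
  \<open>merge\<close> divides \<open>S\<close> into two nonempty parts, which pays for one. Heights
  occur as n * x \<le> l because l is a bound with respect to \<open>w1\<close>.\<close>

lemma tree_exists:
  assumes "F \<subseteq> [{..<n}]\<^bsup>2\<^esup> - E" "S \<noteq> {}" "S \<subseteq> {..<B}" "v < n"
    and "\<And>i. i \<in> S \<Longrightarrow> graph_dist {..<n} (E \<union> F) w1 v (U i) \<le> enat l"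
    and "sum c F \<le> b" "b \<le> B" "2 * card F + card S \<le> r"
  shows "\<exists>x. tree r b v S x \<and> n * x \<le> l"
  using assms
proof (induction "2 * card F + card S" arbitrary: F S v l b r rule: less_induct)
  case less
  let ?d = "\<lambda>F. graph_dist {..<n} (E \<union> F) w1"
  have fin_nsets: "finite ([{..<n}]\<^bsup>2\<^esup>)"
    by (simp add: finite_imp_finite_nsets)
  have fin: "finite F" "finite S"
    using less.prems(1,3) fin_nsets by (meson Diff_subset finite_subset finite_lessThan)+
  show ?case
  proof (cases "\<exists>t\<in>S. \<not> ?d {} v (U t) \<le> enat l")
    case False
    then have G: "\<And>i. i \<in> S \<Longrightarrow> ?d {} v (U i) \<le> enat l"
      by blast
    obtain i where i: "i \<in> S"
      using less.prems by blast
    have "enat (n * D v (U i)) \<le> enat l"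
      using D_le_w1[of v "U i"] G[OF i] i less.prems U_less[of i] by (simp add: subset_iff) (meson order_trans enat_ord_simps(1))
    then have nD: "n * D v (U i) \<le> l"
      by simp
    have b0: "tree 0 b' v {i} (D v (U i))" if "b' \<le> B" for b'
      using i less.prems that by (auto intro: base)
    show ?thesis
    proof (cases "S = {i}")
      case True
      then show ?thesis
        using tree_mono[OF b0] nD less.prems by blast
    next
      case False
      let ?S = "S - {i}"
      have "card ?S < card S"
        using fin i by (meson card_Diff1_less)
      then obtain m where m: "r = Suc m" "card ?S \<le> m"
        using less.prems by (cases r) auto
      have "\<exists>x. tree m b v ?S x \<and> n * x \<le> l"
        by (rule less.hyps[of "{}"]) (use G less.prems \<open>card ?S < card S\<close> m False i in auto)
      then obtain x where x: "tree m b v ?S x" "n * x \<le> l"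
        by blast
      \<comment> \<open>Without new edges the single terminal takes budget 0, and the others keep
        all of b.\<close>
      have "tree (Suc m) (0 + b) v ({i} \<union> ?S) (max (D v (U i)) x)"
        by (rule merge[OF tree_mono[OF b0] x(1)]) (use less.prems in auto)
      moreover have "{i} \<union> ?S = S"
        using i by blast
      moreover have "n * max (D v (U i)) x \<le> l"
        using nD x(2) by (simp add: max_def)
      ultimately show ?thesis
        using m(1) by auto
    qed
  next
    case True
    then obtain t where t: "t \<in> S" "enat l < ?d {} v (U t)"
      by (auto simp: not_le)
    \<comment> \<open>Some terminal profits from \<open>F\<close>, so its shortest path has a first
      new edge {x, y}, at which the tree is cut.\<close>
    then have lt: "?d F v (U t) < graph_dist {..<n} E w1 v (U t)"
      using order_le_less_trans[OF less.prems(5)[OF t(1)] t(2)] by simp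
    obtain x y Y where xy: "{x, y} \<in> F" "x \<in> {..<n}" "y \<in> {..<n}" "x \<notin> Y" "y \<in> Y" "U t \<in> Y"
      and dy: "graph_dist {..<n} E w1 v x + enat (w1 {x, y}) \<le> ?d F v y"
      and inY: "\<And>u. u \<in> Y \<Longrightarrow> ?d F v y + ?d {f \<in> F. f \<subseteq> Y} y u \<le> ?d F v u"
      and outY: "\<And>u. u \<in> {..<n} - Y \<Longrightarrow> ?d {f \<in> F. f \<inter> Y = {}} v u \<le> ?d F v u"
      by (rule shortest_path_cut[OF _ lt]) simp_all
    define F1 where "F1 = {f \<in> F. f \<subseteq> Y}"
    define F2 where "F2 = {f \<in> F. f \<inter> Y = {}}"
    define S1 where "S1 = {i \<in> S. U i \<in> Y}"
    define S2 where "S2 = S - S1"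
    have bound_t: "?d F v y + ?d {f \<in> F. f \<subseteq> Y} y (U t) \<le> enat l"
      using inY[OF xy(6)] less.prems(5)[OF t(1)] by (rule order_trans)
    then obtain k where k: "?d F v y = enat k"
      by (cases "?d F v y") auto
    \<comment> \<open>The piece from v to x uses original edges only, so a single
      \<open>move\<close> can replace it.\<close>
    have D_xy: "n * D v x + n * w {x, y} + 1 \<le> k"
    proof -
      have "enat (n * D v x) + enat (w1 {x, y}) \<le> enat k"
        by (rule order_trans[OF add_right_mono[OF D_le_w1] dy[unfolded k]]) (use less.prems(4) xy(2) in auto)
      then show ?thesis by simp
    qed
    have sub: "F1 \<subseteq> F - {{x, y}}" "F2 \<subseteq> F"
      using xy unfolding F1_def F2_def by auto
    have card_F1: "card F1 < card F"
      using sub xy fin by (metis card_Diff1_less card_mono finite_Diff order_le_less_trans)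
    have card_F2: "card F2 \<le> card F"
      using sub fin by (simp add: card_mono)
    have S12: "S1 \<union> S2 = S" "S1 \<inter> S2 = {}" "S1 \<noteq> {}"
      using t xy unfolding S1_def S2_def by auto
    have card_S: "card S1 + card S2 = card S"
      using S12 fin by (metis card_Un_disjoint finite_Un)
    have disj: "F1 \<inter> F2 = {}" "{x, y} \<notin> F2"
      using xy less.prems(1) unfolding F1_def F2_def by (auto simp: nsets_2_eq)
    have "sum c F1 + c {x, y} + sum c F2 = sum c (insert {x, y} F1 \<union> F2)"
    proof -
      have "finite F1" "finite F2" "{x, y} \<notin> F1"
        using sub fin by (auto intro: finite_subset)
      then show ?thesis
        using disj by (simp add: sum.union_disjoint)
    qed
    also have "\<dots> \<le> sum c F"
      using sub xy fin by (intro sum_mono2) auto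
    finally have cost: "sum c F1 + c {x, y} + sum c F2 \<le> b"
      using less.prems(6) by linarith
    \<comment> \<open>Stated for any number m of rounds and any budget b': if S2 is empty, this part
      receives everything, and otherwise only its own cost and one round less.\<close>
    have part1: "\<exists>h. tree m b' v S1 h \<and> n * h \<le> l"
      if b': "sum c F1 + c {x, y} \<le> b'" "b' \<le> B" and m: "2 * card F + card S1 \<le> m" for m b'
    proof -
      \<comment> \<open>F1 lacks {x, y}, so two rounds are left for \<open>edge\<close> and
        \<open>move\<close>.\<close>
      have "m = Suc (Suc (m - 2))" "2 * card F1 + card S1 \<le> m - 2"
        using m card_F1 by linarith+
      then obtain m' where m': "m = Suc (Suc m')" "2 * card F1 + card S1 \<le> m'"
        by blast
      have "\<exists>h. tree m' (b' - c {x, y}) y S1 h \<and> n * h \<le> l - k"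
      proof (rule less.hyps[of F1])
        fix i
        assume i: "i \<in> S1"
        then have "U i \<in> Y" "i \<in> S"
          by (simp_all add: S1_def)
        then have "enat k + ?d F1 y (U i) \<le> enat l"
          unfolding F1_def k[symmetric] by (intro order_trans[OF inY less.prems(5)])
        then show "?d F1 y (U i) \<le> enat (l - k)"
          by (cases "?d F1 y (U i)") auto
      qed (use less.prems xy sub S12 card_F1 card_S b' m' in auto)
      then obtain h where h: "tree m' (b' - c {x, y}) y S1 h" "n * h \<le> l - k"
        by blast
      have "k \<le> l"
        using bound_t unfolding k
        by (cases "?d {f \<in> F. f \<subseteq> Y} y (U t)"; cases "?d F v (U t)") auto
      have "tree (Suc m') (b' - c {x, y} + c {x, y}) x S1 (w {x, y} + h)"
        by (rule edge[OF h(1)]) (use xy less.prems b' in auto)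
      then have "tree m (b' - c {x, y} + c {x, y}) v S1 (D v x + (w {x, y} + h))"
        unfolding m'(1) using less.prems by (intro move)
      moreover have "b' - c {x, y} + c {x, y} = b'"
        using b' by simp
      moreover have "n * (D v x + (w {x, y} + h)) \<le> l"
        using D_xy h(2) \<open>k \<le> l\<close> by (simp add: distrib_left)
      ultimately show ?thesis by metis
    qed
    show ?thesis
    proof (cases "S2 = {}")
      case True
      then have "S1 = S" using S12 by blast
      then show ?thesis
        using part1[of b r] cost less.prems by simp
    next
      case False
      then have "0 < card S2"
        using fin S2_def by (simp add: card_gt_0_iff)
      then obtain m where m: "r = Suc m" "2 * card F + card S1 \<le> m"
        using less.prems(8) card_S by (cases r) auto
      have "0 < card S1"
        using fin S12 S1_def by (simp add: card_gt_0_iff)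
      then have m2: "2 * card F + card S2 \<le> m" "card S2 < card S"
        using less.prems(8) card_S m(1) by auto
      obtain h1 where h1: "tree m (sum c F1 + c {x, y}) v S1 h1" "n * h1 \<le> l"
        using part1[OF order_refl _ m(2)] cost less.prems(7) by auto
      \<comment> \<open>All of the remaining budget goes to the second part, so that the merged tree
        is listed under exactly b.\<close>
      have "\<exists>h. tree m (b - (sum c F1 + c {x, y})) v S2 h \<and> n * h \<le> l"
      proof (rule less.hyps[of F2])
        fix i
        assume i: "i \<in> S2"
        then have "U i \<in> {..<n} - Y" "i \<in> S"
          using less.prems(3) U_less unfolding S1_def S2_def by auto
        then show "?d F2 v (U i) \<le> enat l"
          unfolding F2_def by (intro order_trans[OF outY less.prems(5)])
      qed (use less.prems sub m2 card_F2 cost False S2_def in auto)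
      then obtain h2 where h2: "tree m (b - (sum c F1 + c {x, y})) v S2 h2" "n * h2 \<le> l"
        by blast
      have "tree (Suc m) (sum c F1 + c {x, y} + (b - (sum c F1 + c {x, y}))) v (S1 \<union> S2) (max h1 h2)"
        by (rule merge[OF h1(1) h2(1)]) (use less.prems(7) cost S12 in auto)
      moreover have "n * max h1 h2 \<le> l"
        using h1 h2 by (simp add: max_def)
      ultimately show ?thesis
        using cost m(1) S12(1) by auto
    qed
  qed
qed

lemma tree_D_opt:
  assumes "D_opt {..<n} E w c B = enat d" "0 < B" "v < n"
  obtains x where "tree (B + B + B) B v {..<B} x" "x \<le> d"
proof -
  obtain F where F: "bcmd_feasible {..<n} E c B F" "diameter {..<n} (E \<union> F) w = enat d"
    using D_opt_attained assms(1) by metis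
  have "\<exists>x. tree (B + B + B) B v {..<B} x \<and> n * x \<le> n * d + (n - 1)"
  proof (rule tree_exists)
    fix i
    assume "i \<in> {..<B}"
    then have "graph_dist {..<n} (E \<union> F) w v (U i) \<le> enat d"
      using graph_dist_le_diameter[of v "{..<n}" "U i" "E \<union> F" w] U_less assms(3) F(2) by simp
    then obtain k where k: "graph_dist {..<n} (E \<union> F) w v (U i) = enat k" "k \<le> d"
      by (cases "graph_dist {..<n} (E \<union> F) w v (U i)") auto
    then obtain p where p: "path_between {..<n} (E \<union> F) v (U i) p" "path_weight w p = k"
      using graph_dist_attained by metis
    \<comment> \<open>The summand 1 per edge in \<open>w1\<close> contributes at most n - 1 to a
      path and therefore disappears on division by n.\<close>
    have "path_weight w1 p \<le> n * d + (n - 1)"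
      unfolding path_weight_scaled using p(2) k(2) path_length_le[OF p(1)] by (simp add: add_le_mono)
    then show "graph_dist {..<n} (E \<union> F) w1 v (U i) \<le> enat (n * d + (n - 1))"
      using graph_dist_le_path[OF p(1), of w1] by (meson enat_ord_simps(1) order_trans)
  qed (use F bcmd_feasible_card[OF inst F(1)] assms in \<open>auto simp: bcmd_feasible_def\<close>)
  then obtain x where x: "tree (B + B + B) B v {..<B} x" "n * x \<le> n * d + (n - 1)"
    by blast
  have "x \<le> d"
  proof (rule ccontr)
    assume "\<not> ?thesis"
    then have "n * Suc d \<le> n * x"
      by (intro mult_le_mono) auto
    then show False
      using x(2) n_pos by simp
  qed
  with x(1) show ?thesis using that by blast
qed

end

section \<open>Total correctness with a time bound\<close>

text \<open>One run within the bound suffices, since runs are unique by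
  \<open>exec_deterministic\<close>.\<close>

definition ok :: "com \<Rightarrow> state \<Rightarrow> nat \<Rightarrow> (state \<Rightarrow> bool) \<Rightarrow> bool" where
  "ok p s T Q \<longleftrightarrow> (\<exists>t s'. exec p s t s' \<and> t \<le> T \<and> Q s')"

lemma ok_mono: "ok p s T Q \<Longrightarrow> T \<le> T' \<Longrightarrow> (\<And>t. Q t \<Longrightarrow> Q' t) \<Longrightarrow> ok p s T' Q'"
  unfolding ok_def by (meson order_trans)

lemma ok_Seq:
  assumes "ok p s T1 R" "\<And>t. R t \<Longrightarrow> ok q t T2 Q"
  shows "ok (Seq p q) s (T1 + T2) Q"
  using assms unfolding ok_def by (meson add_mono exec.Seq)

fun wr :: "com \<Rightarrow> string set" where
  "wr (Assign x e) = {x}"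
| "wr (Seq p q) = wr p \<union> wr q"
| "wr (If b p q) = wr p \<union> wr q"
| "wr (While b p) = wr p"
| "wr _ = {}"

fun wa :: "com \<Rightarrow> string set" where
  "wa (Write a i e) = {a}"
| "wa (Seq p q) = wa p \<union> wa q"
| "wa (If b p q) = wa p \<union> wa q"
| "wa (While b p) = wa p"
| "wa _ = {}"

definition same :: "string set \<Rightarrow> string set \<Rightarrow> state \<Rightarrow> state \<Rightarrow> bool" where
  "same W A s t \<longleftrightarrow> (\<forall>x. x \<notin> W \<longrightarrow> fst t x = fst s x) \<and> (\<forall>a. a \<notin> A \<longrightarrow> snd t a = snd s a)"

abbreviation effect :: "com \<Rightarrow> state \<Rightarrow> state \<Rightarrow> bool" where
  "effect p \<equiv> same (wr p) (wa p)"

text \<open>What any number of iterations of \<open>For x e p\<close> may change, its counter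
  included.\<close>

abbreviation frame :: "string \<Rightarrow> com \<Rightarrow> state \<Rightarrow> state \<Rightarrow> bool" where
  "frame x p \<equiv> same (insert x (wr p)) (wa p)"

lemma same_refl [simp]: "same W A s s"
  by (simp add: same_def)

lemma same_trans: "same W A s t \<Longrightarrow> same W' A' t u \<Longrightarrow> same (W \<union> W') (A \<union> A') s u"
  by (auto simp: same_def)

lemma exec_same: "exec p s t s' \<Longrightarrow> effect p s s'"
  by (induction rule: exec.induct) (auto simp: same_def)

lemma ok_frame: "ok p s T Q \<Longrightarrow> ok p s T (\<lambda>t. Q t \<and> effect p s t)"
  unfolding ok_def using exec_same by blast

fun loopfree :: "com \<Rightarrow> bool" where
  "loopfree (Seq p q) \<longleftrightarrow> loopfree p \<and> loopfree q"
| "loopfree (If b p q) \<longleftrightarrow> loopfree p \<and> loopfree q"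
| "loopfree (While b p) \<longleftrightarrow> False"
| "loopfree _ \<longleftrightarrow> True"

fun run :: "com \<Rightarrow> state \<Rightarrow> state" where
  "run (Assign x e) s = ((fst s)(x := aval e s), snd s)"
| "run (Write a i e) s = (fst s, (snd s)(a := (snd s a)(aval i s := aval e s)))"
| "run (Seq p q) s = run q (run p s)"
| "run (If b p q) s = (if bval b s then run p s else run q s)"
| "run _ s = s"

text \<open>A conditional is charged for both branches; for a fixed loop-free program this affects
  only a constant.\<close>

fun tmax :: "com \<Rightarrow> nat" where
  "tmax (Assign x e) = 1 + acost e"
| "tmax (Write a i e) = 1 + acost i + acost e"
| "tmax (Seq p q) = tmax p + tmax q"
| "tmax (If b p q) = 1 + bcost b + (tmax p + tmax q)"
| "tmax _ = 1"

lemma exec_loopfree: "loopfree p \<Longrightarrow> \<exists>t. exec p s t (run p s) \<and> t \<le> tmax p"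
proof (induction p arbitrary: s)
  case (Seq p q)
  obtain t1 t2 where "exec p s t1 (run p s)" "t1 \<le> tmax p"
    "exec q (run p s) t2 (run q (run p s))" "t2 \<le> tmax q"
    using Seq by (metis loopfree.simps(1))
  then have "exec (Seq p q) s (t1 + t2) (run (Seq p q) s)" "t1 + t2 \<le> tmax (Seq p q)"
    by (auto intro: exec.Seq)
  then show ?case by blast
next
  case (If b p q)
  show ?case
  proof (cases "bval b s")
    case True
    obtain t where "exec p s t (run p s)" "t \<le> tmax p"
      using If by (metis loopfree.simps(2))
    then have "exec (If b p q) s (1 + bcost b + t) (run (If b p q) s)" "1 + bcost b + t \<le> tmax (If b p q)"
      using True by (auto simp only: run.simps if_True tmax.simps intro: exec.IfTrue)
    then show ?thesis by blast
  next
    case False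
    obtain t where "exec q s t (run q s)" "t \<le> tmax q"
      using If by (metis loopfree.simps(2))
    then have "exec (If b p q) s (1 + bcost b + t) (run (If b p q) s)" "1 + bcost b + t \<le> tmax (If b p q)"
      using False by (auto simp only: run.simps if_False tmax.simps intro: exec.IfFalse)
    then show ?thesis by blast
  qed
next
  case (Assign x e)
  show ?case
    using exec.Assign[of x e s] by auto
next
  case (Write a i e)
  show ?case
    using exec.Write[of a i e s] by auto
next
  case Skip
  show ?case
    using exec.Skip[of s] by auto
qed simp

lemma ok_loopfree: "loopfree p \<Longrightarrow> Q (run p s) \<Longrightarrow> tmax p \<le> T \<Longrightarrow> ok p s T Q"
  unfolding ok_def using exec_loopfree by (meson order_trans)

definition For :: "string \<Rightarrow> aexp \<Rightarrow> com \<Rightarrow> com" where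
  "For x e p = Seq (Assign x (Const 0))
     (While (Less (Reg x) e) (Seq p (Assign x (Plus (Reg x) (Const 1)))))"

lemma wr_For [simp]: "wr (For x e p) = insert x (wr p)"
  and wa_For [simp]: "wa (For x e p) = wa p"
  by (auto simp: For_def)

definition set_reg :: "string \<Rightarrow> nat \<Rightarrow> state \<Rightarrow> state" where
  "set_reg x k s = ((fst s)(x := k), snd s)"

lemma set_reg_simps [simp]:
  "fst (set_reg x k s) = (fst s)(x := k)" "snd (set_reg x k s) = snd s"
  by (simp_all add: set_reg_def)

lemma same_set_reg: "same W A s t \<Longrightarrow> x \<in> W \<Longrightarrow> same W A s (set_reg x k t)"
  by (auto simp: same_def)

text \<open>The bound e is evaluated anew before each iteration, so its value must persist. The
  invariant is indexed by the iteration and must be insensitive to the counter register, which is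
  incremented only after the body. An iteration costs T for the body, acost e + 3 for the test and 4
  for the increment, whence the 7; the initial assignment and the last test fit into the additional
  summand of N + 1.\<close>

lemma ok_For:
  fixes s :: state
  assumes x: "x \<notin> wr p"
    and bound: "\<And>t. frame x p s t \<Longrightarrow> aval e t = N"
    and init: "I 0 s"
    and insens: "\<And>i k t. i \<le> N \<Longrightarrow> I i t \<Longrightarrow> I i (set_reg x k t)"
    and body: "\<And>i t. i < N \<Longrightarrow> I i t \<Longrightarrow> fst t x = i \<Longrightarrow>
      frame x p s t \<Longrightarrow> ok p t T (I (Suc i))"
    and time: "(N + 1) * (T + acost e + 7) \<le> T'"
  shows "ok (For x e p) s T' (I N)"
proof -
  let ?W = "While (Less (Reg x) e) (Seq p (Assign x (Plus (Reg x) (Const 1))))"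
  let ?same = "frame x p s"
  have loop: "\<exists>u t'. exec ?W t u t' \<and> u \<le> (N - i) * (T + acost e + 7) + (acost e + 3) \<and> I N t' \<and> ?same t'"
    if "i \<le> N" "I i t" "fst t x = i" "?same t" for i t
    using that
  proof (induction "N - i" arbitrary: i t)
    case 0
    then have "\<not> bval (Less (Reg x) e) t"
      using bound by simp
    from exec.WhileFalse[OF this, of "Seq p (Assign x (Plus (Reg x) (Const 1)))"] show ?case
      using 0 by (intro exI[of _ "1 + bcost (Less (Reg x) e)"] exI[of _ t]) auto
  next
    case (Suc d)
    then have "i < N" by simp
    then obtain u1 t1 where 1: "exec p t u1 t1" "u1 \<le> T" "I (Suc i) t1"
      using body Suc.prems unfolding ok_def by blast
    have s1: "effect p t t1"
      using 1(1) by (rule exec_same)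
    then have "fst t1 x = i"
      using x Suc.prems by (simp add: same_def)
    let ?t2 = "set_reg x (Suc i) t1"
    have 2: "exec (Assign x (Plus (Reg x) (Const 1))) t1 4 ?t2"
      using exec.Assign[of x "Plus (Reg x) (Const 1)" t1] \<open>fst t1 x = i\<close>
      by (simp add: set_reg_def eval_nat_numeral)
    have "?same t1"
      using same_trans[OF Suc.prems(4) s1] by (simp add: insert_absorb Un_absorb)
    then have same2: "?same ?t2"
      by (rule same_set_reg) simp
    obtain u3 t3 where 3: "exec ?W ?t2 u3 t3" "u3 \<le> (N - Suc i) * (T + acost e + 7) + (acost e + 3)"
      "I N t3" "?same t3"
    proof -
      have "d = N - Suc i" "Suc i \<le> N" "fst ?t2 x = Suc i"
        using Suc.hyps(2) \<open>i < N\<close> by simp_all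
      from Suc.hyps(1)[OF this(1,2) insens[OF this(2) 1(3)] this(3) same2] that show thesis
        by blast
    qed
    have "bval (Less (Reg x) e) t"
      using \<open>i < N\<close> Suc.prems bound by simp
    from exec.WhileTrue[OF this exec.Seq[OF 1(1) 2] 3(1)]
    have "exec ?W t (1 + bcost (Less (Reg x) e) + (u1 + 4) + u3) t3" .
    moreover have "N - i = Suc (N - Suc i)"
      using \<open>i < N\<close> by simp
    then have "1 + bcost (Less (Reg x) e) + (u1 + 4) + u3 \<le> (N - i) * (T + acost e + 7) + (acost e + 3)"
      using 1(2) 3(2) by simp
    ultimately show ?case
      using 3 by blast
  qed
  have 0: "exec (Assign x (Const 0)) s 2 (set_reg x 0 s)"
    using exec.Assign[of x "Const 0" s] by (simp add: set_reg_def eval_nat_numeral)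
  have "?same (set_reg x 0 s)"
    by (rule same_set_reg) simp_all
  from loop[OF le0 insens[OF le0 init] _ this]
  obtain u t where u: "exec ?W (set_reg x 0 s) u t" "u \<le> N * (T + acost e + 7) + (acost e + 3)"
    "I N t" "?same t"
    unfolding diff_zero by (metis fun_upd_same set_reg_simps(1))
  have "exec (For x e p) s (2 + u) t"
    unfolding For_def using exec.Seq[OF 0 u(1)] .
  moreover have "2 + u \<le> T'"
    using u(2) time by simp
  ultimately show ?thesis
    using u unfolding ok_def by blast
qed

text \<open>
  For loops whose iterations establish their effects \<open>P i\<close> independently of each other: \<open>J\<close>
  relates the states before and after any part of the computation and preserves each \<open>P i\<close>.
\<close>

lemma ok_For_stable:
  fixes s :: state
  assumes x: "x \<notin> wr p"
    and bound: "\<And>t. frame x p s t \<Longrightarrow> aval e t = N"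
    and J_refl: "\<And>t. J t t" and J_trans: "\<And>t u v. J t u \<Longrightarrow> J u v \<Longrightarrow> J t v"
    and J_set: "\<And>t k. J t (set_reg x k t)"
    and stable: "\<And>i t u. i < N \<Longrightarrow> P i t \<Longrightarrow> J t u \<Longrightarrow> P i u"
    and body: "\<And>i t. i < N \<Longrightarrow> J s t \<Longrightarrow> fst t x = i \<Longrightarrow>
      frame x p s t \<Longrightarrow> ok p t T (\<lambda>u. J t u \<and> P i u)"
    and time: "(N + 1) * (T + acost e + 7) \<le> T'"
  shows "ok (For x e p) s T' (\<lambda>t. J s t \<and> (\<forall>i<N. P i t))"
proof (rule ok_For[OF x bound, where I = "\<lambda>k t. J s t \<and> (\<forall>i<k. P i t)" and T = T])
  fix i t
  assume *: "i < N" "J s t \<and> (\<forall>j<i. P j t)" "fst t x = i" "frame x p s t"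
  then have "ok p t T (\<lambda>u. J t u \<and> P i u)"
    by (intro body) auto
  then show "ok p t T (\<lambda>t. J s t \<and> (\<forall>j<Suc i. P j t))"
  proof (rule ok_mono)
    fix u
    assume "J t u \<and> P i u"
    then show "J s u \<and> (\<forall>j<Suc i. P j u)"
      using * J_trans stable by (metis less_Suc_eq less_trans)
  qed simp
next
  fix i k t
  assume "i \<le> N" "J s t \<and> (\<forall>j<i. P j t)"
  then show "J s (set_reg x k t) \<and> (\<forall>j<i. P j (set_reg x k t))"
    using J_trans J_set stable by (meson order_less_le_trans)
qed (use J_refl time in auto)


text \<open>Used for the number of allocated nodes, so that a final pass over them takes no longer than the rounds.\<close>

fun counts_in :: "string \<Rightarrow> com \<Rightarrow> bool" where
  "counts_in g (Assign x e) \<longleftrightarrow> x \<noteq> g \<or> e = Plus (Reg g) (Const 1)"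
| "counts_in g (Seq p q) \<longleftrightarrow> counts_in g p \<and> counts_in g q"
| "counts_in g (If b p q) \<longleftrightarrow> counts_in g p \<and> counts_in g q"
| "counts_in g (While b p) \<longleftrightarrow> counts_in g p"
| "counts_in g _ \<longleftrightarrow> True"

lemma exec_counts_in: "exec p s t s' \<Longrightarrow> counts_in g p \<Longrightarrow> fst s' g \<le> fst s g + t"
  by (induction rule: exec.induct) auto

lemma ok_counts_in: "ok p s T Q \<Longrightarrow> counts_in g p \<Longrightarrow> ok p s T (\<lambda>t. Q t \<and> fst t g \<le> fst s g + T)"
  unfolding ok_def by (meson add_left_mono exec_counts_in order_trans)

lemma counts_in_For [simp]: "counts_in g (For x e p) \<longleftrightarrow> x \<noteq> g \<and> counts_in g p"
  by (auto simp: For_def)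

section \<open>Tables\<close>

abbreviation seq (infixr ";;" 60) where "p ;; q \<equiv> Seq p q"
abbreviation assign (infix "::=" 61) where "x ::= e \<equiv> Assign x e"
abbreviation plus_aexp (infixl "\<oplus>" 65) where "a \<oplus> b \<equiv> Plus a b"

text \<open>Without multiplication, products used as addresses are tabulated by repeated addition.
  The register y ends at N times the step and can serve as the step of a further table.\<close>

definition multiples :: "string \<Rightarrow> string \<Rightarrow> string \<Rightarrow> string \<Rightarrow> aexp \<Rightarrow> com" where
  "multiples a y d x e =
     y ::= Const 0 ;;
     For x e (Write a (Reg x) (Reg y) ;; y ::= Reg y \<oplus> Reg d)"

lemma ok_multiples:
  assumes "x \<noteq> y" "y \<noteq> d" "x \<noteq> d" "fst s d = k"
    and bound: "\<And>t. same {x, y} {a} s t \<Longrightarrow> aval e t = N"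
  shows "ok (multiples a y d x e) s ((N + 1) * (acost e + 16))
    (\<lambda>t. fst t y = N * k \<and> (\<forall>i<N. snd t a i = i * k))"
proof -
  let ?p = "Write a (Reg x) (Reg y) ;; y ::= Reg y \<oplus> Reg d"
  have 1: "ok (y ::= Const 0) s 2 (\<lambda>t. t = set_reg y 0 s)"
    by (rule ok_loopfree) (simp_all add: set_reg_def)
  have 2: "ok (For x e ?p) (set_reg y 0 s) ((N + 1) * (7 + acost e + 7))
    (\<lambda>t. fst t y = N * k \<and> (\<forall>i<N. snd t a i = i * k))"
  proof (rule ok_For[where T = 7 and I = "\<lambda>j t. fst t y = j * k \<and> (\<forall>i<j. snd t a i = i * k)"])
    fix t
    assume "frame x ?p (set_reg y 0 s) t"
    then show "aval e t = N"
      by (intro bound) (auto simp: same_def)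
  next
    fix i t
    assume "fst t y = i * k \<and> (\<forall>j<i. snd t a j = j * k)" "fst t x = i"
      "frame x ?p (set_reg y 0 s) t"
    then show "ok ?p t 7 (\<lambda>t. fst t y = Suc i * k \<and> (\<forall>j<Suc i. snd t a j = j * k))"
      using assms(1-4) by (intro ok_loopfree) (auto simp: same_def)
  qed (use assms in auto)
  have "ok (multiples a y d x e) s (2 + (N + 1) * (7 + acost e + 7))
    (\<lambda>t. fst t y = N * k \<and> (\<forall>i<N. snd t a i = i * k))"
    unfolding multiples_def by (rule ok_Seq[OF 1]) (use 2 in simp)
  then show ?thesis
    by (rule ok_mono) simp_all
qed


text \<open>These are the pairs that a merge may combine. Each element has three possibilities,
  whence 3 ^ m instead of 4 ^ m; and for disjoint sets the code of the union is the sum of the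
  codes, which replaces bit operations.\<close>

definition is_splits :: "nat \<Rightarrow> (nat \<Rightarrow> nat) \<Rightarrow> (nat \<Rightarrow> nat) \<Rightarrow> bool" where
  "is_splits m L R \<longleftrightarrow>
     (\<forall>x<3 ^ m. \<exists>S1 S2. S1 \<inter> S2 = {} \<and> S1 \<union> S2 \<subseteq> {..<m} \<and> L x = set_encode S1 \<and> R x = set_encode S2) \<and>
     (\<forall>S1 S2. S1 \<inter> S2 = {} \<longrightarrow> S1 \<union> S2 \<subseteq> {..<m} \<longrightarrow>
       (\<exists>x<3 ^ m. L x = set_encode S1 \<and> R x = set_encode S2))"

text \<open>Three consecutive blocks of length 3 ^ m correspond to m lying in neither set, in the
  first and in the second.\<close>

lemma is_splits_Suc:
  assumes "is_splits m L R"
    and eq: "\<And>x. x < 3 ^ m \<Longrightarrow> L' x = L x \<and> R' x = R x \<and>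
      L' (3 ^ m + x) = L x + 2 ^ m \<and> R' (3 ^ m + x) = R x \<and>
      L' (3 ^ m + 3 ^ m + x) = L x \<and> R' (3 ^ m + 3 ^ m + x) = R x + 2 ^ m"
  shows "is_splits (Suc m) L' R'"
proof -
  have ins: "set_encode (insert m S) = set_encode S + 2 ^ m" if "S \<subseteq> {..<m}" for S
    using that by (subst set_encode_insert) (auto intro: finite_subset)
  note ex = conjunct1[OF assms(1)[unfolded is_splits_def], rule_format]
  note comp = conjunct2[OF assms(1)[unfolded is_splits_def], rule_format]
  have sound: "\<exists>S1 S2. S1 \<inter> S2 = {} \<and> S1 \<union> S2 \<subseteq> {..<Suc m} \<and> L' x = set_encode S1 \<and> R' x = set_encode S2"
    if x: "x < 3 ^ Suc m" for x
  proof -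
    consider "x < 3 ^ m" | y where "x = 3 ^ m + y" "y < 3 ^ m" | y where "x = 3 ^ m + 3 ^ m + y" "y < 3 ^ m"
    proof -
      have "x < 3 ^ m \<or> x - 3 ^ m < 3 ^ m \<and> x = 3 ^ m + (x - 3 ^ m) \<or>
        x - (3 ^ m + 3 ^ m) < 3 ^ m \<and> x = 3 ^ m + 3 ^ m + (x - (3 ^ m + 3 ^ m))"
        using x unfolding power_Suc by linarith
      then show thesis
        using that by blast
    qed
    then show ?thesis
    proof cases
      case 1
      obtain S1 S2 where *: "S1 \<inter> S2 = {}" "S1 \<union> S2 \<subseteq> {..<m}" "L x = set_encode S1" "R x = set_encode S2"
        using ex[OF 1] by (elim exE conjE)
      then show ?thesis
        using eq[OF 1] by (intro exI[of _ S1] exI[of _ S2]) auto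
    next
      case (2 y)
      obtain S1 S2 where *: "S1 \<inter> S2 = {}" "S1 \<union> S2 \<subseteq> {..<m}" "L y = set_encode S1" "R y = set_encode S2"
        using ex[OF 2(2)] by (elim exE conjE)
      then show ?thesis
        using eq[OF 2(2)] 2(1) ins[of S1] by (intro exI[of _ "insert m S1"] exI[of _ S2]) auto
    next
      case (3 y)
      obtain S1 S2 where *: "S1 \<inter> S2 = {}" "S1 \<union> S2 \<subseteq> {..<m}" "L y = set_encode S1" "R y = set_encode S2"
        using ex[OF 3(2)] by (elim exE conjE)
      then show ?thesis
        using eq[OF 3(2)] 3(1) ins[of S2] by (intro exI[of _ S1] exI[of _ "insert m S2"]) auto
    qed
  qed
  have complete: "\<exists>x<3 ^ Suc m. L' x = set_encode S1 \<and> R' x = set_encode S2"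
    if S: "S1 \<inter> S2 = {}" "S1 \<union> S2 \<subseteq> {..<Suc m}" for S1 S2
  proof -
    let ?S1 = "S1 - {m}" and ?S2 = "S2 - {m}"
    have sub: "?S1 \<inter> ?S2 = {}" "?S1 \<union> ?S2 \<subseteq> {..<m}"
      using S by (auto simp: less_Suc_eq)
    then obtain x where x: "x < 3 ^ m" "L x = set_encode ?S1" "R x = set_encode ?S2"
      using comp[OF sub] by (elim exE conjE)
    note e = eq[OF x(1)]
    consider "m \<notin> S1" "m \<notin> S2" | "m \<in> S1" "m \<notin> S2" | "m \<notin> S1" "m \<in> S2"
      using S by blast
    then show ?thesis
    proof cases
      case 1
      then show ?thesis
        using x e by (intro exI[of _ x]) auto
    next
      case 2
      then have "set_encode S1 = set_encode ?S1 + 2 ^ m"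
        using ins[of ?S1] sub by (simp add: insert_absorb)
      then show ?thesis
        using x e 2 by (intro exI[of _ "3 ^ m + x"]) auto
    next
      case 3
      then have "set_encode S2 = set_encode ?S2 + 2 ^ m"
        using ins[of ?S2] sub by (simp add: insert_absorb)
      then show ?thesis
        using x e 3 by (intro exI[of _ "3 ^ m + 3 ^ m + x"]) auto
    qed
  qed
  show ?thesis
    unfolding is_splits_def by (intro conjI allI impI sound complete)
qed

text \<open>
  The digit \<open>i\<close> of \<open>x\<close> to base 3 tells whether \<open>i\<close> belongs to neither set (\<open>0\<close>), to the first (\<open>1\<close>)
  or to the second one (\<open>2\<close>); \<open>p\<close> and \<open>q\<close> hold \<open>2 ^ i\<close> and \<open>3 ^ i\<close>.
\<close>

definition splits_step :: com where
  "splits_step =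
     Write ''L'' (Reg ''q'' \<oplus> Reg ''x'') (Read ''L'' (Reg ''x'') \<oplus> Reg ''p'') ;;
     Write ''R'' (Reg ''q'' \<oplus> Reg ''x'') (Read ''R'' (Reg ''x'')) ;;
     Write ''L'' (Reg ''q'' \<oplus> Reg ''q'' \<oplus> Reg ''x'') (Read ''L'' (Reg ''x'')) ;;
     Write ''R'' (Reg ''q'' \<oplus> Reg ''q'' \<oplus> Reg ''x'') (Read ''R'' (Reg ''x'') \<oplus> Reg ''p'')"

definition splits :: com where
  "splits =
     ''p'' ::= Const 1 ;; ''q'' ::= Const 1 ;;
     For ''i'' (Reg ''B'') (
       For ''x'' (Reg ''q'') splits_step ;;
       ''p'' ::= Reg ''p'' \<oplus> Reg ''p'' ;;
       ''q'' ::= Reg ''q'' \<oplus> (Reg ''q'' \<oplus> Reg ''q''))"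

lemma wr_splits_step [simp]: "wr splits_step = {}" "wa splits_step = {''L'', ''R''}"
  by (auto simp: splits_step_def)

lemma ok_splits_inner:
  assumes "fst s ''p'' = 2 ^ m" "fst s ''q'' = 3 ^ m" "is_splits m (snd s ''L'') (snd s ''R'')"
  shows "ok (For ''x'' (Reg ''q'') splits_step) s ((3 ^ m + 1) * 50)
    (\<lambda>t. is_splits (Suc m) (snd t ''L'') (snd t ''R'') \<and> fst t ''p'' = 2 ^ m \<and> fst t ''q'' = 3 ^ m)"
proof -
  let ?L = "snd s ''L''" and ?R = "snd s ''R''"
  let ?I = "\<lambda>j (t :: state).
    (\<forall>x<3 ^ m. snd t ''L'' x = ?L x \<and> snd t ''R'' x = ?R x) \<and>
    (\<forall>x<j. snd t ''L'' (3 ^ m + x) = ?L x + 2 ^ m \<and> snd t ''R'' (3 ^ m + x) = ?R x \<and>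
      snd t ''L'' (3 ^ m + 3 ^ m + x) = ?L x \<and> snd t ''R'' (3 ^ m + 3 ^ m + x) = ?R x + 2 ^ m)"
  have "ok (For ''x'' (Reg ''q'') splits_step) s ((3 ^ m + 1) * 50) (?I (3 ^ m))"
  proof (rule ok_For[where I = ?I and T = 40])
    fix j t
    assume *: "j < 3 ^ m" "?I j t" "fst t ''x'' = j"
      "frame ''x'' splits_step s t"
    then have pq: "fst t ''p'' = 2 ^ m" "fst t ''q'' = 3 ^ m"
      using assms by (simp_all add: same_def)
    have LR: "snd t ''L'' j = ?L j" "snd t ''R'' j = ?R j"
      using * by auto
    show "ok splits_step t 40 (?I (Suc j))"
      by (rule ok_loopfree) (use * pq LR in \<open>auto simp: splits_step_def less_Suc_eq\<close>)
  qed (use assms in \<open>auto simp: same_def\<close>)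
  then show ?thesis
  proof (rule ok_mono[OF ok_frame])
    fix t
    assume t: "?I (3 ^ m) t \<and> effect (For ''x'' (Reg ''q'') splits_step) s t"
    have "is_splits (Suc m) (snd t ''L'') (snd t ''R'')"
      by (rule is_splits_Suc[OF assms(3)]) (use t in blast)
    then show "is_splits (Suc m) (snd t ''L'') (snd t ''R'') \<and> fst t ''p'' = 2 ^ m \<and> fst t ''q'' = 3 ^ m"
      using t assms by (simp add: same_def)
  qed simp
qed

text \<open>Zero memory already encodes the only pair of subsets of the empty set, and the block for
  digit 0 is the previous table, so only the other two blocks are ever written.\<close>

lemma ok_splits:
  assumes B: "fst s ''B'' = B" and 0: "snd s ''L'' 0 = 0" "snd s ''R'' 0 = 0"
  shows "ok splits s ((B + 1) * ((3 ^ B + 1) * 50 + 18) + 4)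
    (\<lambda>t. fst t ''p'' = 2 ^ B \<and> fst t ''q'' = 3 ^ B \<and> is_splits B (snd t ''L'') (snd t ''R''))"
proof -
  let ?I = "\<lambda>j (t :: state). fst t ''p'' = 2 ^ j \<and> fst t ''q'' = 3 ^ j \<and> is_splits j (snd t ''L'') (snd t ''R'')"
  let ?b = "For ''x'' (Reg ''q'') splits_step ;;
       ''p'' ::= Reg ''p'' \<oplus> Reg ''p'' ;;
       ''q'' ::= Reg ''q'' \<oplus> (Reg ''q'' \<oplus> Reg ''q'')"
  have loop: "ok (For ''i'' (Reg ''B'') ?b) s' ((B + 1) * ((3 ^ B + 1) * 50 + 18)) (?I B)"
    if "?I 0 s'" "fst s' ''B'' = B" for s'
  proof (rule ok_For[where I = ?I and T = "(3 ^ B + 1) * 50 + 10"])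
    fix j t
    assume *: "j < B" "?I j t" "fst t ''i'' = j"
    have "ok (For ''x'' (Reg ''q'') splits_step) t ((3 ^ B + 1) * 50)
      (\<lambda>t. is_splits (Suc j) (snd t ''L'') (snd t ''R'') \<and> fst t ''p'' = 2 ^ j \<and> fst t ''q'' = 3 ^ j)"
      by (rule ok_mono[OF ok_splits_inner[of t j]]) (use * in \<open>auto intro: power_increasing\<close>)
    then show "ok ?b t ((3 ^ B + 1) * 50 + 10) (?I (Suc j))"
      by (rule ok_Seq) (rule ok_loopfree, auto)
  qed (use that in \<open>auto simp: same_def\<close>)
  have 1: "ok (''p'' ::= Const 1) s 2 (\<lambda>t. t = set_reg ''p'' 1 s)"
    by (rule ok_loopfree) (simp_all add: set_reg_def)
  have 2: "ok (''q'' ::= Const 1) t 2 (\<lambda>u. ?I 0 u \<and> fst u ''B'' = B)" if "t = set_reg ''p'' 1 s" for t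
    by (rule ok_loopfree) (use that B 0 in \<open>simp_all add: is_splits_def\<close>)
  have "ok splits s (2 + (2 + (B + 1) * ((3 ^ B + 1) * 50 + 18))) (?I B)"
    unfolding splits_def by (rule ok_Seq[OF 1 ok_Seq[OF 2 loop]]) simp_all
  then show ?thesis
    by (rule ok_mono) simp_all
qed

section \<open>Distances and terminals\<close>

lemma mat_index_eq:
  assumes "u < n" "u' < (n :: nat)"
  shows "v * n + u = v' * n + u' \<longleftrightarrow> v = v' \<and> u = u'"
proof
  assume eq: "v * n + u = v' * n + u'"
  have "(v * n + u) div n = v" "(v' * n + u') div n = v'" "(v * n + u) mod n = u" "(v' * n + u') mod n = u'"
    using assms by auto
  then show "v = v' \<and> u = u'"
    using eq by metis
qed simp

lemma mat_index_less:
  assumes "v < n" "u < (n :: nat)"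
  shows "v * n + u < n * n"
proof -
  have "v * n + u < Suc v * n"
    using assms by simp
  also have "\<dots> \<le> n * n"
    using assms by (intro mult_le_mono1) simp
  finally show ?thesis .
qed

lemma pair_matrix_index:
  assumes "v < n" "u < n"
  shows "pair_matrix n f (v * n + u) = (if v = u then 0 else f {v, u})"
  using assms mat_index_less[OF assms] by (simp add: pair_matrix_def row_major_def)

text \<open>Register \<open>z\<close> receives a number larger than any finite distance, which serves as infinity.\<close>

definition sum_weights :: com where
  "sum_weights = ''z'' ::= Const 1 ;;
     For ''v'' (Reg ''n'') (For ''u'' (Reg ''n'')
       (''z'' ::= Reg ''z'' \<oplus> Read ''w'' (Read ''M'' (Reg ''v'') \<oplus> Reg ''u'')))"

text \<open>\<open>E\<close> is zero on the diagonal, so v = u fails the first test; equality is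
  then detected by two negated comparisons.\<close>

definition init_dist_step :: com where
  "init_dist_step =
     ''j'' ::= Read ''M'' (Reg ''v'') \<oplus> Reg ''u'' ;;
     If (Less (Const 0) (Read ''E'' (Reg ''j''))) (Write ''D'' (Reg ''j'') (Read ''w'' (Reg ''j'')))
       (If (Conj (Neg (Less (Reg ''v'') (Reg ''u''))) (Neg (Less (Reg ''u'') (Reg ''v''))))
          (Write ''D'' (Reg ''j'') (Const 0)) (Write ''D'' (Reg ''j'') (Reg ''z'')))"

definition init_dist :: com where
  "init_dist = For ''v'' (Reg ''n'') (For ''u'' (Reg ''n'') init_dist_step)"

definition floyd_step :: com where
  "floyd_step =
     ''m'' ::= Read ''D'' (Read ''M'' (Reg ''v'') \<oplus> Reg ''k'') \<oplus> Read ''D'' (Read ''M'' (Reg ''k'') \<oplus> Reg ''u'') ;;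
     ''j'' ::= Read ''M'' (Reg ''v'') \<oplus> Reg ''u'' ;;
     If (Less (Reg ''m'') (Read ''D'' (Reg ''j''))) (Write ''D'' (Reg ''j'') (Reg ''m'')) Skip"

definition floyd :: com where
  "floyd = For ''k'' (Reg ''n'') (For ''v'' (Reg ''n'') (For ''u'' (Reg ''n'') floyd_step))"

definition nearer :: com where
  "nearer = ''j'' ::= Read ''D'' (Read ''M'' (Reg ''m'') \<oplus> Reg ''v'') ;;
     If (Less (Reg ''j'') (Read ''t'' (Reg ''v''))) (Write ''t'' (Reg ''v'') (Reg ''j'')) Skip"

definition farthest :: com where
  "farthest = If (Less (Read ''t'' (Reg ''m'')) (Read ''t'' (Reg ''v''))) (''m'' ::= Reg ''v'') Skip"

text \<open>Vertex 0 is the first centre, so the array t starts as row 0 of \<open>D\<close>, which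
  needs no offset. From then on it holds the distances to the nearest centre.\<close>

definition farthest_first :: com where
  "farthest_first =
     For ''v'' (Reg ''n'') (Write ''t'' (Reg ''v'') (Read ''D'' (Reg ''v''))) ;;
     For ''i'' (Reg ''B'') (
       ''m'' ::= Const 0 ;;
       For ''v'' (Reg ''n'') farthest ;;
       Write ''U'' (Reg ''i'') (Reg ''m'') ;;
       For ''v'' (Reg ''n'') nearer)"

lemma wr_steps [simp]:
  "wr init_dist_step = {''j''}" "wa init_dist_step = {''D''}"
  "wr floyd_step = {''m'', ''j''}" "wa floyd_step = {''D''}"
  "wr nearer = {''j''}" "wa nearer = {''t''}"
  "wr farthest = {''m''}" "wa farthest = {}"
  by (auto simp: init_dist_step_def floyd_step_def nearer_def farthest_def)

context bcmd
begin

definition input :: "state \<Rightarrow> bool" where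
  "input s \<longleftrightarrow> fst s ''n'' = n \<and> fst s ''B'' = B \<and>
     snd s ''E'' = pair_matrix n (\<lambda>e. if e \<in> E then 1 else 0) \<and>
     snd s ''w'' = pair_matrix n w \<and> snd s ''c'' = pair_matrix n c \<and>
     (\<forall>v<n. snd s ''M'' v = v * n)"

lemma input_same:
  assumes "input s" "same W A s t" "''n'' \<notin> W" "''B'' \<notin> W" "A \<inter> {''E'', ''w'', ''c'', ''M''} = {}"
  shows "input t"
  using assms by (simp add: input_def same_def)

lemma total_weight_eq: "total_weight = (\<Sum>v<n. \<Sum>u<n. pair_matrix n w (v * n + u))"
  unfolding total_weight_def by (intro sum.cong) (auto simp: pair_matrix_index)

lemma ok_sum_weights:
  assumes "input s"
  shows "ok sum_weights s ((n + 1) * ((n + 1) * 16 + 8) + 2) (\<lambda>t. fst t ''z'' = Suc total_weight)"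
proof -
  let ?p = "''z'' ::= Reg ''z'' \<oplus> Read ''w'' (Read ''M'' (Reg ''v'') \<oplus> Reg ''u'')"
  let ?f = "\<lambda>v u. pair_matrix n w (v * n + u)"
  have inner: "ok (For ''u'' (Reg ''n'') ?p) t ((n + 1) * 16) (\<lambda>t. fst t ''z'' = x + (\<Sum>u<n. ?f v u))"
    if "input t" "fst t ''v'' = v" "v < n" "fst t ''z'' = x" for t v x
  proof (rule ok_For[where T = 8 and I = "\<lambda>j t'. fst t' ''z'' = x + (\<Sum>u<j. ?f v u)"])
    fix i t'
    assume *: "fst t' ''z'' = x + (\<Sum>u<i. ?f v u)" "fst t' ''u'' = i"
      "frame ''u'' ?p t t'"
    have "input t'"
      using that(1) *(3) by (rule input_same) simp_all
    moreover have "fst t' ''v'' = v"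
      using *(3) that(2) by (simp add: same_def)
    ultimately show "ok ?p t' 8 (\<lambda>t'. fst t' ''z'' = x + (\<Sum>u<Suc i. ?f v u))"
      using *(1,2) that(3) by (intro ok_loopfree) (simp_all add: input_def)
  qed (use that in \<open>auto simp: input_def same_def\<close>)
  have outer: "ok (For ''v'' (Reg ''n'') (For ''u'' (Reg ''n'') ?p)) t ((n + 1) * ((n + 1) * 16 + 8))
      (\<lambda>t'. fst t' ''z'' = 1 + (\<Sum>v<n. \<Sum>u<n. ?f v u))"
    if "input t" "fst t ''z'' = 1" for t
  proof (rule ok_For[where T = "(n + 1) * 16" and I = "\<lambda>j t'. fst t' ''z'' = 1 + (\<Sum>v<j. \<Sum>u<n. ?f v u)"])
    fix i t'
    assume *: "i < n" "fst t' ''z'' = 1 + (\<Sum>v<i. \<Sum>u<n. ?f v u)" "fst t' ''v'' = i"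
      "frame ''v'' (For ''u'' (Reg ''n'') ?p) t t'"
    have "input t'"
      using that(1) *(4) by (rule input_same) simp_all
    from inner[OF this *(3,1,2)]
    show "ok (For ''u'' (Reg ''n'') ?p) t' ((n + 1) * 16) (\<lambda>t'. fst t' ''z'' = 1 + (\<Sum>v<Suc i. \<Sum>u<n. ?f v u))"
      by (rule ok_mono) simp_all
  qed (use that in \<open>auto simp: input_def same_def\<close>)
  have 1: "ok (''z'' ::= Const 1) s 2 (\<lambda>t. input t \<and> fst t ''z'' = 1)"
    by (rule ok_loopfree) (use assms in \<open>simp_all add: input_def\<close>)
  have "ok sum_weights s (2 + (n + 1) * ((n + 1) * 16 + 8)) (\<lambda>t. fst t ''z'' = 1 + (\<Sum>v<n. \<Sum>u<n. ?f v u))"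
    unfolding sum_weights_def by (rule ok_Seq[OF 1 outer]) simp_all
  then show ?thesis
    unfolding total_weight_eq by (rule ok_mono) simp_all
qed

definition edge_dist :: "nat \<Rightarrow> nat \<Rightarrow> nat" where
  "edge_dist v u = (if v = u then 0 else if {v, u} \<in> E then w {v, u} else Suc total_weight)"

lemma edge_nonloop: "{v} \<notin> E"
  using inst by (auto simp: bcmd_instance_def nsets_2_eq doubleton_eq_iff)

lemma ok_init_dist:
  assumes "input s" "fst s ''z'' = Suc total_weight"
  shows "ok init_dist s ((n + 1) * ((n + 1) * 50 + 8))
    (\<lambda>t. \<forall>v<n. \<forall>u<n. snd t ''D'' (v * n + u) = edge_dist v u)"
proof -
  let ?P = "\<lambda>v u (t :: state). snd t ''D'' (v * n + u) = edge_dist v u"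
  \<comment> \<open>A cell that has its correct value keeps it, which makes the iterations
    independent.\<close>
  let ?J = "\<lambda>(s :: state) (t :: state). \<forall>v u. v < n \<longrightarrow> u < n \<longrightarrow> ?P v u s \<longrightarrow> ?P v u t"
  have step: "ok init_dist_step t 42 (\<lambda>t'. ?J t t' \<and> ?P v u t')"
    if "input t" "fst t ''z'' = Suc total_weight" "fst t ''v'' = v" "fst t ''u'' = u" "v < n" "u < n" for t v u
    by (rule ok_loopfree)
       (use that edge_nonloop in \<open>auto simp: init_dist_step_def input_def pair_matrix_index edge_dist_def mat_index_eq\<close>)
  have inner: "ok (For ''u'' (Reg ''n'') init_dist_step) t ((n + 1) * 50) (\<lambda>t'. ?J t t' \<and> (\<forall>u<n. ?P v u t'))"
    if "input t" "fst t ''z'' = Suc total_weight" "fst t ''v'' = v" "v < n" for t v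
  proof (rule ok_For_stable[where J = ?J and T = 42])
    fix u t'
    assume *: "u < n" "fst t' ''u'' = u" "frame ''u'' init_dist_step t t'"
    have "input t'"
      using that(1) *(3) by (rule input_same) simp_all
    then show "ok init_dist_step t' 42 (\<lambda>t''. ?J t' t'' \<and> ?P v u t'')"
      using step[of t' v u] * that by (simp add: same_def)
  qed (use that in \<open>auto simp: input_def same_def\<close>)
  show ?thesis
    unfolding init_dist_def
  proof (rule ok_mono)
    show "ok (For ''v'' (Reg ''n'') (For ''u'' (Reg ''n'') init_dist_step)) s ((n + 1) * ((n + 1) * 50 + 8))
      (\<lambda>t. ?J s t \<and> (\<forall>v<n. \<forall>u<n. ?P v u t))"
    proof (rule ok_For_stable[where J = ?J and T = "(n + 1) * 50"])
      fix v t
      assume *: "v < n" "fst t ''v'' = v" "frame ''v'' (For ''u'' (Reg ''n'') init_dist_step) s t"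
      have "input t"
        using assms(1) *(3) by (rule input_same) simp_all
      then show "ok (For ''u'' (Reg ''n'') init_dist_step) t ((n + 1) * 50) (\<lambda>t'. ?J t t' \<and> (\<forall>u<n. ?P v u t'))"
        using inner[of t v] * assms by (simp add: same_def)
    qed (use assms in \<open>auto simp: input_def same_def\<close>)
  qed auto
qed

section \<open>Invariants of the Floyd-Warshall computation\<close>

definition dist_sound :: "(nat \<Rightarrow> nat) \<Rightarrow> bool" where
  "dist_sound A \<longleftrightarrow> (\<forall>v<n. \<forall>u<n. A (v * n + u) \<le> total_weight \<longrightarrow>
     graph_dist {..<n} E w v u \<le> enat (A (v * n + u)))"

text \<open>The invariant of phase k, where butlast (tl p) lists the inner vertices of a path. As an
  inequality it tolerates entries that fall early through in-place updates; for k = n it determines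
  all finite distances together with \<open>dist_sound\<close>.\<close>

definition dist_complete :: "nat \<Rightarrow> (nat \<Rightarrow> nat) \<Rightarrow> bool" where
  "dist_complete k A \<longleftrightarrow> (\<forall>v u p. path_between {..<n} E v u p \<longrightarrow> set (butlast (tl p)) \<subseteq> {..<k} \<longrightarrow>
     A (v * n + u) \<le> path_weight w p)"

lemma dist_sound_upd:
  assumes "dist_sound A" "v < n" "u < n" "k < n"
  shows "dist_sound (A(v * n + u := A (v * n + k) + A (k * n + u)))"
proof -
  have "graph_dist {..<n} E w v u \<le> enat (A (v * n + k) + A (k * n + u))"
    if "A (v * n + k) + A (k * n + u) \<le> total_weight"
  proof -
    have "graph_dist {..<n} E w v u \<le> graph_dist {..<n} E w v k + graph_dist {..<n} E w k u"
      by (rule graph_dist_triangle)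
    also have "\<dots> \<le> enat (A (v * n + k)) + enat (A (k * n + u))"
      using assms that by (intro add_mono) (auto simp: dist_sound_def)
    finally show ?thesis by simp
  qed
  then show ?thesis
    using assms by (auto simp: dist_sound_def mat_index_eq)
qed

lemma dist_edge_dist:
  assumes "\<forall>v<n. \<forall>u<n. A (v * n + u) = edge_dist v u"
  shows "dist_sound A" "dist_complete 0 A"
proof -
  show "dist_sound A"
    unfolding dist_sound_def using assms graph_dist_edge[of _ _ E "{..<n}" w]
    by (auto simp: edge_dist_def)
  show "dist_complete 0 A"
    unfolding dist_complete_def
  proof (intro allI impI)
    fix v u p
    assume p: "path_between {..<n} E v u p" "set (butlast (tl p)) \<subseteq> {..<0}"
    have "v < n" "u < n"
      using path_between_ends[OF p(1)] by simp_all
    then have A: "A (v * n + u) = edge_dist v u"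
      using assms by blast
    from p consider "p = [v]" "v = u" | "p = [v, u]"
      unfolding path_between_def
      by (cases p; cases "tl p"; cases "tl (tl p)") (auto split: if_splits)
    then show "A (v * n + u) \<le> path_weight w p"
      using p(1) A by cases (auto simp: edge_dist_def path_between_iff_walk walk_def)
  qed
qed

text \<open>A path meets k at most once, so the two pieces of a path through k have inner vertices
  below k, and the matrix \<open>A\<close> before the phase bounds their weights.\<close>

lemma dist_complete_Suc:
  assumes A: "dist_complete k A" and le: "\<And>i. A' i \<le> A i"
    and new: "\<And>v u. v < n \<Longrightarrow> u < n \<Longrightarrow> A' (v * n + u) \<le> A (v * n + k) + A (k * n + u)"
  shows "dist_complete (Suc k) A'"
  unfolding dist_complete_def
proof (intro allI impI)
  fix v u p
  assume p: "path_between {..<n} E v u p" "set (butlast (tl p)) \<subseteq> {..<Suc k}"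
  show "A' (v * n + u) \<le> path_weight w p"
  proof (cases "k \<in> set (butlast (tl p))")
    case False
    then have "set (butlast (tl p)) \<subseteq> {..<k}"
      using p(2) by (auto simp: less_Suc_eq)
    then have "A (v * n + u) \<le> path_weight w p"
      using A p(1) by (simp add: dist_complete_def)
    then show ?thesis
      using le order_trans by blast
  next
    case True
    then obtain m1 m2 where m: "butlast (tl p) = m1 @ k # m2"
      by (meson split_list)
    then have "tl p \<noteq> []"
      by auto
    then have eq: "p = (v # m1) @ k # (m2 @ [u])"
      using m p(1) unfolding path_between_def
      by (metis append_Cons append_assoc append_butlast_last_id last_tl list.collapse)
    have "walk {..<n} E v u ((v # m1) @ k # (m2 @ [u]))" and dist: "distinct ((v # m1) @ k # (m2 @ [u]))"
      using p(1) unfolding eq path_between_iff_walk by blast+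
    from walk_split[OF this(1)]
    have paths: "path_between {..<n} E v k ((v # m1) @ [k])" "path_between {..<n} E k u (k # (m2 @ [u]))"
      using dist unfolding path_between_iff_walk by auto
    have "set (butlast (tl ((v # m1) @ [k]))) \<subseteq> {..<k}" "set (butlast (tl (k # (m2 @ [u])))) \<subseteq> {..<k}"
      using p(2) dist unfolding m by (auto simp: less_Suc_eq)
    then have "A (v * n + k) \<le> path_weight w ((v # m1) @ [k])" "A (k * n + u) \<le> path_weight w (k # (m2 @ [u]))"
      using A paths unfolding dist_complete_def by blast+
    moreover have "A' (v * n + u) \<le> A (v * n + k) + A (k * n + u)"
      using path_between_ends[OF p(1)] by (intro new) simp_all
    ultimately show ?thesis
      unfolding eq path_weight_append[of w "v # m1" k "m2 @ [u]"] by linarith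
  qed
qed

lemma dist_complete_n:
  assumes "dist_complete n A"
  shows "enat (A (v * n + u)) \<le> graph_dist {..<n} E w v u"
  unfolding graph_dist_def
proof (rule INF_greatest)
  fix p
  assume "p \<in> {p. path_between {..<n} E v u p}"
  moreover from this have "set (butlast (tl p)) \<subseteq> {..<n}"
    by (auto simp: path_between_def dest!: in_set_butlastD list.set_sel(2)[rotated])
  ultimately show "enat (A (v * n + u)) \<le> enat (path_weight w p)"
    using assms by (simp add: dist_complete_def)
qed

text \<open>\<open>A\<close> stands for the matrix at the start of phase k. Entries only decrease,
  so a sum read in the middle of the phase is still at most the sum of the old entries.\<close>

lemma ok_floyd_inner:
  assumes "input s" "fst s ''k'' = k" "fst s ''v'' = v" "k < n" "v < n" "\<And>i. snd s ''D'' i \<le> A i"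
  shows "ok (For ''u'' (Reg ''n'') floyd_step) s ((n + 1) * 50)
    (\<lambda>t. (dist_sound (snd s ''D'') \<longrightarrow> dist_sound (snd t ''D'')) \<and> (\<forall>i. snd t ''D'' i \<le> snd s ''D'' i) \<and>
      (\<forall>u<n. snd t ''D'' (v * n + u) \<le> A (v * n + k) + A (k * n + u)))"
proof -
  let ?J = "\<lambda>(s :: state) (t :: state). (dist_sound (snd s ''D'') \<longrightarrow> dist_sound (snd t ''D'')) \<and>
    (\<forall>i. snd t ''D'' i \<le> snd s ''D'' i)"
  let ?P = "\<lambda>u (t :: state). snd t ''D'' (v * n + u) \<le> A (v * n + k) + A (k * n + u)"
  have "ok (For ''u'' (Reg ''n'') floyd_step) s ((n + 1) * 50) (\<lambda>t. ?J s t \<and> (\<forall>u<n. ?P u t))"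
  proof (rule ok_For_stable[where J = ?J and T = 42])
    fix u t
    assume *: "u < n" "?J s t" "fst t ''u'' = u" "frame ''u'' floyd_step s t"
    have "input t"
      using assms(1) *(4) by (rule input_same) simp_all
    moreover have "fst t ''k'' = k" "fst t ''v'' = v"
      using *(4) assms by (simp_all add: same_def)
    moreover have "snd t ''D'' (v * n + k) + snd t ''D'' (k * n + u) \<le> A (v * n + k) + A (k * n + u)"
      using *(2) assms(6) by (meson add_mono order_trans)
    ultimately show "ok floyd_step t 42 (\<lambda>t'. ?J t t' \<and> ?P u t')"
      using * assms dist_sound_upd[of "snd t ''D''" v u k]
      by (intro ok_loopfree) (auto simp: floyd_step_def input_def)
  next
    fix i and t t' :: state
    assume "?P i t" "?J t t'"
    then show "?P i t'"
      by (meson order_trans)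
  next
    fix t t' t'' :: state
    assume "?J t t'" "?J t' t''"
    then show "?J t t''"
      by (meson order_trans)
  qed (use assms in \<open>auto simp: input_def same_def\<close>)
  then show ?thesis
    by (rule ok_mono) simp_all
qed

lemma ok_floyd_middle:
  assumes "input s" "fst s ''k'' = k" "k < n" "dist_sound (snd s ''D'')" "dist_complete k (snd s ''D'')"
  shows "ok (For ''v'' (Reg ''n'') (For ''u'' (Reg ''n'') floyd_step)) s ((n + 1) * ((n + 1) * 50 + 8))
    (\<lambda>t. dist_sound (snd t ''D'') \<and> dist_complete (Suc k) (snd t ''D''))"
proof -
  let ?p = "For ''u'' (Reg ''n'') floyd_step" and ?A = "snd s ''D''"
  let ?J = "\<lambda>(s :: state) (t :: state). (dist_sound (snd s ''D'') \<longrightarrow> dist_sound (snd t ''D'')) \<and>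
    (\<forall>i. snd t ''D'' i \<le> snd s ''D'' i)"
  let ?P = "\<lambda>v (t :: state). \<forall>u<n. snd t ''D'' (v * n + u) \<le> ?A (v * n + k) + ?A (k * n + u)"
  have "ok (For ''v'' (Reg ''n'') ?p) s ((n + 1) * ((n + 1) * 50 + 8)) (\<lambda>t. ?J s t \<and> (\<forall>v<n. ?P v t))"
  proof (rule ok_For_stable[where J = ?J and T = "(n + 1) * 50"])
    fix v t
    assume *: "v < n" "?J s t" "fst t ''v'' = v" "frame ''v'' ?p s t"
    have "input t"
      using assms(1) *(4) by (rule input_same) simp_all
    moreover have "fst t ''k'' = k"
      using *(4) assms by (simp add: same_def)
    ultimately show "ok ?p t ((n + 1) * 50) (\<lambda>t'. ?J t t' \<and> ?P v t')"
      using * assms(3) by (intro ok_mono[OF ok_floyd_inner[of t k v ?A]]) auto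
  next
    fix i and t t' :: state
    assume "?P i t" "?J t t'"
    then show "?P i t'"
      by (meson order_trans)
  next
    fix t t' t'' :: state
    assume "?J t t'" "?J t' t''"
    then show "?J t t''"
      by (meson order_trans)
  qed (use assms in \<open>auto simp: input_def same_def\<close>)
  then show ?thesis
    by (rule ok_mono) (use assms dist_complete_Suc[of k ?A] in auto)
qed

lemma ok_floyd:
  assumes "input s" "dist_sound (snd s ''D'')" "dist_complete 0 (snd s ''D'')"
  shows "ok floyd s ((n + 1) * ((n + 1) * ((n + 1) * 50 + 8) + 8))
    (\<lambda>t. dist_sound (snd t ''D'') \<and> dist_complete n (snd t ''D''))"
proof -
  let ?p = "For ''v'' (Reg ''n'') (For ''u'' (Reg ''n'') floyd_step)"
  show ?thesis
    unfolding floyd_def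
  proof (rule ok_For[where I = "\<lambda>k t. dist_sound (snd t ''D'') \<and> dist_complete k (snd t ''D'')"
      and T = "(n + 1) * ((n + 1) * 50 + 8)"])
    fix k t
    assume *: "k < n" "dist_sound (snd t ''D'') \<and> dist_complete k (snd t ''D'')" "fst t ''k'' = k"
      "frame ''k'' ?p s t"
    have "input t"
      using assms(1) *(4) by (rule input_same) simp_all
    then show "ok ?p t ((n + 1) * ((n + 1) * 50 + 8))
      (\<lambda>t. dist_sound (snd t ''D'') \<and> dist_complete (Suc k) (snd t ''D''))"
      using * by (intro ok_floyd_middle) auto
  qed (use assms in \<open>auto simp: input_def same_def\<close>)
qed

section \<open>Farthest-first traversal\<close>

definition centres :: "(nat \<Rightarrow> nat) \<Rightarrow> nat \<Rightarrow> nat set" where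
  "centres U i = insert 0 (U ` {..<i})"

text \<open>The last clause is the separation property: U j was chosen at maximal distance from the
  earlier centres, and t has only decreased since. So t v, for any v, is a lower bound for the
  distance of every terminal from the centres before it.\<close>

definition traversal :: "(nat \<Rightarrow> nat) \<Rightarrow> nat \<Rightarrow> (nat \<Rightarrow> nat) \<Rightarrow> (nat \<Rightarrow> nat) \<Rightarrow> bool" where
  "traversal A i U t \<longleftrightarrow> (\<forall>j<i. U j < n) \<and>
     (\<forall>v<n. (\<forall>x\<in>centres U i. t v \<le> A (x * n + v)) \<and> (\<exists>x\<in>centres U i. t v = A (x * n + v))) \<and>
     (\<forall>j<i. \<forall>v<n. \<forall>x\<in>centres U j. t v \<le> A (x * n + U j))"

lemma traversal_0: "(\<And>v. v < n \<Longrightarrow> t v = A v) \<Longrightarrow> traversal A 0 U t"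
  by (simp add: traversal_def centres_def)

lemma traversal_Suc:
  assumes tr: "traversal A i U t" and m: "m < n" "\<And>v. v < n \<Longrightarrow> t v \<le> t m"
    and U': "U' = U(i := m)" and t': "\<And>v. v < n \<Longrightarrow> t' v = min (t v) (A (m * n + v))"
  shows "traversal A (Suc i) U' t'"
proof -
  have old: "centres U' j = centres U j" if "j \<le> i" for j
    using that unfolding centres_def U' by auto
  have new: "centres U' (Suc i) = insert m (centres U i)"
    unfolding centres_def U' by (auto simp: lessThan_Suc)
  have t'_le: "t' v \<le> t v" if "v < n" for v
    using t'[OF that] by simp
  have 1: "(\<forall>x\<in>centres U' (Suc i). t' v \<le> A (x * n + v)) \<and> (\<exists>x\<in>centres U' (Suc i). t' v = A (x * n + v))"
    if v: "v < n" for v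
  proof -
    have "\<forall>x\<in>centres U i. t v \<le> A (x * n + v)" "\<exists>x\<in>centres U i. t v = A (x * n + v)"
      using tr v unfolding traversal_def by blast+
    then show ?thesis
      unfolding new t'[OF v] by (auto simp: min_def)
  qed
  have 2: "t' v \<le> A (x * n + U' j)" if "j < Suc i" "v < n" "x \<in> centres U' j" for j v x
  proof (cases "j = i")
    case True
    have "t' v \<le> t m"
      using t'_le m(2) that(2) order_trans by blast
    also have "t m \<le> A (x * n + m)"
      using tr m(1) that(3) old[of i] unfolding traversal_def True by auto
    finally show ?thesis
      by (simp add: True U')
  next
    case False
    then have "j < i"
      using that by simp
    then have "t v \<le> A (x * n + U j)"
      using tr that old[of j] unfolding traversal_def by auto
    then show ?thesis
      using t'_le[OF that(2)] \<open>j < i\<close> by (simp add: U')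
  qed
  have "\<forall>j<Suc i. U' j < n"
    using tr m(1) unfolding traversal_def U' by auto
  then show ?thesis
    using 1 2 unfolding traversal_def by blast
qed

text \<open>If v were farther than \<open>D_opt\<close> from its nearest centre, then 0, the B
  terminals and v would be B + 2 vertices at mutual distances above \<open>D_opt\<close>, against
  \<open>far_apart_D_opt\<close>.\<close>

lemma traversal_radius:
  assumes tr: "traversal A B U t" and A: "dist_complete n A" and v: "v < n"
  shows "\<exists>x\<in>centres U B. enat (A (x * n + v)) \<le> D_opt {..<n} E w c B"
proof (rule ccontr)
  let ?D = "D_opt {..<n} E w c B"
  let ?d = "graph_dist {..<n} E w"
  assume "\<not> ?thesis"
  moreover obtain x where "x \<in> centres U B" "t v = A (x * n + v)"
    using tr v unfolding traversal_def by blast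
  ultimately have far: "?D < enat (t v)"
    by (auto simp: not_le)
  define f where "f j = (if j = 0 then 0 else if j \<le> B then U (j - 1) else v)" for j
  have f_less: "f j < n" for j
    using tr v n_pos by (auto simp: f_def traversal_def)
  have f_centre: "f i \<in> centres U j" if "i \<le> j" "j \<le> B" for i j
    using that by (auto simp: f_def centres_def)
  have "?D < ?d (f i) (f j)" if "i < j" "j \<le> Suc B" for i j
  proof -
    have "t v \<le> A (f i * n + f j)"
    proof (cases "j = Suc B")
      case True
      then show ?thesis
        using tr v f_centre[of i B] that unfolding traversal_def by (simp add: f_def)
    next
      case False
      then have "f j = U (j - 1)" "j - 1 < B"
        using that by (auto simp: f_def)
      then show ?thesis
        using tr v f_centre[of i "j - 1"] that unfolding traversal_def by simp
    qed
    then show ?thesis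
      using far dist_complete_n[OF A, of "f i" "f j"] by (meson enat_ord_simps(1) order_less_le_trans)
  qed
  then have far_f: "?D < ?d (f i) (f j)" if "i \<le> Suc B" "j \<le> Suc B" "i \<noteq> j" for i j
    using that graph_dist_commute by (metis linorder_neqE_nat)
  \<comment> \<open>Terminals may coincide in general; under the assumption on v they cannot, as a
    vertex has distance 0 to itself.\<close>
  have "inj_on f {..Suc B}"
  proof (rule inj_onI, rule ccontr)
    fix i j
    assume "i \<in> {..Suc B}" "j \<in> {..Suc B}" "f i = f j" "i \<noteq> j"
    then show False
      using far_f[of i j] f_less[of j] by simp
  qed
  then have "card (f ` {..Suc B}) = Suc (Suc B)"
    by (simp add: card_image)
  moreover have "far_apart {..<n} E w ?D (f ` {..Suc B})"
    unfolding far_apart_def using far_f by (auto simp del: atMost_Suc)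
  moreover have "f ` {..Suc B} \<subseteq> {..<n}"
    using f_less by blast
  ultimately show False
    using far_apart_D_opt[OF inst, of "f ` {..Suc B}" B] by simp
qed

lemma ok_farthest:
  assumes "fst s ''n'' = n" "fst s ''m'' < n"
  shows "ok (For ''v'' (Reg ''n'') farthest) s ((n + 1) * 30)
    (\<lambda>t. fst t ''m'' < n \<and> (\<forall>v<n. snd t ''t'' v \<le> snd t ''t'' (fst t ''m'')))"
proof -
  let ?I = "\<lambda>k (t :: state). fst t ''m'' < n \<and> (\<forall>v<k. snd s ''t'' v \<le> snd s ''t'' (fst t ''m''))"
  have "ok (For ''v'' (Reg ''n'') farthest) s ((n + 1) * 30) (?I n)"
  proof (rule ok_For[where I = ?I and T = 20])
    fix i t
    assume *: "i < n" "?I i t" "fst t ''v'' = i" "frame ''v'' farthest s t"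
    have "snd t ''t'' = snd s ''t''"
      using *(4) by (simp add: same_def)
    then show "ok farthest t 20 (?I (Suc i))"
      using * by (intro ok_loopfree) (auto simp: farthest_def less_Suc_eq dest: order_trans less_imp_le)
  qed (use assms in \<open>auto simp: same_def\<close>)
  then show ?thesis
    by (rule ok_mono[OF ok_frame]) (auto simp: same_def)
qed

lemma ok_nearer:
  assumes "input s" "fst s ''m'' = m" "m < n"
  shows "ok (For ''v'' (Reg ''n'') nearer) s ((n + 1) * 30)
    (\<lambda>t. \<forall>v<n. snd t ''t'' v = min (snd s ''t'' v) (snd s ''D'' (m * n + v)))"
proof -
  let ?I = "\<lambda>k (t :: state). \<forall>v. snd t ''t'' v =
    (if v < k then min (snd s ''t'' v) (snd s ''D'' (m * n + v)) else snd s ''t'' v)"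
  have "ok (For ''v'' (Reg ''n'') nearer) s ((n + 1) * 30) (?I n)"
  proof (rule ok_For[where I = ?I and T = 20])
    fix i t
    assume *: "i < n" "?I i t" "fst t ''v'' = i" "frame ''v'' nearer s t"
    have "input t"
      using assms(1) *(4) by (rule input_same) simp_all
    moreover have "snd t ''D'' = snd s ''D''" "fst t ''m'' = m"
      using *(4) assms by (simp_all add: same_def)
    ultimately show "ok nearer t 20 (?I (Suc i))"
      using * assms by (intro ok_loopfree) (auto simp: nearer_def input_def less_Suc_eq)
  qed (use assms in \<open>auto simp: same_def input_def\<close>)
  then show ?thesis
    by (rule ok_mono) auto
qed

lemma ok_farthest_first:
  assumes "input s" "snd s ''D'' = A"
  shows "ok farthest_first s ((n + 1) * 12 + (B + 1) * (2 + ((n + 1) * 30 + (3 + (n + 1) * 30)) + 8))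
    (\<lambda>t. traversal A B (snd t ''U'') (snd t ''t''))"
proof -
  let ?c = "Write ''t'' (Reg ''v'') (Read ''D'' (Reg ''v''))"
  let ?p = "''m'' ::= Const 0 ;; For ''v'' (Reg ''n'') farthest ;;
       Write ''U'' (Reg ''i'') (Reg ''m'') ;; For ''v'' (Reg ''n'') nearer"
  let ?I = "\<lambda>i (t :: state). traversal A i (snd t ''U'') (snd t ''t'')"
  have "ok (For ''v'' (Reg ''n'') ?c) s ((n + 1) * 12) (\<lambda>t. \<forall>v<n. snd t ''t'' v = A v)"
  proof (rule ok_For[where T = 4 and I = "\<lambda>k t. \<forall>v<k. snd t ''t'' v = A v"])
    fix i t
    assume "\<forall>v<i. snd t ''t'' v = A v" "fst t ''v'' = i" "frame ''v'' ?c s t"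
    then show "ok ?c t 4 (\<lambda>t. \<forall>v<Suc i. snd t ''t'' v = A v)"
      using assms by (intro ok_loopfree) (auto simp: less_Suc_eq same_def)
  qed (use assms in \<open>auto simp: same_def input_def\<close>)
  then have init: "ok (For ''v'' (Reg ''n'') ?c) s ((n + 1) * 12)
    (\<lambda>t. ?I 0 t \<and> input t \<and> snd t ''D'' = A)"
  proof (rule ok_mono[OF ok_frame])
    fix t
    assume t: "(\<forall>v<n. snd t ''t'' v = A v) \<and> effect (For ''v'' (Reg ''n'') ?c) s t"
    have "input t"
      using assms(1) conjunct2[OF t] by (rule input_same) simp_all
    moreover have "snd t ''D'' = A"
      using t assms by (simp add: same_def)
    moreover have "?I 0 t"
      by (rule traversal_0) (use t in blast)
    ultimately show "?I 0 t \<and> input t \<and> snd t ''D'' = A"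
      by blast
  qed simp
  have loop: "ok (For ''i'' (Reg ''B'') ?p) s ((B + 1) * (2 + ((n + 1) * 30 + (3 + (n + 1) * 30)) + 8)) (?I B)"
    if s: "?I 0 s" "input s" "snd s ''D'' = A" for s
  proof (rule ok_For[where I = ?I and T = "2 + ((n + 1) * 30 + (3 + (n + 1) * 30))"])
    fix i t
    assume t: "i < B" "?I i t" "fst t ''i'' = i" "frame ''i'' ?p s t"
    have "input t"
      using s(2) t(4) by (rule input_same) simp_all
    moreover have "snd t ''D'' = A"
      using s t by (simp add: same_def)
    ultimately have t': "input t" "snd t ''D'' = A"
      by blast+
    let ?R1 = "\<lambda>u. ?I i u \<and> fst u ''i'' = i \<and> input u \<and> snd u ''D'' = A \<and> fst u ''m'' < n"
    let ?R2 = "\<lambda>u. ?R1 u \<and> (\<forall>v<n. snd u ''t'' v \<le> snd u ''t'' (fst u ''m''))"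
    \<comment> \<open>After the write the invariant still refers to the previous contents of the
      array \<open>U\<close>; \<open>traversal_Suc\<close> relates old and new contents.\<close>
    let ?R3 = "\<lambda>u. input u \<and> snd u ''D'' = A \<and> fst u ''m'' < n \<and> (\<exists>U. traversal A i U (snd u ''t'') \<and>
      snd u ''U'' = U(i := fst u ''m'')) \<and> (\<forall>v<n. snd u ''t'' v \<le> snd u ''t'' (fst u ''m''))"
    have 1: "ok (''m'' ::= Const 0) t 2 ?R1"
      by (rule ok_loopfree) (use t t' n_pos in \<open>simp_all add: input_def\<close>)
    have 2: "ok (For ''v'' (Reg ''n'') farthest) t1 ((n + 1) * 30) ?R2" if t1: "?R1 t1" for t1
    proof (rule ok_mono[OF ok_frame[OF ok_farthest] order_refl])
      fix t2
      assume t2: "(fst t2 ''m'' < n \<and> (\<forall>v<n. snd t2 ''t'' v \<le> snd t2 ''t'' (fst t2 ''m''))) \<and>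
        effect (For ''v'' (Reg ''n'') farthest) t1 t2"
      have "snd t2 = snd t1" "fst t2 ''i'' = i"
        using t1 t2 by (simp_all add: same_def fun_eq_iff)
      then show "?R2 t2"
        using input_same[OF _ conjunct2[OF t2]] t1 conjunct1[OF t2] by simp
    qed (use t1 in \<open>simp_all add: input_def\<close>)
    have 3: "ok (Write ''U'' (Reg ''i'') (Reg ''m'')) t2 3 ?R3" if t2: "?R2 t2" for t2
      by (rule ok_loopfree) (use t2 in \<open>auto simp: input_def\<close>)
    have 4: "ok (For ''v'' (Reg ''n'') nearer) t3 ((n + 1) * 30) (?I (Suc i))" if t3: "?R3 t3" for t3
    proof (rule ok_mono[OF ok_frame[OF ok_nearer] order_refl])
      fix t4
      assume t4: "(\<forall>v<n. snd t4 ''t'' v = min (snd t3 ''t'' v) (snd t3 ''D'' (fst t3 ''m'' * n + v))) \<and>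
        effect (For ''v'' (Reg ''n'') nearer) t3 t4"
      obtain U where "traversal A i U (snd t3 ''t'')" "snd t3 ''U'' = U(i := fst t3 ''m'')"
        using t3 by blast
      then show "?I (Suc i) t4"
        by (elim traversal_Suc[where m = "fst t3 ''m''"]) (use t3 t4 in \<open>auto simp: same_def\<close>)
    qed (use t3 in simp_all)
    show "ok ?p t (2 + ((n + 1) * 30 + (3 + (n + 1) * 30))) (?I (Suc i))"
      by (rule ok_Seq[OF 1 ok_Seq[OF 2 ok_Seq[OF 3 4]]])
  qed (use s in \<open>auto simp: same_def input_def\<close>)
  show ?thesis
    unfolding farthest_first_def by (rule ok_Seq[OF init loop]) simp_all
qed

end

section \<open>The dynamic program\<close>

definition cell :: "aexp \<Rightarrow> aexp \<Rightarrow> aexp \<Rightarrow> aexp" where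
  "cell b v m = Read ''X'' b \<oplus> Read ''Y'' v \<oplus> m"

text \<open>
  New edge sets are never copied: each improvement of a table entry allocates a node with number
  \<open>g\<close> of a persistent acyclic graph, with successors \<open>l\<close> and \<open>r\<close> and the code \<open>e\<close> of an added
  edge (\<open>0\<close> for none, \<open>Suc (v * n + u)\<close> for \<open>{v, u}\<close>). Node \<open>0\<close> is the empty set.
\<close>

definition relax :: com where
  "relax = If (Less (Reg ''m'') (Read ''H'' (Reg ''o'')))
     (''g'' ::= Reg ''g'' \<oplus> Const 1 ;;
      Write ''l'' (Reg ''g'') (Reg ''a'') ;;
      Write ''r'' (Reg ''g'') (Reg ''y'') ;;
      Write ''e'' (Reg ''g'') (Reg ''k'') ;;
      Write ''H'' (Reg ''o'') (Reg ''m'') ;;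
      Write ''N'' (Reg ''o'') (Reg ''g'')) Skip"

text \<open>The setups supply the arguments of \<open>relax\<close>: o is the target cell, a and y
  are the nodes of the operands, k codes the added edge, and m is the candidate height.\<close>

definition merge_setup :: com where
  "merge_setup =
     ''i'' ::= cell (Reg ''b'') (Reg ''v'') (Read ''L'' (Reg ''x'')) ;;
     ''j'' ::= cell (Reg ''d'') (Reg ''v'') (Read ''R'' (Reg ''x'')) ;;
     ''o'' ::= cell (Reg ''b'' \<oplus> Reg ''d'') (Reg ''v'') (Read ''L'' (Reg ''x'') \<oplus> Read ''R'' (Reg ''x'')) ;;
     ''a'' ::= Read ''N'' (Reg ''i'') ;;
     ''y'' ::= Read ''N'' (Reg ''j'') ;;
     ''k'' ::= Const 0 ;;
     ''m'' ::= Read ''H'' (Reg ''i'') ;;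
     If (Less (Reg ''m'') (Read ''H'' (Reg ''j''))) (''m'' ::= Read ''H'' (Reg ''j'')) Skip"

definition edge_setup :: com where
  "edge_setup =
     ''i'' ::= cell (Minus (Reg ''b'') (Read ''c'' (Reg ''j''))) (Reg ''u'') (Reg ''s'') ;;
     ''a'' ::= Read ''N'' (Reg ''i'') ;;
     ''y'' ::= Const 0 ;;
     ''k'' ::= Reg ''j'' \<oplus> Const 1 ;;
     ''m'' ::= Read ''w'' (Reg ''j'') \<oplus> Read ''H'' (Reg ''i'')"

definition move_setup :: com where
  "move_setup =
     ''i'' ::= cell (Reg ''b'') (Reg ''u'') (Reg ''s'') ;;
     ''a'' ::= Read ''N'' (Reg ''i'') ;;
     ''y'' ::= Const 0 ;;
     ''k'' ::= Const 0 ;;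
     ''m'' ::= Read ''D'' (Reg ''j'') \<oplus> Read ''H'' (Reg ''i'')"

definition target_setup :: com where
  "target_setup =
     ''j'' ::= Read ''M'' (Reg ''v'') \<oplus> Reg ''u'' ;;
     ''o'' ::= cell (Reg ''b'') (Reg ''v'') (Reg ''s'')"

definition merge_step :: com where
  "merge_step = merge_setup ;; relax"

text \<open>For v = u the edge branch is entered with weight and cost 0; the candidate is then the
  entry itself, and \<open>relax\<close> changes nothing.\<close>

definition path_step :: com where
  "path_step = target_setup ;;
     If (Conj (Less (Read ''E'' (Reg ''j'')) (Const 1)) (Neg (Less (Reg ''b'') (Read ''c'' (Reg ''j'')))))
       (edge_setup ;; relax) Skip ;;
     (move_setup ;; relax)"

definition merges :: com where
  "merges = For ''x'' (Reg ''q'') (For ''b'' (Reg ''B'' \<oplus> Const 1)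
     (For ''d'' (Minus (Reg ''B'' \<oplus> Const 1) (Reg ''b'')) (For ''v'' (Reg ''n'') merge_step)))"

definition paths :: com where
  "paths = For ''s'' (Reg ''p'') (For ''b'' (Reg ''B'' \<oplus> Const 1)
     (For ''v'' (Reg ''n'') (For ''u'' (Reg ''n'') path_step)))"

text \<open>By \<open>tree_exists\<close>, a tree with \<open>B\<close> terminals and at most \<open>B\<close> new edges needs \<open>2 B + B\<close> rounds.\<close>

definition rounds :: com where
  "rounds = For ''f'' (Reg ''B'' \<oplus> Reg ''B'' \<oplus> Reg ''B'') (merges ;; paths)"

lemmas setup_defs = merge_setup_def edge_setup_def move_setup_def target_setup_def cell_def

lemma wr_dp_steps [simp]:
  "wr relax = {''g''}" "wa relax = {''l'', ''r'', ''e'', ''H'', ''N''}"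
  "wr merge_step = {''i'', ''j'', ''o'', ''a'', ''y'', ''k'', ''m'', ''g''}"
  "wa merge_step = {''l'', ''r'', ''e'', ''H'', ''N''}"
  "wr path_step = {''i'', ''j'', ''o'', ''a'', ''y'', ''k'', ''m'', ''g''}"
  "wa path_step = {''l'', ''r'', ''e'', ''H'', ''N''}"
  by (auto simp: relax_def merge_step_def path_step_def setup_defs)

lemma set_encode_less: "S \<subseteq> {..<m} \<Longrightarrow> set_encode S < 2 ^ m"
proof -
  assume "S \<subseteq> {..<m}"
  then have "set_encode S \<le> (\<Sum>i<m. 2 ^ i)"
    unfolding set_encode_def by (intro sum_mono2) auto
  also have "\<dots> < (2 :: nat) ^ m"
    by (induction m) simp_all
  finally show ?thesis .
qed

lemma set_decode_subset:
  assumes "x < 2 ^ m"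
  shows "set_decode x \<subseteq> {..<m}"
proof
  fix i
  assume i: "i \<in> set_decode x"
  show "i \<in> {..<m}"
  proof (rule ccontr)
    assume "i \<notin> {..<m}"
    then have "(2 :: nat) ^ m \<le> 2 ^ i"
      by (simp add: power_increasing)
    then have "x div 2 ^ i = 0"
      by (intro div_less less_le_trans[OF assms])
    then show False
      using i by (simp add: set_decode_def)
  qed
qed

text \<open>An entry of \<open>D\<close> above \<open>total_weight\<close> stands for infinity and
  carries no upper bound on a distance.\<close>

locale bcmd_table = bcmd_terminals +
  assumes D_sound: "u < n \<Longrightarrow> v < n \<Longrightarrow> D u v \<le> total_weight \<Longrightarrow> graph_dist {..<n} E w u v \<le> enat (D u v)"
begin

definition index :: "nat \<Rightarrow> nat \<Rightarrow> nat \<Rightarrow> nat" where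
  "index b v m = b * (n * 2 ^ B) + v * 2 ^ B + m"

lemma index_eq:
  assumes "v < n" "v' < n" "m < 2 ^ B" "m' < 2 ^ B"
  shows "index b v m = index b' v' m' \<longleftrightarrow> b = b' \<and> v = v' \<and> m = m'"
proof -
  have "index b v m = (b * n + v) * 2 ^ B + m" for b v m
    by (simp add: index_def algebra_simps)
  then show ?thesis
    using assms by (simp add: mat_index_eq)
qed

abbreviation entry :: "nat \<Rightarrow> nat \<Rightarrow> nat set \<Rightarrow> nat" where
  "entry b v S \<equiv> index b v (set_encode S)"

lemma entry_eq:
  assumes "v < n" "v' < n" "S \<subseteq> {..<B}" "S' \<subseteq> {..<B}"
  shows "entry b v S = entry b' v' S' \<longleftrightarrow> b = b' \<and> v = v' \<and> S = S'"
  using assms by (simp add: index_eq set_encode_less set_encode_eq finite_subset[OF _ finite_lessThan])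

text \<open>The certificate of a table entry. It speaks of distances and not of trees: a union of
  certified sets need not be a tree, but its cost and distances remain under control.\<close>

definition sol :: "nat \<Rightarrow> nat \<Rightarrow> nat set \<Rightarrow> nat \<Rightarrow> nat set set \<Rightarrow> bool" where
  "sol b v S x F \<longleftrightarrow> F \<subseteq> [{..<n}]\<^bsup>2\<^esup> - E \<and> sum c F \<le> b \<and>
     (x \<le> total_weight \<longrightarrow> (\<forall>i\<in>S. graph_dist {..<n} (E \<union> F) w v (U i) \<le> enat x))"

lemma finite_new_edges: "F \<subseteq> [{..<n}]\<^bsup>2\<^esup> - E \<Longrightarrow> finite F"
  by (meson Diff_subset finite_imp_finite_nsets finite_lessThan finite_subset)

lemma sol_merge:
  assumes "sol b v S x F" "sol d v S' y F'"
  shows "sol (b + d) v (S \<union> S') (max x y) (F \<union> F')"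
proof -
  have fin: "finite F" "finite F'"
    using assms finite_new_edges unfolding sol_def by blast+
  have "sum c (F \<union> F') \<le> sum c F + sum c F'"
    using sum.union_inter[OF fin, of c] by simp
  moreover have "graph_dist {..<n} (E \<union> (F \<union> F')) w v (U i) \<le> enat (max x y)"
    if "max x y \<le> total_weight" "i \<in> S \<union> S'" for i
  proof -
    have "graph_dist {..<n} (E \<union> (F \<union> F')) w v (U i) \<le> graph_dist {..<n} (E \<union> F) w v (U i)"
      "graph_dist {..<n} (E \<union> (F \<union> F')) w v (U i) \<le> graph_dist {..<n} (E \<union> F') w v (U i)"
      by (rule graph_dist_mono; blast)+
    moreover have "graph_dist {..<n} (E \<union> F) w v (U i) \<le> enat x \<or> graph_dist {..<n} (E \<union> F') w v (U i) \<le> enat y"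
      using assms that unfolding sol_def by auto
    moreover have "enat x \<le> enat (max x y)" "enat y \<le> enat (max x y)"
      by simp_all
    ultimately show ?thesis
      by (meson order_trans)
  qed
  ultimately show ?thesis
    using assms unfolding sol_def by auto
qed

lemma sol_edge:
  assumes "sol b u S x F" "{v, u} \<in> [{..<n}]\<^bsup>2\<^esup> - E"
  shows "sol (b + c {v, u}) v S (w {v, u} + x) (insert {v, u} F)"
proof -
  have fin: "finite F"
    using assms finite_new_edges unfolding sol_def by blast
  have "sum c (insert {v, u} F) \<le> b + c {v, u}"
    using assms(1) fin by (cases "{v, u} \<in> F") (auto simp: sol_def insert_absorb)
  moreover have "graph_dist {..<n} (E \<union> insert {v, u} F) w v (U i) \<le> enat (w {v, u} + x)"
    if "w {v, u} + x \<le> total_weight" "i \<in> S" for i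
  proof -
    let ?d = "graph_dist {..<n} (E \<union> insert {v, u} F) w"
    have "?d v (U i) \<le> ?d v u + ?d u (U i)"
      by (rule graph_dist_triangle)
    also have "\<dots> \<le> enat (w {v, u}) + graph_dist {..<n} (E \<union> F) w u (U i)"
      by (intro add_mono graph_dist_edge graph_dist_mono) (use assms in auto)
    also have "\<dots> \<le> enat (w {v, u}) + enat x"
      using assms(1) that by (intro add_left_mono) (auto simp: sol_def)
    finally show ?thesis by simp
  qed
  ultimately show ?thesis
    using assms unfolding sol_def by auto
qed

lemma sol_move:
  assumes "sol b u S x F" "v < n" "u < n"
  shows "sol b v S (D v u + x) F"
proof -
  have "graph_dist {..<n} (E \<union> F) w v (U i) \<le> enat (D v u + x)"
    if "D v u + x \<le> total_weight" "i \<in> S" for i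
  proof -
    let ?d = "graph_dist {..<n} (E \<union> F) w"
    have "?d v (U i) \<le> ?d v u + ?d u (U i)"
      by (rule graph_dist_triangle)
    also have "\<dots> \<le> graph_dist {..<n} E w v u + enat x"
      using assms(1) that by (intro add_mono graph_dist_mono) (auto simp: sol_def)
    also have "\<dots> \<le> enat (D v u) + enat x"
      using assms that by (intro add_right_mono D_sound) auto
    finally show ?thesis by simp
  qed
  then show ?thesis
    using assms unfolding sol_def by auto
qed

definition coded :: "nat \<Rightarrow> nat set set \<Rightarrow> nat set set \<Rightarrow> bool" where
  "coded k G F \<longleftrightarrow> k = 0 \<and> F = G \<or> (\<exists>v<n. \<exists>u<n. k = Suc (v * n + u) \<and> F = insert {v, u} G)"

text \<open>\<open>es\<close> is a ghost assignment of edge sets to nodes. Successors have smaller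
  numbers, so a fresh node leaves the sets of all others unchanged.\<close>

definition dag :: "(nat \<Rightarrow> nat set set) \<Rightarrow> state \<Rightarrow> bool" where
  "dag es s \<longleftrightarrow> es 0 = {} \<and>
     (\<forall>y. 0 < y \<longrightarrow> y \<le> fst s ''g'' \<longrightarrow> snd s ''l'' y < y \<and> snd s ''r'' y < y \<and>
       coded (snd s ''e'' y) (es (snd s ''l'' y) \<union> es (snd s ''r'' y)) (es y))"

definition table :: "(nat \<Rightarrow> nat set set) \<Rightarrow> state \<Rightarrow> bool" where
  "table es s \<longleftrightarrow> (\<forall>b\<le>B. \<forall>v<n. \<forall>S\<subseteq>{..<B}. snd s ''N'' (entry b v S) \<le> fst s ''g'' \<and>
     sol b v S (snd s ''H'' (entry b v S)) (es (snd s ''N'' (entry b v S))))"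

definition dp_inv :: "state \<Rightarrow> bool" where
  "dp_inv s \<longleftrightarrow> (\<exists>es. dag es s \<and> table es s)"

text \<open>The preorder used with \<open>ok_For_stable\<close> throughout the rounds: entries fall
  and certificates persist, with no exact description of the table.\<close>

definition improves :: "state \<Rightarrow> state \<Rightarrow> bool" where
  "improves s t \<longleftrightarrow> (dp_inv s \<longrightarrow> dp_inv t) \<and> (\<forall>i. snd t ''H'' i \<le> snd s ''H'' i)"

lemma improves_refl [simp]: "improves s s"
  by (simp add: improves_def)

lemma improves_trans: "improves s t \<Longrightarrow> improves t u \<Longrightarrow> improves s u"
  unfolding improves_def by (meson order_trans)

lemma improves_cong:
  assumes "fst t ''g'' = fst s ''g''"
    and "snd t ''l'' = snd s ''l''" "snd t ''r'' = snd s ''r''" "snd t ''e'' = snd s ''e''"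
    and "snd t ''H'' = snd s ''H''" "snd t ''N'' = snd s ''N''"
  shows "improves s t"
  by (simp add: improves_def dp_inv_def dag_def table_def assms)

abbreviation candidate :: "(nat \<Rightarrow> nat set set) \<Rightarrow> state \<Rightarrow> nat \<Rightarrow> nat \<Rightarrow> nat set \<Rightarrow> bool" where
  "candidate es s b v S \<equiv> \<exists>F. fst s ''a'' \<le> fst s ''g'' \<and> fst s ''y'' \<le> fst s ''g'' \<and>
     coded (fst s ''k'') (es (fst s ''a'') \<union> es (fst s ''y'')) F \<and> sol b v S (fst s ''m'') F"

text \<open>A certificate is demanded only if the candidate is strictly better; this disposes of the
  edge step with v = u, for which there is no edge to add.\<close>

lemma improves_relax:
  assumes o_eq: "fst s ''o'' = entry b v S" and b: "b \<le> B" "v < n" "S \<subseteq> {..<B}"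
    and cand: "\<And>es. dag es s \<Longrightarrow> table es s \<Longrightarrow> fst s ''m'' < snd s ''H'' (entry b v S) \<Longrightarrow>
      candidate es s b v S"
  shows "improves s (run relax s) \<and> snd (run relax s) ''H'' (entry b v S) \<le> fst s ''m''"
proof (cases "fst s ''m'' < snd s ''H'' (entry b v S)")
  case False
  then show ?thesis
    by (simp add: relax_def o_eq)
next
  case True
  let ?t = "run relax s"
  let ?g = "Suc (fst s ''g'')"
  have t: "fst ?t ''g'' = ?g" "snd ?t ''l'' = (snd s ''l'')(?g := fst s ''a'')"
    "snd ?t ''r'' = (snd s ''r'')(?g := fst s ''y'')" "snd ?t ''e'' = (snd s ''e'')(?g := fst s ''k'')"
    "snd ?t ''H'' = (snd s ''H'')(entry b v S := fst s ''m'')"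
    "snd ?t ''N'' = (snd s ''N'')(entry b v S := ?g)"
    using True by (simp_all add: relax_def o_eq)
  have "dp_inv ?t" if inv_s: "dp_inv s"
  proof -
    obtain es where es: "dag es s" "table es s"
      using inv_s by (auto simp: dp_inv_def)
    obtain F where F: "fst s ''a'' \<le> fst s ''g''" "fst s ''y'' \<le> fst s ''g''"
      "coded (fst s ''k'') (es (fst s ''a'') \<union> es (fst s ''y'')) F" "sol b v S (fst s ''m'') F"
      using cand[OF es True] by blast
    define es' where "es' = es(?g := F)"
    have old: "es' y = es y" if "y \<le> fst s ''g''" for y
      using that by (simp add: es'_def)
    have "snd ?t ''l'' y < y \<and> snd ?t ''r'' y < y \<and>
      coded (snd ?t ''e'' y) (es' (snd ?t ''l'' y) \<union> es' (snd ?t ''r'' y)) (es' y)"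
      if y: "0 < y" "y \<le> fst ?t ''g''" for y
    proof (cases "y = ?g")
      case True
      then show ?thesis
        using F(1-3) old unfolding t by (simp add: es'_def)
    next
      case False
      then have le: "y \<le> fst s ''g''"
        using y t by simp
      then have "snd s ''l'' y < y \<and> snd s ''r'' y < y \<and>
        coded (snd s ''e'' y) (es (snd s ''l'' y) \<union> es (snd s ''r'' y)) (es y)"
        using es(1) y(1) unfolding dag_def by blast
      then show ?thesis
        using False le unfolding t by (simp add: old)
    qed
    moreover have "es' 0 = {}"
      using es(1) by (simp add: es'_def dag_def)
    ultimately have "dag es' ?t"
      unfolding dag_def by blast
    moreover have "table es' ?t"
      unfolding table_def
    proof (intro allI impI)
      fix b' v' S'
      assume *: "b' \<le> B" "v' < n" "S' \<subseteq> {..<B}"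
      show "snd ?t ''N'' (entry b' v' S') \<le> fst ?t ''g'' \<and>
        sol b' v' S' (snd ?t ''H'' (entry b' v' S')) (es' (snd ?t ''N'' (entry b' v' S')))"
      proof (cases "entry b' v' S' = entry b v S")
        case True
        then have "b' = b" "v' = v" "S' = S"
          using entry_eq[OF *(2) b(2) *(3) b(3)] by simp_all
        then show ?thesis
          using F(4) unfolding t by (simp add: es'_def)
      next
        case False
        then show ?thesis
          using es(2) * unfolding t table_def by (simp add: old le_Suc_eq)
      qed
    qed
    ultimately show ?thesis
      by (auto simp: dp_inv_def)
  qed
  then show ?thesis
    using True by (simp add: improves_def t)
qed

definition dp_input :: "state \<Rightarrow> bool" where
  "dp_input s \<longleftrightarrow> input s \<and> fst s ''p'' = 2 ^ B \<and> fst s ''q'' = 3 ^ B \<and>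
     is_splits B (snd s ''L'') (snd s ''R'') \<and>
     (\<forall>b\<le>B. snd s ''X'' b = b * (n * 2 ^ B)) \<and> (\<forall>v<n. snd s ''Y'' v = v * 2 ^ B) \<and>
     (\<forall>v<n. \<forall>u<n. snd s ''D'' (v * n + u) = D v u)"

lemma dp_input_same:
  assumes "dp_input s" "same W A s t" "W \<inter> {''n'', ''B'', ''p'', ''q''} = {}"
    "A \<inter> {''E'', ''w'', ''c'', ''M'', ''L'', ''R'', ''X'', ''Y'', ''D''} = {}"
  shows "dp_input t"
  using assms by (simp add: dp_input_def input_def same_def)

lemma improves_merge_step:
  assumes s: "dp_input s" "fst s ''x'' = x" "fst s ''b'' = b" "fst s ''d'' = d" "fst s ''v'' = v"
    and x: "x < 3 ^ B" "b + d \<le> B" "v < n"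
  shows "improves s (run merge_step s) \<and>
    snd (run merge_step s) ''H'' (index (b + d) v (snd s ''L'' x + snd s ''R'' x))
      \<le> max (snd s ''H'' (index b v (snd s ''L'' x))) (snd s ''H'' (index d v (snd s ''R'' x)))"
proof -
  obtain S1 S2 where S: "S1 \<inter> S2 = {}" "S1 \<union> S2 \<subseteq> {..<B}"
    "snd s ''L'' x = set_encode S1" "snd s ''R'' x = set_encode S2"
    using s(1) x(1) unfolding dp_input_def is_splits_def by metis
  have fin: "finite S1" "finite S2"
    using S(2) by (auto intro: finite_subset)
  have enc: "set_encode S1 + set_encode S2 = set_encode (S1 \<union> S2)"
    unfolding set_encode_def using fin S(1) by (simp add: sum.union_disjoint)
  let ?t = "run merge_setup s"
  have t: "fst ?t ''o'' = entry (b + d) v (S1 \<union> S2)"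
    "fst ?t ''a'' = snd s ''N'' (entry b v S1)" "fst ?t ''y'' = snd s ''N'' (entry d v S2)" "fst ?t ''k'' = 0"
    "fst ?t ''m'' = max (snd s ''H'' (entry b v S1)) (snd s ''H'' (entry d v S2))"
    "fst ?t ''g'' = fst s ''g''" "snd ?t = snd s"
    using s x S(3,4) by (simp_all add: setup_defs dp_input_def index_def enc[symmetric] max_def)
  have "improves ?t (run relax ?t) \<and> snd (run relax ?t) ''H'' (entry (b + d) v (S1 \<union> S2)) \<le> fst ?t ''m''"
  proof (rule improves_relax[OF t(1) x(2,3) S(2)])
    fix es
    assume es: "dag es ?t" "table es ?t"
    have "S1 \<subseteq> {..<B}" "S2 \<subseteq> {..<B}" "b \<le> B" "d \<le> B"
      using S(2) x(2) by auto
    then have "snd s ''N'' (entry b v S1) \<le> fst s ''g'' \<and>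
      sol b v S1 (snd s ''H'' (entry b v S1)) (es (snd s ''N'' (entry b v S1)))"
      "snd s ''N'' (entry d v S2) \<le> fst s ''g'' \<and>
      sol d v S2 (snd s ''H'' (entry d v S2)) (es (snd s ''N'' (entry d v S2)))"
      using es(2) x(3) unfolding table_def t by blast+
    then show "candidate es ?t (b + d) v (S1 \<union> S2)"
      unfolding t coded_def by (auto intro: sol_merge)
  qed
  moreover have "improves s ?t"
    by (rule improves_cong) (simp_all add: t)
  ultimately show ?thesis
    using improves_trans unfolding merge_step_def run.simps t S(3,4) enc by blast
qed

lemma improves_path_step:
  assumes s: "dp_input s" "fst s ''s'' = m" "fst s ''b'' = b" "fst s ''v'' = v" "fst s ''u'' = u"
    and x: "m < 2 ^ B" "b \<le> B" "v < n" "u < n"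
  shows "improves s (run path_step s) \<and>
    (v \<noteq> u \<longrightarrow> {v, u} \<notin> E \<longrightarrow> c {v, u} \<le> b \<longrightarrow>
      snd (run path_step s) ''H'' (index b v m) \<le> w {v, u} + snd s ''H'' (index (b - c {v, u}) u m)) \<and>
    snd (run path_step s) ''H'' (index b v m) \<le> D v u + snd s ''H'' (index b u m)"
proof -
  define S where "S = set_decode m"
  have S: "S \<subseteq> {..<B}" "m = set_encode S"
    using set_decode_subset[OF x(1)] by (simp_all add: S_def)
  let ?k = "v * n + u"
  let ?s1 = "run target_setup s"
  have s1: "fst ?s1 ''o'' = entry b v S" "fst ?s1 ''j'' = ?k" "snd ?s1 = snd s"
    "\<And>y. y \<notin> {''j'', ''o''} \<Longrightarrow> fst ?s1 y = fst s y"
    using s x by (simp_all add: setup_defs dp_input_def input_def index_def S(2))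
  have E: "snd s ''E'' ?k = (if v = u then 0 else if {v, u} \<in> E then 1 else 0)"
    "snd s ''w'' ?k = (if v = u then 0 else w {v, u})" "snd s ''c'' ?k = (if v = u then 0 else c {v, u})"
    "snd s ''D'' ?k = D v u"
    using s x by (simp_all add: dp_input_def input_def pair_matrix_index)
  let ?C = "snd s ''E'' ?k < 1 \<and> \<not> b < snd s ''c'' ?k"
  define s2 where "s2 = (if ?C then run relax (run edge_setup ?s1) else ?s1)"
  have imp1: "improves s ?s1"
    by (rule improves_cong) (simp_all add: s1)
  have 2: "improves ?s1 s2 \<and> (v \<noteq> u \<longrightarrow> {v, u} \<notin> E \<longrightarrow> c {v, u} \<le> b \<longrightarrow>
      snd s2 ''H'' (index b v m) \<le> w {v, u} + snd s ''H'' (index (b - c {v, u}) u m))"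
  proof (cases ?C)
    case False
    then show ?thesis
      using E by (auto simp: s2_def)
  next
    case True
    let ?t = "run edge_setup ?s1"
    let ?b = "b - snd s ''c'' ?k"
    have t: "fst ?t ''o'' = entry b v S"
      "fst ?t ''a'' = snd s ''N'' (entry ?b u S)" "fst ?t ''y'' = 0" "fst ?t ''k'' = Suc ?k"
      "fst ?t ''m'' = snd s ''w'' ?k + snd s ''H'' (entry ?b u S)"
      "fst ?t ''g'' = fst s ''g''" "snd ?t = snd s"
      using s x by (simp_all add: setup_defs dp_input_def input_def index_def S(2))
    have "improves ?t (run relax ?t) \<and> snd (run relax ?t) ''H'' (entry b v S) \<le> fst ?t ''m''"
    proof (rule improves_relax[OF t(1) x(2,3) S(1)])
      fix es
      assume es: "dag es ?t" "table es ?t" "fst ?t ''m'' < snd ?t ''H'' (entry b v S)"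
      have "v \<noteq> u"
        using es(3) unfolding t E by auto
      with True E have new: "{v, u} \<in> [{..<n}]\<^bsup>2\<^esup> - E" "c {v, u} \<le> b"
        using x by (auto split: if_splits)
      have "?b \<le> B"
        using x by simp
      then have *: "snd s ''N'' (entry ?b u S) \<le> fst s ''g''"
        "sol ?b u S (snd s ''H'' (entry ?b u S)) (es (snd s ''N'' (entry ?b u S)))"
        using es(2) x(4) S(1) unfolding table_def t by blast+
      have "?b + c {v, u} = b" "snd s ''w'' ?k = w {v, u}"
        using new \<open>v \<noteq> u\<close> E by simp_all
      then have "sol b v S (fst ?t ''m'') (insert {v, u} (es (fst ?t ''a'') \<union> es (fst ?t ''y'')))"
        using sol_edge[OF *(2) new(1)] es(1) unfolding t dag_def by simp
      then show "candidate es ?t b v S"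
        using * x(3,4) unfolding t coded_def by blast
    qed
    moreover have "improves ?s1 ?t"
      by (rule improves_cong) (simp_all add: t s1)
    ultimately show ?thesis
      using improves_trans E True unfolding s2_def t S(2) by auto
  qed
  have s2: "fst s2 ''o'' = entry b v S" "fst s2 ''j'' = ?k" "fst s2 ''b'' = b" "fst s2 ''u'' = u" "fst s2 ''s'' = m"
    "snd s2 ''X'' = snd s ''X''" "snd s2 ''Y'' = snd s ''Y''" "snd s2 ''D'' = snd s ''D''"
    using s s1 by (simp_all add: s2_def edge_setup_def relax_def)
  let ?t = "run move_setup s2"
  have t: "fst ?t ''o'' = entry b v S"
    "fst ?t ''a'' = snd s2 ''N'' (entry b u S)" "fst ?t ''y'' = 0" "fst ?t ''k'' = 0"
    "fst ?t ''m'' = D v u + snd s2 ''H'' (entry b u S)"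
    "fst ?t ''g'' = fst s2 ''g''" "snd ?t = snd s2"
    using s x E by (simp_all add: move_setup_def cell_def s2 dp_input_def index_def S(2)[symmetric])
  have 3: "improves ?t (run relax ?t) \<and> snd (run relax ?t) ''H'' (entry b v S) \<le> fst ?t ''m''"
  proof (rule improves_relax[OF t(1) x(2,3) S(1)])
    fix es
    assume es: "dag es ?t" "table es ?t"
    then have *: "snd s2 ''N'' (entry b u S) \<le> fst s2 ''g''"
      "sol b u S (snd s2 ''H'' (entry b u S)) (es (snd s2 ''N'' (entry b u S)))"
      using x S(1) unfolding table_def t by blast+
    have "sol b v S (fst ?t ''m'') (es (fst ?t ''a'') \<union> es (fst ?t ''y''))"
      using sol_move[OF *(2) x(3,4)] es(1) unfolding t dag_def by simp
    then show "candidate es ?t b v S"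
      using * unfolding t coded_def by blast
  qed
  have "improves s2 ?t"
    by (rule improves_cong) (simp_all add: t)
  then have imp: "improves s2 (run relax ?t)"
    using 3 improves_trans by blast
  have final: "run path_step s = run relax ?t"
    using s s1 by (simp add: path_step_def s2_def)
  have "improves s s2"
    using imp1 2 improves_trans by blast
  \<comment> \<open>The move step reads entries that the edge step may have lowered; by monotonicity
    the bounds in terms of s still follow.\<close>
  then have H: "snd s2 ''H'' i \<le> snd s ''H'' i" "snd (run relax ?t) ''H'' i \<le> snd s2 ''H'' i" for i
    using imp unfolding improves_def by blast+
  have "snd (run relax ?t) ''H'' (index b v m) \<le> D v u + snd s ''H'' (index b u m)"
    using 3 H(1)[of "entry b u S"] unfolding t S(2) by simp
  moreover have "snd (run relax ?t) ''H'' (index b v m) \<le> w {v, u} + snd s ''H'' (index (b - c {v, u}) u m)"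
    if "v \<noteq> u" "{v, u} \<notin> E" "c {v, u} \<le> b"
    using 2 that H(2) order_trans by blast
  ultimately show ?thesis
    unfolding final using improves_trans[OF \<open>improves s s2\<close> imp] by blast
qed

text \<open>\<open>A\<close> is meant to be the table at the start of a round, and P i to bound
  current entries by entries of \<open>A\<close>; such a bound persists while entries fall.\<close>

lemma ok_dp_For:
  assumes s: "dp_input s" "dp_inv s" "\<And>k. snd s ''H'' k \<le> A k"
    and x: "x \<notin> wr p" "x \<noteq> ''g''" "insert x (wr p) \<inter> {''n'', ''B'', ''p'', ''q''} = {}"
      "wa p \<inter> {''E'', ''w'', ''c'', ''M'', ''L'', ''R'', ''X'', ''Y'', ''D''} = {}"
    and bound: "\<And>t. frame x p s t \<Longrightarrow> aval e t = N"
    and antimono: "\<And>i H H'. P i H \<Longrightarrow> (\<And>k. H' k \<le> H k) \<Longrightarrow> P i H'"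
    and body: "\<And>i t. i < N \<Longrightarrow> dp_input t \<Longrightarrow> dp_inv t \<Longrightarrow> (\<And>k. snd t ''H'' k \<le> A k) \<Longrightarrow> fst t x = i \<Longrightarrow>
      frame x p s t \<Longrightarrow> ok p t T (\<lambda>u. improves t u \<and> P i (snd u ''H''))"
    and time: "(N + 1) * (T + acost e + 7) \<le> T'"
  shows "ok (For x e p) s T' (\<lambda>t. improves s t \<and> (\<forall>i<N. P i (snd t ''H'')))"
proof (rule ok_For_stable[where J = improves and T = T, OF x(1) bound])
  show "improves t v" if "improves t u" "improves u v" for t u v
    using that by (rule improves_trans)
  show "improves t (set_reg x k t)" for t k
    by (rule improves_cong) (use x(2) in auto)
  show "P i (snd u ''H'')" if "P i (snd t ''H'')" "improves t u" for i t u
    using that(1) by (rule antimono) (use that(2) in \<open>simp add: improves_def\<close>)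
  fix i t
  assume *: "i < N" "improves s t" "fst t x = i" "frame x p s t"
  have "dp_inv t"
    using *(2) s(2) by (simp add: improves_def)
  moreover have "snd t ''H'' k \<le> A k" for k
    using *(2) s(3)[of k] unfolding improves_def by (meson order_trans)
  moreover have "dp_input t"
    using s(1) *(4) x(3,4) by (rule dp_input_same)
  ultimately show "ok p t T (\<lambda>u. improves t u \<and> P i (snd u ''H''))"
    using * by (intro body)
qed (use time in simp_all)

text \<open>\<open>merged\<close> and \<open>stepped\<close> are the recurrences of one round as
  inequalities, from an old table A to a current table H.\<close>

definition merged :: "(nat \<Rightarrow> nat) \<Rightarrow> (nat \<Rightarrow> nat) \<Rightarrow> (nat \<Rightarrow> nat) \<Rightarrow> nat \<Rightarrow> nat \<Rightarrow> nat \<Rightarrow> nat \<Rightarrow> (nat \<Rightarrow> nat) \<Rightarrow> bool" where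
  "merged L R A x b d v H \<longleftrightarrow>
     H (index (b + d) v (L x + R x)) \<le> max (A (index b v (L x))) (A (index d v (R x)))"

definition stepped :: "(nat \<Rightarrow> nat) \<Rightarrow> nat \<Rightarrow> nat \<Rightarrow> nat \<Rightarrow> nat \<Rightarrow> (nat \<Rightarrow> nat) \<Rightarrow> bool" where
  "stepped A m b v u H \<longleftrightarrow>
     (v \<noteq> u \<longrightarrow> {v, u} \<notin> E \<longrightarrow> c {v, u} \<le> b \<longrightarrow>
        H (index b v m) \<le> w {v, u} + A (index (b - c {v, u}) u m)) \<and>
     H (index b v m) \<le> D v u + A (index b u m)"

lemma merged_antimono: "merged L R A x b d v H \<Longrightarrow> (\<And>k. H' k \<le> H k) \<Longrightarrow> merged L R A x b d v H'"
  unfolding merged_def by (meson order_trans)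

lemma stepped_antimono: "stepped A m b v u H \<Longrightarrow> (\<And>k. H' k \<le> H k) \<Longrightarrow> stepped A m b v u H'"
  unfolding stepped_def by (meson order_trans)

lemma loopfree_steps: "loopfree merge_step" "loopfree path_step"
  by (simp_all add: merge_step_def path_step_def relax_def setup_defs)

lemma tmax_steps: "tmax merge_step \<le> 150" "tmax path_step \<le> 250"
  by (simp_all add: merge_step_def path_step_def relax_def setup_defs)

text \<open>Nested instances of the bound in \<open>ok_For\<close>: each loop adds 7 and the cost of
  its bound expression to its body, and 1 to the number of iterations. The 158 is the 150 of
  \<open>tmax_steps\<close> plus 8.\<close>

definition merges_time :: nat where
  "merges_time = (3 ^ B + 1) * ((B + 2) * ((B + 2) * ((n + 1) * 158 + 12) + 10) + 8)"

definition paths_time :: nat where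
  "paths_time = (2 ^ B + 1) * ((B + 2) * ((n + 1) * ((n + 1) * 258 + 8) + 10) + 8)"

lemma ok_merges:
  assumes s: "dp_input s" "dp_inv s" "\<And>k. snd s ''H'' k \<le> A k" "snd s ''L'' = L" "snd s ''R'' = R"
  shows "ok merges s merges_time
    (\<lambda>t. improves s t \<and> (\<forall>x<3 ^ B. \<forall>b<B + 1. \<forall>d<B + 1 - b. \<forall>v<n. merged L R A x b d v (snd t ''H'')))"
proof -
  let ?p4 = "merge_step"
  let ?p3 = "For ''v'' (Reg ''n'') ?p4"
  let ?p2 = "For ''d'' (Minus (Reg ''B'' \<oplus> Const 1) (Reg ''b'')) ?p3"
  let ?p1 = "For ''b'' (Reg ''B'' \<oplus> Const 1) ?p2"
  let ?inv = "\<lambda>t. dp_input t \<and> dp_inv t \<and> (\<forall>k. snd t ''H'' k \<le> A k) \<and> snd t ''L'' = L \<and> snd t ''R'' = R"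
  let ?T3 = "(n + 1) * 158"
  let ?T2 = "(B + 2) * (?T3 + 12)"
  let ?T1 = "(B + 2) * (?T2 + 10)"
  let ?Q3 = "\<lambda>x b d H. \<forall>v<n. merged L R A x b d v H"
  let ?Q2 = "\<lambda>x b H. \<forall>d<B + 1 - b. ?Q3 x b d H"
  let ?Q1 = "\<lambda>x H. \<forall>b<B + 1. ?Q2 x b H"
  have 3: "ok ?p3 t ?T3 (\<lambda>u. improves t u \<and> ?Q3 x b d (snd u ''H''))"
    if t: "?inv t" "fst t ''x'' = x" "fst t ''b'' = b" "fst t ''d'' = d" "x < 3 ^ B" "b + d \<le> B" for t x b d
  proof (rule ok_dp_For[where A = A and T = 150])
    fix v t'
    assume t': "v < n" "dp_input t'" "\<And>k. snd t' ''H'' k \<le> A k" "fst t' ''v'' = v"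
      "frame ''v'' ?p4 t t'"
    have eqs: "fst t' ''x'' = x" "fst t' ''b'' = b" "fst t' ''d'' = d" "snd t' ''L'' = L" "snd t' ''R'' = R"
      using t'(5) t by (simp_all add: same_def)
    have "max (snd t' ''H'' i) (snd t' ''H'' j) \<le> max (A i) (A j)" for i j
      using t'(3)[of i] t'(3)[of j] by (simp add: max_def)
    then have "improves t' (run merge_step t') \<and> merged L R A x b d v (snd (run merge_step t') ''H'')"
      using improves_merge_step[OF t'(2) eqs(1-3) t'(4) t(5,6) t'(1)] unfolding merged_def eqs
      by (meson order_trans)
    then show "ok ?p4 t' 150 (\<lambda>u. improves t' u \<and> merged L R A x b d v (snd u ''H''))"
      by (intro ok_loopfree loopfree_steps tmax_steps)
  qed (use t merged_antimono in \<open>auto simp: same_def dp_input_def input_def\<close>)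
  have 2: "ok ?p2 t ?T2 (\<lambda>u. improves t u \<and> ?Q2 x b (snd u ''H''))"
    if t: "?inv t" "fst t ''x'' = x" "fst t ''b'' = b" "x < 3 ^ B" for t x b
  proof (rule ok_dp_For[where A = A and T = "?T3"])
    fix d t'
    assume t': "d < B + 1 - b" "dp_input t'" "dp_inv t'" "\<And>k. snd t' ''H'' k \<le> A k" "fst t' ''d'' = d"
      "frame ''d'' ?p3 t t'"
    then show "ok ?p3 t' ?T3 (\<lambda>u. improves t' u \<and> ?Q3 x b d (snd u ''H''))"
      by (intro 3) (use t in \<open>auto simp: same_def\<close>)
  next
    show "(B + 1 - b + 1) * (?T3 + acost (Minus (Reg ''B'' \<oplus> Const 1) (Reg ''b'')) + 7) \<le> ?T2"
      by (intro mult_le_mono) simp_all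
  qed (use t merged_antimono in \<open>auto simp: same_def dp_input_def input_def\<close>)
  have 1: "ok ?p1 t ?T1 (\<lambda>u. improves t u \<and> ?Q1 x (snd u ''H''))"
    if t: "?inv t" "fst t ''x'' = x" "x < 3 ^ B" for t x
  proof (rule ok_dp_For[where A = A and T = "?T2"])
    fix b t'
    assume t': "b < B + 1" "dp_input t'" "dp_inv t'" "\<And>k. snd t' ''H'' k \<le> A k" "fst t' ''b'' = b"
      "frame ''b'' ?p2 t t'"
    then show "ok ?p2 t' ?T2 (\<lambda>u. improves t' u \<and> ?Q2 x b (snd u ''H''))"
      by (intro 2) (use t in \<open>auto simp: same_def\<close>)
  next
    fix b and H H' :: "nat \<Rightarrow> nat"
    assume "?Q2 x b H" "\<And>k. H' k \<le> H k"
    then show "?Q2 x b H'"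
      using merged_antimono by blast
  qed (use t in \<open>auto simp: same_def dp_input_def input_def\<close>)
  show ?thesis
    unfolding merges_def merges_time_def
  proof (rule ok_dp_For[where A = A and T = "?T1"])
    fix x t'
    assume t': "x < 3 ^ B" "dp_input t'" "dp_inv t'" "\<And>k. snd t' ''H'' k \<le> A k" "fst t' ''x'' = x"
      "frame ''x'' ?p1 s t'"
    then show "ok ?p1 t' ?T1 (\<lambda>u. improves t' u \<and> ?Q1 x (snd u ''H''))"
      by (intro 1) (use s in \<open>auto simp: same_def\<close>)
  next
    fix x and H H' :: "nat \<Rightarrow> nat"
    assume "?Q1 x H" "\<And>k. H' k \<le> H k"
    then show "?Q1 x H'"
      using merged_antimono by blast
  qed (use s in \<open>auto simp: same_def dp_input_def input_def\<close>)
qed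

lemma ok_paths:
  assumes s: "dp_input s" "dp_inv s" "\<And>k. snd s ''H'' k \<le> A k"
  shows "ok paths s paths_time
    (\<lambda>t. improves s t \<and> (\<forall>m<2 ^ B. \<forall>b<B + 1. \<forall>v<n. \<forall>u<n. stepped A m b v u (snd t ''H'')))"
proof -
  let ?p4 = "path_step"
  let ?p3 = "For ''u'' (Reg ''n'') ?p4"
  let ?p2 = "For ''v'' (Reg ''n'') ?p3"
  let ?p1 = "For ''b'' (Reg ''B'' \<oplus> Const 1) ?p2"
  let ?inv = "\<lambda>t. dp_input t \<and> dp_inv t \<and> (\<forall>k. snd t ''H'' k \<le> A k)"
  let ?T3 = "(n + 1) * 258"
  let ?T2 = "(n + 1) * (?T3 + 8)"
  let ?T1 = "(B + 2) * (?T2 + 10)"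
  let ?Q3 = "\<lambda>m b v H. \<forall>y<n. stepped A m b v y H"
  let ?Q2 = "\<lambda>m b H. \<forall>v<n. ?Q3 m b v H"
  let ?Q1 = "\<lambda>m H. \<forall>b<B + 1. ?Q2 m b H"
  have 3: "ok ?p3 t ?T3 (\<lambda>u. improves t u \<and> ?Q3 m b v (snd u ''H''))"
    if t: "?inv t" "fst t ''s'' = m" "fst t ''b'' = b" "fst t ''v'' = v" "m < 2 ^ B" "b \<le> B" "v < n" for t m b v
  proof (rule ok_dp_For[where A = A and T = 250])
    fix y t'
    assume t': "y < n" "dp_input t'" "\<And>k. snd t' ''H'' k \<le> A k" "fst t' ''u'' = y"
      "frame ''u'' ?p4 t t'"
    have eqs: "fst t' ''s'' = m" "fst t' ''b'' = b" "fst t' ''v'' = v"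
      using t'(5) t by (simp_all add: same_def)
    have "k + snd t' ''H'' i \<le> k + A i" for i k
      using t'(3)[of i] by simp
    then have "improves t' (run path_step t') \<and> stepped A m b v y (snd (run path_step t') ''H'')"
      using improves_path_step[OF t'(2) eqs t'(4) t(5-7) t'(1)] unfolding stepped_def
      by (meson order_trans)
    then show "ok ?p4 t' 250 (\<lambda>u. improves t' u \<and> stepped A m b v y (snd u ''H''))"
      by (intro ok_loopfree loopfree_steps tmax_steps)
  qed (use t stepped_antimono in \<open>auto simp: same_def dp_input_def input_def\<close>)
  have 2: "ok ?p2 t ?T2 (\<lambda>u. improves t u \<and> ?Q2 m b (snd u ''H''))"
    if t: "?inv t" "fst t ''s'' = m" "fst t ''b'' = b" "m < 2 ^ B" "b \<le> B" for t m b
  proof (rule ok_dp_For[where A = A and T = "?T3"])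
    fix v t'
    assume t': "v < n" "dp_input t'" "dp_inv t'" "\<And>k. snd t' ''H'' k \<le> A k" "fst t' ''v'' = v"
      "frame ''v'' ?p3 t t'"
    then show "ok ?p3 t' ?T3 (\<lambda>u. improves t' u \<and> ?Q3 m b v (snd u ''H''))"
      by (intro 3) (use t in \<open>auto simp: same_def\<close>)
  qed (use t stepped_antimono in \<open>auto simp: same_def dp_input_def input_def\<close>)
  have 1: "ok ?p1 t ?T1 (\<lambda>u. improves t u \<and> ?Q1 m (snd u ''H''))"
    if t: "?inv t" "fst t ''s'' = m" "m < 2 ^ B" for t m
  proof (rule ok_dp_For[where A = A and T = "?T2"])
    fix b t'
    assume t': "b < B + 1" "dp_input t'" "dp_inv t'" "\<And>k. snd t' ''H'' k \<le> A k" "fst t' ''b'' = b"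
      "frame ''b'' ?p2 t t'"
    then show "ok ?p2 t' ?T2 (\<lambda>u. improves t' u \<and> ?Q2 m b (snd u ''H''))"
      by (intro 2) (use t in \<open>auto simp: same_def\<close>)
  next
    fix b and H H' :: "nat \<Rightarrow> nat"
    assume "?Q2 m b H" "\<And>k. H' k \<le> H k"
    then show "?Q2 m b H'"
      using stepped_antimono by blast
  qed (use t in \<open>auto simp: same_def dp_input_def input_def\<close>)
  show ?thesis
    unfolding paths_def paths_time_def
  proof (rule ok_dp_For[where A = A and T = "?T1"])
    fix m t'
    assume t': "m < 2 ^ B" "dp_input t'" "dp_inv t'" "\<And>k. snd t' ''H'' k \<le> A k" "fst t' ''s'' = m"
      "frame ''s'' ?p1 s t'"
    then show "ok ?p1 t' ?T1 (\<lambda>u. improves t' u \<and> ?Q1 m (snd u ''H''))"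
      by (intro 1) (use s in \<open>auto simp: same_def\<close>)
  next
    fix m and H H' :: "nat \<Rightarrow> nat"
    assume "?Q1 m H" "\<And>k. H' k \<le> H k"
    then show "?Q1 m H'"
      using stepped_antimono by blast
  qed (use s in \<open>auto simp: same_def dp_input_def input_def\<close>)
qed

text \<open>Completeness after r rounds. Entries may be smaller than all trees of r rounds, because
  updates are visible within the same round.\<close>

definition reached :: "nat \<Rightarrow> (nat \<Rightarrow> nat) \<Rightarrow> bool" where
  "reached r H \<longleftrightarrow> (\<forall>b v S x. tree r b v S x \<longrightarrow> H (entry b v S) \<le> x)"

text \<open>Each rule of \<open>tree\<close> has its inequality: \<open>keep\<close> monotonicity,
  \<open>merge\<close> the index of its pair in the split tables, \<open>edge\<close> and
  \<open>move\<close> the two halves of \<open>stepped\<close>.\<close>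

lemma reached_Suc:
  assumes A: "reached r A" and le: "\<And>k. H k \<le> A k" and LR: "is_splits B L R"
    and merged: "\<And>x b d v. x < 3 ^ B \<Longrightarrow> b + d \<le> B \<Longrightarrow> v < n \<Longrightarrow> merged L R A x b d v H"
    and stepped: "\<And>m b v u. m < 2 ^ B \<Longrightarrow> b \<le> B \<Longrightarrow> v < n \<Longrightarrow> u < n \<Longrightarrow> stepped A m b v u H"
  shows "reached (Suc r) H"
  unfolding reached_def
proof (intro allI impI)
  fix b v S x
  assume "tree (Suc r) b v S x"
  then show "H (entry b v S) \<le> x"
  proof cases
    case keep
    then have "A (entry b v S) \<le> x"
      using A by (simp add: reached_def)
    then show ?thesis
      using le[of "entry b v S"] by simp
  next
    case (merge b1 S1 x1 b2 S2 x2)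
    have bounds: "S1 \<subseteq> {..<B}" "S2 \<subseteq> {..<B}" "v < n"
      using tree_bounds[OF merge(4)] tree_bounds[OF merge(5)] by simp_all
    then obtain i where i: "i < 3 ^ B" "L i = set_encode S1" "R i = set_encode S2"
      using LR merge(7) unfolding is_splits_def by (meson Un_least)
    have "set_encode S1 + set_encode S2 = set_encode (S1 \<union> S2)"
      using bounds(1,2) merge(7) unfolding set_encode_def
      by (subst sum.union_disjoint) (auto intro: finite_subset)
    then have "H (entry (b1 + b2) v (S1 \<union> S2)) \<le> max (A (entry b1 v S1)) (A (entry b2 v S2))"
      using merged[OF i(1) merge(6) bounds(3)] by (simp add: merged_def i)
    moreover have "A (entry b1 v S1) \<le> x1" "A (entry b2 v S2) \<le> x2"
      using A merge(4,5) by (simp_all add: reached_def)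
    ultimately show ?thesis
      unfolding merge(1-3) by (simp add: max_def split: if_splits)
  next
    case (edge b' u x')
    have "b' \<le> B" "S \<subseteq> {..<B}"
      using tree_bounds[OF edge(3)] by simp_all
    then have "H (entry b v S) \<le> w {v, u} + A (entry b' u S)"
      using stepped[of "set_encode S" b v u] edge set_encode_less[of S B] by (auto simp: stepped_def)
    moreover have "A (entry b' u S) \<le> x'"
      using A edge(3) by (simp add: reached_def)
    ultimately show ?thesis
      using edge by simp
  next
    case (move u x')
    have "b \<le> B" "u < n" "S \<subseteq> {..<B}"
      using tree_bounds[OF move(2)] by simp_all
    then have "H (entry b v S) \<le> D v u + A (entry b u S)"
      using stepped[of "set_encode S" b v u] move set_encode_less[of S B] by (auto simp: stepped_def)
    moreover have "A (entry b u S) \<le> x'"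
      using A move(2) by (simp add: reached_def)
    ultimately show ?thesis
      using move by simp
  qed
qed

lemma wr_merges_paths [simp]:
  "wr merges = {''x'', ''b'', ''d'', ''v'', ''i'', ''j'', ''o'', ''a'', ''y'', ''k'', ''m'', ''g''}"
  "wa merges = {''l'', ''r'', ''e'', ''H'', ''N''}"
  "wr paths = {''s'', ''b'', ''v'', ''u'', ''i'', ''j'', ''o'', ''a'', ''y'', ''k'', ''m'', ''g''}"
  "wa paths = {''l'', ''r'', ''e'', ''H'', ''N''}"
  by (auto simp: merges_def paths_def)

lemma ok_round:
  assumes s: "dp_input s" "dp_inv s" "reached r (snd s ''H'')"
  shows "ok (merges ;; paths) s (merges_time + paths_time)
    (\<lambda>t. dp_inv t \<and> reached (Suc r) (snd t ''H''))"
proof -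
  let ?A = "snd s ''H''" and ?L = "snd s ''L''" and ?R = "snd s ''R''"
  show ?thesis
  proof (rule ok_Seq[OF ok_frame[OF ok_merges[OF s(1,2) order_refl refl refl]]])
    fix t
    assume t: "(improves s t \<and> (\<forall>x<3 ^ B. \<forall>b<B + 1. \<forall>d<B + 1 - b. \<forall>v<n.
      merged ?L ?R ?A x b d v (snd t ''H''))) \<and> effect merges s t"
    have "dp_input t"
      using s(1) conjunct2[OF t] by (rule dp_input_same) simp_all
    moreover have "dp_inv t" "\<And>k. snd t ''H'' k \<le> ?A k"
      using t s(2) by (simp_all add: improves_def)
    ultimately have "ok paths t paths_time
      (\<lambda>u. improves t u \<and> (\<forall>m<2 ^ B. \<forall>b<B + 1. \<forall>v<n. \<forall>y<n. stepped ?A m b v y (snd u ''H'')))"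
      by (rule ok_paths)
    then show "ok paths t paths_time (\<lambda>t. dp_inv t \<and> reached (Suc r) (snd t ''H''))"
    proof (rule ok_mono)
      fix u
      assume u: "improves t u \<and> (\<forall>m<2 ^ B. \<forall>b<B + 1. \<forall>v<n. \<forall>y<n. stepped ?A m b v y (snd u ''H''))"
      have u_t: "snd u ''H'' k \<le> snd t ''H'' k" for k
        using u by (simp add: improves_def)
      have "reached (Suc r) (snd u ''H'')"
      proof (rule reached_Suc[OF s(3)])
        show "snd u ''H'' k \<le> ?A k" for k
          using u_t \<open>\<And>k. snd t ''H'' k \<le> ?A k\<close> order_trans by blast
        show "is_splits B ?L ?R"
          using s(1) by (simp add: dp_input_def)
        show "merged ?L ?R ?A x b d v (snd u ''H'')" if "x < 3 ^ B" "b + d \<le> B" "v < n" for x b d v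
          by (rule merged_antimono[OF _ u_t]) (use t that in auto)
        show "stepped ?A m b v y (snd u ''H'')" if "m < 2 ^ B" "b \<le> B" "v < n" "y < n" for m b v y
          using u that by simp
      qed
      then show "dp_inv u \<and> reached (Suc r) (snd u ''H'')"
        using u \<open>dp_inv t\<close> by (simp add: improves_def)
    qed simp
  qed
qed

lemma ok_rounds:
  assumes s: "dp_input s" "dp_inv s" "reached 0 (snd s ''H'')"
  shows "ok rounds s ((B + B + B + 1) * (merges_time + paths_time + 12))
    (\<lambda>t. dp_inv t \<and> reached (B + B + B) (snd t ''H''))"
proof -
  let ?p = "merges ;; paths"
  show ?thesis
    unfolding rounds_def
  proof (rule ok_For[where T = "merges_time + paths_time" and I = "\<lambda>r t. dp_inv t \<and> reached r (snd t ''H'')"])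
    fix r t
    assume t: "dp_inv t \<and> reached r (snd t ''H'')" "frame ''f'' ?p s t"
    have "dp_input t"
      using s(1) t(2) by (rule dp_input_same) simp_all
    then show "ok ?p t (merges_time + paths_time) (\<lambda>t. dp_inv t \<and> reached (Suc r) (snd t ''H''))"
      using t(1) by (intro ok_round) auto
  next
    fix i k t
    assume "dp_inv t \<and> reached i (snd t ''H'')"
    then show "dp_inv (set_reg ''f'' k t) \<and> reached i (snd (set_reg ''f'' k t) ''H'')"
      using improves_cong[of "set_reg ''f'' k t" t] by (simp add: improves_def)
  qed (use s in \<open>auto simp: same_def dp_input_def input_def\<close>)
qed

end

text \<open>The register j runs through the powers of 2, which are the codes of the singletons; all
  other sets keep the infinite value.\<close>

definition init_row :: com where
  "init_row =
     For ''s'' (Reg ''p'') (Write ''H'' (cell (Reg ''b'') (Reg ''v'') (Reg ''s'')) (Reg ''z'')) ;;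
     ''j'' ::= Const 1 ;;
     For ''i'' (Reg ''B'')
       (Write ''H'' (cell (Reg ''b'') (Reg ''v'') (Reg ''j''))
          (Read ''D'' (Read ''M'' (Reg ''v'') \<oplus> Read ''U'' (Reg ''i''))) ;;
        ''j'' ::= Reg ''j'' \<oplus> Reg ''j'')"

definition init_table :: com where
  "init_table = For ''b'' (Reg ''B'' \<oplus> Const 1) (For ''v'' (Reg ''n'') init_row)"

text \<open>Nodes are visited in the order g, g - 1, ..., 1. Successors are smaller, so a node has
  received all its marks before its turn. The array m of marks is unrelated to the register
  m.\<close>

definition collect_step :: com where
  "collect_step = ''y'' ::= Minus (Reg ''g'') (Reg ''i'') ;;
     If (Less (Const 0) (Read ''m'' (Reg ''y'')))
       (Write ''m'' (Read ''l'' (Reg ''y'')) (Const 1) ;;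
        Write ''m'' (Read ''r'' (Reg ''y'')) (Const 1) ;;
        If (Less (Const 0) (Read ''e'' (Reg ''y'')))
          (Write ''F'' (Minus (Read ''e'' (Reg ''y'')) (Const 1)) (Const 1)) Skip)
       Skip"

text \<open>The search starts at the entry for root 0, full budget and all terminals, whose code is
  2 ^ B - 1.\<close>

definition collect :: com where
  "collect = ''f'' ::= Read ''N'' (cell (Reg ''B'') (Const 0) (Minus (Reg ''p'') (Const 1))) ;;
     Write ''m'' (Reg ''f'') (Const 1) ;;
     For ''i'' (Reg ''g'') collect_step"

lemma wr_collect_step [simp]: "wr collect_step = {''y''}" "wa collect_step = {''m'', ''F''}"
  by (auto simp: collect_step_def)

lemma wr_init [simp]:
  "wr init_row = {''s'', ''j'', ''i''}" "wa init_row = {''H''}"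
  "wr init_table = {''b'', ''v'', ''s'', ''j'', ''i''}" "wa init_table = {''H''}"
  by (auto simp: init_row_def init_table_def)

lemma bcmd_output_upd:
  assumes "snd t ''F'' = (snd s ''F'')(v * n + u := 1)" "v < n" "u < n"
  shows "bcmd_output n t = insert {v, u} (bcmd_output n s)"
  unfolding bcmd_output_def assms(1) using assms(2,3) by (auto simp: mat_index_eq)

context bcmd_table
begin

section \<open>The initial table\<close>

definition row :: "nat \<Rightarrow> nat \<Rightarrow> nat \<Rightarrow> (nat \<Rightarrow> nat) \<Rightarrow> bool" where
  "row i b v H \<longleftrightarrow>
     (\<forall>S\<subseteq>{..<B}. H (entry b v S) = Suc total_weight \<or> (\<exists>j. S = {j} \<and> H (entry b v S) = D v (U j))) \<and>
     (\<forall>j<i. H (entry b v {j}) = D v (U j))"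

definition other_rows :: "nat \<Rightarrow> nat \<Rightarrow> state \<Rightarrow> state \<Rightarrow> bool" where
  "other_rows b v s t \<longleftrightarrow> (\<forall>b' v' m. v' < n \<longrightarrow> m < 2 ^ B \<longrightarrow> (b', v') \<noteq> (b, v) \<longrightarrow>
     snd t ''H'' (index b' v' m) = snd s ''H'' (index b' v' m))"

lemma other_rows_upd:
  assumes "other_rows b v s t" "snd t' ''H'' = (snd t ''H'')(index b v m := x)" "v < n" "m < 2 ^ B"
  shows "other_rows b v s t'"
  using assms(1) index_eq[OF _ assms(3) _ assms(4)] unfolding other_rows_def assms(2) by auto

lemma row_upd:
  assumes "row i b v H" "i < B" "v < n"
  shows "row (Suc i) b v (H(entry b v {i} := D v (U i)))"
proof -
  let ?H = "H(entry b v {i} := D v (U i))"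
  have eq: "?H (entry b v S) = (if S = {i} then D v (U i) else H (entry b v S))" if "S \<subseteq> {..<B}" for S
    using entry_eq[of v v S "{i}"] that assms(2,3) by simp
  show ?thesis
    unfolding row_def
  proof (intro conjI allI impI)
    show "?H (entry b v S) = Suc total_weight \<or> (\<exists>j. S = {j} \<and> ?H (entry b v S) = D v (U j))"
      if "S \<subseteq> {..<B}" for S
      using assms(1) that unfolding eq[OF that] by (auto simp: row_def)
    show "?H (entry b v {j}) = D v (U j)" if "j < Suc i" for j
      using assms(1,2) that eq[of "{j}"] by (auto simp: row_def less_Suc_eq)
  qed
qed

lemma ok_init_row:
  assumes s: "dp_input s" "fst s ''z'' = Suc total_weight" "\<And>i. i < B \<Longrightarrow> snd s ''U'' i = U i"
    and bv: "fst s ''b'' = b" "fst s ''v'' = v" "b \<le> B" "v < n"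
  shows "ok init_row s ((2 ^ B + 1) * 17 + (2 + (B + 1) * 26))
    (\<lambda>t. other_rows b v s t \<and> row B b v (snd t ''H''))"
proof -
  let ?p1 = "Write ''H'' (cell (Reg ''b'') (Reg ''v'') (Reg ''s'')) (Reg ''z'')"
  let ?p2 = "Write ''H'' (cell (Reg ''b'') (Reg ''v'') (Reg ''j''))
          (Read ''D'' (Read ''M'' (Reg ''v'') \<oplus> Read ''U'' (Reg ''i''))) ;;
        ''j'' ::= Reg ''j'' \<oplus> Reg ''j''"
  let ?ctx = "\<lambda>t. dp_input t \<and> (\<forall>i<B. snd t ''U'' i = U i) \<and> fst t ''b'' = b \<and> fst t ''v'' = v"
  let ?I1 = "\<lambda>m t. other_rows b v s t \<and> (\<forall>k<m. snd t ''H'' (index b v k) = Suc total_weight)"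
  let ?I2 = "\<lambda>i t. fst t ''j'' = 2 ^ i \<and> other_rows b v s t \<and> row i b v (snd t ''H'')"
  have enc: "set_encode {i} = 2 ^ i" for i
    by (simp add: set_encode_def)
  have 1: "ok (For ''s'' (Reg ''p'') ?p1) s ((2 ^ B + 1) * 17) (?I1 (2 ^ B))"
  proof (rule ok_For[where I = ?I1 and T = 9])
    fix m t
    assume t: "m < 2 ^ B" "?I1 m t" "fst t ''s'' = m" "frame ''s'' ?p1 s t"
    have "dp_input t"
      using s(1) t(4) by (rule dp_input_same) simp_all
    then have H: "snd (run ?p1 t) ''H'' = (snd t ''H'')(index b v m := Suc total_weight)"
      using s bv t by (simp add: cell_def dp_input_def index_def same_def)
    have "?I1 (Suc m) (run ?p1 t)"
      using other_rows_upd[OF conjunct1[OF t(2)] H bv(4) t(1)] t(2) unfolding H by (simp add: less_Suc_eq)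
    then show "ok ?p1 t 9 (?I1 (Suc m))"
      by (intro ok_loopfree) (simp_all add: cell_def)
  qed (use s in \<open>auto simp: other_rows_def same_def dp_input_def\<close>)
  have 2: "ok (''j'' ::= Const 1) t 2 (\<lambda>t. ?I2 0 t \<and> ?ctx t)"
    if t: "?I1 (2 ^ B) t \<and> effect (For ''s'' (Reg ''p'') ?p1) s t" for t
  proof (rule ok_loopfree)
    have "dp_input t" "\<forall>i<B. snd t ''U'' i = U i" "fst t ''b'' = b" "fst t ''v'' = v"
      using dp_input_same[OF s(1) conjunct2[OF t]] t s bv by (simp_all add: same_def)
    then show "?I2 0 (run (''j'' ::= Const 1) t) \<and> ?ctx (run (''j'' ::= Const 1) t)"
      using t by (simp add: row_def set_encode_less other_rows_def dp_input_def input_def)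
  qed simp_all
  have 3: "ok (For ''i'' (Reg ''B'') ?p2) t ((B + 1) * 26) (?I2 B)" if t: "?I2 0 t \<and> ?ctx t" for t
  proof (rule ok_For[where I = ?I2 and T = 18])
    fix i t'
    assume t': "i < B" "?I2 i t'" "fst t' ''i'' = i" "frame ''i'' ?p2 t t'"
    have "dp_input t'"
      using conjunct1[OF conjunct2[OF t]] t'(4) by (rule dp_input_same) simp_all
    then have H: "snd (run ?p2 t') ''H'' = (snd t' ''H'')(index b v (2 ^ i) := D v (U i))"
      using t bv t' U_less[of i] by (simp add: cell_def dp_input_def input_def index_def same_def)
    have "other_rows b v s (run ?p2 t')"
      by (rule other_rows_upd[OF _ H bv(4)]) (use t' in \<open>auto intro: power_strict_increasing\<close>)
    moreover have "row (Suc i) b v (snd (run ?p2 t') ''H'')"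
      unfolding H using row_upd[of i b v "snd t' ''H''"] t' bv(4) by (simp add: enc)
    ultimately have "?I2 (Suc i) (run ?p2 t')"
      using t' by simp
    then show "ok ?p2 t' 18 (?I2 (Suc i))"
      by (rule ok_loopfree[rotated]) (simp_all add: cell_def)
  qed (use t in \<open>auto simp: other_rows_def same_def dp_input_def input_def\<close>)
  have "ok init_row s ((2 ^ B + 1) * 17 + (2 + (B + 1) * 26)) (?I2 B)"
    unfolding init_row_def by (rule ok_Seq[OF ok_frame[OF 1] ok_Seq[OF 2 3]])
  then show ?thesis
    by (rule ok_mono) simp_all
qed

definition filled :: "(nat \<Rightarrow> nat) \<Rightarrow> bool" where
  "filled H \<longleftrightarrow> (\<forall>b\<le>B. \<forall>v<n. row B b v H)"

lemma ok_init_table: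
  assumes s: "dp_input s" "fst s ''z'' = Suc total_weight" "\<And>i. i < B \<Longrightarrow> snd s ''U'' i = U i"
  shows "ok init_table s ((B + 2) * ((n + 1) * ((2 ^ B + 1) * 17 + (2 + (B + 1) * 26) + 8) + 10))
    (\<lambda>t. filled (snd t ''H''))"
proof -
  let ?T = "(2 ^ B + 1) * 17 + (2 + (B + 1) * 26)"
  let ?p = "For ''v'' (Reg ''n'') init_row"
  let ?J = "\<lambda>(s :: state) (t :: state). \<forall>b v. v < n \<longrightarrow> row B b v (snd s ''H'') \<longrightarrow> row B b v (snd t ''H'')"
  let ?ctx = "\<lambda>t. dp_input t \<and> fst t ''z'' = Suc total_weight \<and> (\<forall>i<B. snd t ''U'' i = U i)"
  have ctx: "?ctx t'" if "?ctx t" "same {''b'', ''v'', ''s'', ''j'', ''i''} {''H''} t t'" for t t'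
    using dp_input_same[OF conjunct1[OF that(1)] that(2)] that by (simp add: same_def)
  have step: "ok init_row t ?T (\<lambda>u. ?J t u \<and> row B b v (snd u ''H''))"
    if t: "?ctx t" "fst t ''b'' = b" "fst t ''v'' = v" "b \<le> B" "v < n" for t b v
  proof (rule ok_mono[OF ok_init_row order_refl])
    fix u
    assume u: "other_rows b v t u \<and> row B b v (snd u ''H'')"
    have "row B b' v' (snd u ''H'')" if "v' < n" "row B b' v' (snd t ''H'')" for b' v'
    proof (cases "(b', v') = (b, v)")
      case False
      then have "snd u ''H'' (entry b' v' S) = snd t ''H'' (entry b' v' S)" if "S \<subseteq> {..<B}" for S
        using conjunct1[OF u] \<open>v' < n\<close> set_encode_less[OF that] by (simp add: other_rows_def)
      then show ?thesis
        using that(2) by (simp add: row_def del: set_encode_insert)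
    qed (use u in simp)
    then show "?J t u \<and> row B b v (snd u ''H'')"
      using u by blast
  qed (use t in auto)
  have inner: "ok ?p t ((n + 1) * (?T + 8)) (\<lambda>u. ?J t u \<and> (\<forall>v<n. row B b v (snd u ''H'')))"
    if t: "?ctx t" "fst t ''b'' = b" "b \<le> B" for t b
  proof (rule ok_For_stable[where J = ?J and T = ?T])
    fix v t'
    assume t': "v < n" "fst t' ''v'' = v" "frame ''v'' init_row t t'"
    have "?ctx t'"
      by (rule ctx[OF t(1)]) (use t'(3) in \<open>simp add: same_def\<close>)
    then show "ok init_row t' ?T (\<lambda>u. ?J t' u \<and> row B b v (snd u ''H''))"
      by (rule step) (use t t' in \<open>simp_all add: same_def\<close>)
  qed (use t in \<open>auto simp: same_def dp_input_def input_def\<close>)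
  have "ok init_table s ((B + 2) * ((n + 1) * (?T + 8) + 10))
    (\<lambda>t. ?J s t \<and> (\<forall>b<B + 1. \<forall>v<n. row B b v (snd t ''H'')))"
    unfolding init_table_def
  proof (rule ok_For_stable[where J = ?J and T = "(n + 1) * (?T + 8)"])
    fix b t
    assume t: "b < B + 1" "fst t ''b'' = b" "frame ''b'' ?p s t"
    have "?ctx t"
      by (rule ctx[of s]) (use s t(3) in \<open>simp_all add: same_def\<close>)
    then show "ok ?p t ((n + 1) * (?T + 8)) (\<lambda>u. ?J t u \<and> (\<forall>v<n. row B b v (snd u ''H'')))"
      by (rule inner) (use t in simp_all)
  qed (use s in \<open>auto simp: same_def dp_input_def input_def\<close>)
  then show ?thesis
    by (rule ok_mono) (auto simp: filled_def)
qed

text \<open>The empty edge set, node 0, certifies infinite entries as well as distances in the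
  original graph, and trees of 0 rounds come from \<open>base\<close> alone.\<close>

lemma filled_dp_inv:
  assumes "filled (snd s ''H'')" "fst s ''g'' = 0" "\<And>k. snd s ''N'' k = 0"
  shows "dp_inv s" "reached 0 (snd s ''H'')"
proof -
  have "table (\<lambda>_. {}) s"
    unfolding table_def
  proof (intro allI impI)
    fix b v S
    assume *: "b \<le> B" "v < n" "S \<subseteq> {..<B}"
    then have "snd s ''H'' (entry b v S) = Suc total_weight \<or> (\<exists>j. S = {j} \<and> snd s ''H'' (entry b v S) = D v (U j))"
      using assms(1) by (simp add: filled_def row_def)
    then have "sol b v S (snd s ''H'' (entry b v S)) {}"
      using * D_sound U_less by (auto simp: sol_def)
    then show "snd s ''N'' (entry b v S) \<le> fst s ''g'' \<and> sol b v S (snd s ''H'' (entry b v S)) {}"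
      by (simp add: assms)
  qed
  moreover have "dag (\<lambda>_. {}) s"
    by (simp add: dag_def assms)
  ultimately show "dp_inv s"
    unfolding dp_inv_def by blast
  show "reached 0 (snd s ''H'')"
    unfolding reached_def
  proof (intro allI impI)
    fix b v S x
    assume "tree 0 b v S x"
    then show "snd s ''H'' (entry b v S) \<le> x"
      by cases (use assms(1) in \<open>auto simp: filled_def row_def\<close>)
  qed
qed

text \<open>The future output of the descending pass: edges written so far and the sets of marked
  nodes still to be visited. It stays constant, since a visit exchanges a node for its successors
  and its own edge.\<close>

definition frontier :: "(nat \<Rightarrow> nat set set) \<Rightarrow> nat \<Rightarrow> state \<Rightarrow> nat set set" where
  "frontier es y s = bcmd_output n s \<union> (\<Union>z\<in>{z. snd s ''m'' z \<noteq> 0 \<and> z \<le> y}. es z)"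

lemma frontier_step:
  assumes dag: "dag es s" and y: "y = fst s ''g'' - fst s ''i''" "fst s ''i'' < fst s ''g''"
  shows "frontier es (y - 1) (run collect_step s) = frontier es y s"
proof (cases "snd s ''m'' y = 0")
  case True
  then have *: "snd (run collect_step s) = snd s"
    by (simp add: collect_step_def y(1))
  have "{z. snd s ''m'' z \<noteq> 0 \<and> z \<le> y - 1} = {z. snd s ''m'' z \<noteq> 0 \<and> z \<le> y}"
  proof (intro Collect_cong conj_cong refl)
    fix z
    assume "snd s ''m'' z \<noteq> 0"
    then have "z \<noteq> y"
      using True by auto
    then show "z \<le> y - 1 \<longleftrightarrow> z \<le> y"
      by linarith
  qed
  then show ?thesis
    by (simp add: frontier_def bcmd_output_def *)
next
  case False
  let ?t = "run collect_step s"
  let ?l = "snd s ''l'' y" and ?r = "snd s ''r'' y" and ?e = "snd s ''e'' y"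
  have "0 < y" "y \<le> fst s ''g''"
    using y by simp_all
  then have node: "?l < y" "?r < y" "?e = 0 \<and> es y = es ?l \<union> es ?r \<or>
        (\<exists>v<n. \<exists>u<n. ?e = Suc (v * n + u) \<and> es y = insert {v, u} (es ?l \<union> es ?r))"
    using dag unfolding dag_def coded_def by blast+
  have m: "snd ?t ''m'' = (snd s ''m'')(?l := 1, ?r := 1)"
    using False by (simp add: collect_step_def y(1))
  have F: "snd ?t ''F'' = (if ?e = 0 then snd s ''F'' else (snd s ''F'')(?e - 1 := 1))"
    using False by (simp add: collect_step_def y(1))
  have marks: "{z. snd ?t ''m'' z \<noteq> 0 \<and> z \<le> y - 1} = {?l, ?r} \<union> {z. z < y \<and> snd s ''m'' z \<noteq> 0}"
    "{z. snd s ''m'' z \<noteq> 0 \<and> z \<le> y} = insert y {z. z < y \<and> snd s ''m'' z \<noteq> 0}"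
  proof -
    have le: "z \<le> y - 1 \<longleftrightarrow> z < y" for z
      using \<open>0 < y\<close> by linarith
    show "{z. snd ?t ''m'' z \<noteq> 0 \<and> z \<le> y - 1} = {?l, ?r} \<union> {z. z < y \<and> snd s ''m'' z \<noteq> 0}"
      unfolding m le using node(1,2) by auto
    show "{z. snd s ''m'' z \<noteq> 0 \<and> z \<le> y} = insert y {z. z < y \<and> snd s ''m'' z \<noteq> 0}"
      using False by (auto simp: le_less)
  qed
  from node(3) show ?thesis
  proof (elim disjE conjE exE)
    assume "?e = 0" "es y = es ?l \<union> es ?r"
    moreover from this have "bcmd_output n ?t = bcmd_output n s"
      by (simp add: bcmd_output_def F)
    ultimately show ?thesis
      unfolding frontier_def marks by auto
  next
    fix v u
    assume "v < n" "u < n" "?e = Suc (v * n + u)" "es y = insert {v, u} (es ?l \<union> es ?r)"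
    moreover from this have "bcmd_output n ?t = insert {v, u} (bcmd_output n s)"
      by (intro bcmd_output_upd) (simp_all add: F)
    ultimately show ?thesis
      unfolding frontier_def marks by auto
  qed
qed

lemma ok_collect:
  assumes s: "dp_input s" "dp_inv s" "\<And>k. snd s ''F'' k = 0" "\<And>k. snd s ''m'' k = 0"
  shows "ok collect s (16 + (fst s ''g'' + 1) * 48)
    (\<lambda>t. sol B 0 {..<B} (snd s ''H'' (entry B 0 {..<B})) (bcmd_output n t))"
proof -
  obtain es where es: "dag es s" "table es s"
    using s(2) by (auto simp: dp_inv_def)
  let ?f = "snd s ''N'' (entry B 0 {..<B})"
  have f: "?f \<le> fst s ''g''" "sol B 0 {..<B} (snd s ''H'' (entry B 0 {..<B})) (es ?f)"
    using es(2) n_pos unfolding table_def by blast+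
  have enc: "set_encode {..<m} = 2 ^ m - 1" for m
    unfolding set_encode_def by (induction m) simp_all
  let ?I = "\<lambda>i t. frontier es (fst s ''g'' - i) t = es ?f"
  have loop: "ok (For ''i'' (Reg ''g'') collect_step) t ((fst s ''g'' + 1) * 48) (?I (fst s ''g''))"
    if t: "?I 0 t" "same {''f''} {''m''} s t" for t
  proof (rule ok_For[where I = ?I and T = 40])
    fix i t'
    assume t': "i < fst s ''g''" "?I i t'" "fst t' ''i'' = i"
      "frame ''i'' collect_step t t'"
    have g: "fst t' ''g'' = fst s ''g''" "snd t' ''l'' = snd s ''l''" "snd t' ''r'' = snd s ''r''" "snd t' ''e'' = snd s ''e''"
      using t(2) t'(4) by (simp_all add: same_def)
    then have "dag es t'"
      using es(1) by (simp add: dag_def)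
    then have "?I (Suc i) (run collect_step t')"
      using frontier_step[of es t' "fst s ''g'' - i"] t' g by simp
    then show "ok collect_step t' 40 (?I (Suc i))"
      by (rule ok_loopfree[rotated]) (simp_all add: collect_step_def)
  qed (use t in \<open>auto simp: same_def frontier_def bcmd_output_def\<close>)
  have 1: "ok (''f'' ::= Read ''N'' (cell (Reg ''B'') (Const 0) (Minus (Reg ''p'') (Const 1)))) s 11
      (\<lambda>t. t = set_reg ''f'' ?f s)"
    by (rule ok_loopfree)
       (use s(1) n_pos in \<open>simp_all add: set_reg_def cell_def dp_input_def input_def index_def enc\<close>)
  have 2: "ok (Write ''m'' (Reg ''f'') (Const 1)) t 3 (\<lambda>u. ?I 0 u \<and> same {''f''} {''m''} s u)"
    if t: "t = set_reg ''f'' ?f s" for t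
  proof (rule ok_loopfree)
    let ?u = "run (Write ''m'' (Reg ''f'') (Const 1)) t"
    have "{z. snd ?u ''m'' z \<noteq> 0 \<and> z \<le> fst s ''g''} = {?f}"
      using f(1) s(4) by (auto simp: t)
    then show "?I 0 ?u \<and> same {''f''} {''m''} s ?u"
      using s(3) by (simp add: frontier_def bcmd_output_def same_def t)
  qed simp_all
  have "ok collect s (11 + (3 + (fst s ''g'' + 1) * 48)) (?I (fst s ''g''))"
    unfolding collect_def by (rule ok_Seq[OF 1 ok_Seq[OF 2 loop]]) simp_all
  then show ?thesis
  proof (rule ok_mono)
    fix t
    assume "?I (fst s ''g'') t"
    moreover have "es 0 = {}"
      using es(1) by (simp add: dag_def)
    ultimately have "bcmd_output n t = es ?f"
      by (auto simp: frontier_def)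
    then show "sol B 0 {..<B} (snd s ''H'' (entry B 0 {..<B})) (bcmd_output n t)"
      using f(2) by simp
  qed simp
qed

section \<open>The approximation factor\<close>

lemma diameter_le_total:
  assumes "diameter {..<n} E' w = enat d"
  shows "d \<le> total_weight"
proof -
  have "diameter {..<n} E' w \<le> enat total_weight"
    unfolding diameter_def
  proof (intro SUP_least)
    fix u v
    assume "u \<in> {..<n}" "v \<in> {..<n}"
    then have "graph_dist {..<n} E' w u v \<le> enat d"
      using graph_dist_le_diameter assms by metis
    then show "graph_dist {..<n} E' w u v \<le> enat total_weight"
      using graph_dist_le_total[of E' u v] by (cases "graph_dist {..<n} E' w u v") auto
  qed
  then show ?thesis
    using assms by simp
qed

lemma approx_solution:
  assumes cover: "\<And>v. v < n \<Longrightarrow> \<exists>x\<in>centres U B. enat (D x v) \<le> D_opt {..<n} E w c B"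
    and reached: "reached (B + B + B) H"
    and F: "sol B 0 {..<B} (H (entry B 0 {..<B})) F"
  shows "bcmd_approx_solution 1 4 {..<n} E w c B F"
proof -
  let ?D = "D_opt {..<n} E w c B"
  have "ereal_of_enat (diameter {..<n} (E \<union> F) w) \<le> ereal 4 * ereal_of_enat ?D"
  proof (cases ?D)
    case (enat d)
    obtain F' where "diameter {..<n} (E \<union> F') w = ?D"
      using D_opt_attained by blast
    \<comment> \<open>Only entries up to \<open>total_weight\<close> carry a claim about distances,
      so a table entry of at most d is a true bound.\<close>
    then have d: "d \<le> total_weight"
      using diameter_le_total enat by metis
    let ?d = "graph_dist {..<n} (E \<union> F) w"
    \<comment> \<open>For B = 0 there are no terminals; i < B provides the positive budget that
      \<open>tree_D_opt\<close> requires.\<close>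
    have terminal: "?d 0 (U i) \<le> enat d" if i: "i < B" for i
    proof -
      obtain x where x: "tree (B + B + B) B 0 {..<B} x" "x \<le> d"
        using tree_D_opt[OF enat _ n_pos] i by force
      then have "H (entry B 0 {..<B}) \<le> d"
        using reached unfolding reached_def by (meson order_trans)
      moreover from this have "?d 0 (U i) \<le> enat (H (entry B 0 {..<B}))"
        using F d i unfolding sol_def by simp
      ultimately show ?thesis
        by (meson enat_ord_simps(1) order_trans)
    qed
    \<comment> \<open>New edges lead from 0 to a centre within d of v, and original edges lead on to
      v.\<close>
    have ecc: "?d 0 v \<le> enat (d + d)" if v: "v < n" for v
    proof -
      obtain x where x: "x \<in> centres U B" "D x v \<le> d"
        using cover[OF v] enat by auto
      have "x < n"
        using x(1) U_less n_pos by (auto simp: centres_def)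
      have "?d 0 x \<le> enat d"
        using x(1) terminal n_pos by (auto simp: centres_def)
      moreover have "?d x v \<le> enat d"
      proof -
        have "?d x v \<le> graph_dist {..<n} E w x v"
          by (rule graph_dist_mono) simp
        also have "\<dots> \<le> enat (D x v)"
          using \<open>x < n\<close> v x(2) d by (intro D_sound) auto
        also have "\<dots> \<le> enat d"
          using x(2) by simp
        finally show ?thesis .
      qed
      ultimately have "?d 0 x + ?d x v \<le> enat d + enat d"
        by (rule add_mono)
      then show ?thesis
        using graph_dist_triangle[of "{..<n}" "E \<union> F" w 0 v x] by simp
    qed
    have "diameter {..<n} (E \<union> F) w \<le> enat (4 * d)"
      unfolding diameter_def
    proof (intro SUP_least)
      fix u v
      assume uv: "u \<in> {..<n}" "v \<in> {..<n}"
      have "?d u v \<le> ?d u 0 + ?d 0 v"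
        by (rule graph_dist_triangle)
      also have "\<dots> \<le> enat (d + d) + enat (d + d)"
        using ecc uv graph_dist_commute[of "{..<n}" "E \<union> F" w u 0] by (intro add_mono) simp_all
      also have "\<dots> = enat (4 * d)"
        by (simp only: plus_enat_simps) simp
      finally show "?d u v \<le> enat (4 * d)" .
    qed
    then have "ereal_of_enat (diameter {..<n} (E \<union> F) w) \<le> ereal_of_enat (enat (4 * d))"
      by (simp only: ereal_of_enat_le_iff)
    then show ?thesis
      by (simp add: enat)
  qed simp
  then show ?thesis
    using F by (simp add: bcmd_approx_solution_def sol_def del: of_nat_sum)
qed

end

section \<open>The algorithm\<close>

text \<open>The table \<open>Y\<close> leaves n * 2 ^ B in the register y, which is the step for
  \<open>X\<close>; so all strides of \<open>cell\<close> arise by addition.\<close>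

definition setup_tables :: com where
  "setup_tables =
     multiples ''M'' ''j'' ''n'' ''v'' (Reg ''n'') ;;
     splits ;;
     multiples ''Y'' ''y'' ''p'' ''v'' (Reg ''n'') ;;
     multiples ''X'' ''k'' ''y'' ''b'' (Reg ''B'' \<oplus> Const 1)"

definition distances :: com where
  "distances = sum_weights ;; init_dist ;; floyd ;; farthest_first"

definition algorithm :: com where
  "algorithm = setup_tables ;; distances ;; init_table ;; rounds ;; collect"

lemma wr_parts [simp]:
  "wr (multiples a y d x e) = {x, y}" "wa (multiples a y d x e) = {a}"
  "wr splits = {''p'', ''q'', ''i'', ''x''}" "wa splits = {''L'', ''R''}"
  "wr sum_weights = {''z'', ''v'', ''u''}" "wa sum_weights = {}"
  "wr init_dist = {''v'', ''u'', ''j''}" "wa init_dist = {''D''}"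
  "wr floyd = {''k'', ''v'', ''u'', ''m'', ''j''}" "wa floyd = {''D''}"
  "wr farthest_first = {''v'', ''i'', ''m'', ''j''}" "wa farthest_first = {''t'', ''U''}"
  "wa rounds = {''l'', ''r'', ''e'', ''H'', ''N''}"
  "wr rounds = {''f'', ''x'', ''b'', ''d'', ''v'', ''i'', ''j'', ''o'', ''a'', ''y'', ''k'', ''m'', ''g'', ''s'', ''u''}"
  by (auto simp: multiples_def splits_def sum_weights_def init_dist_def floyd_def farthest_first_def
      rounds_def merges_def paths_def)

lemma counts_in_rounds: "counts_in ''g'' rounds"
  by (simp add: rounds_def merges_def paths_def merge_step_def path_step_def relax_def setup_defs)

definition setup_time :: "nat \<Rightarrow> nat \<Rightarrow> nat" where
  "setup_time n B = (n + 1) * 17 + (((B + 1) * ((3 ^ B + 1) * 50 + 18) + 4) + ((n + 1) * 17 + (B + 2) * 19))"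

definition distances_time :: "nat \<Rightarrow> nat \<Rightarrow> nat" where
  "distances_time n B = ((n + 1) * ((n + 1) * 16 + 8) + 2) + ((n + 1) * ((n + 1) * 50 + 8) +
     ((n + 1) * ((n + 1) * ((n + 1) * 50 + 8) + 8) +
      ((n + 1) * 12 + (B + 1) * (2 + ((n + 1) * 30 + (3 + (n + 1) * 30)) + 8))))"

definition rounds_time :: "nat \<Rightarrow> nat \<Rightarrow> nat" where
  "rounds_time n B = (B + B + B + 1) *
     ((3 ^ B + 1) * ((B + 2) * ((B + 2) * ((n + 1) * 158 + 12) + 10) + 8) +
      (2 ^ B + 1) * ((B + 2) * ((n + 1) * ((n + 1) * 258 + 8) + 10) + 8) + 12)"

text \<open>By \<open>counts_in_rounds\<close> the rounds allocate at most as many nodes as they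
  take time units, so \<open>rounds_time\<close> also bounds the iterations of
  \<open>collect\<close>.\<close>

definition table_time :: "nat \<Rightarrow> nat \<Rightarrow> nat" where
  "table_time n B = (B + 2) * ((n + 1) * ((2 ^ B + 1) * 17 + (2 + (B + 1) * 26) + 8) + 10) +
     (rounds_time n B + (16 + (rounds_time n B + 1) * 48))"

definition total_time :: "nat \<Rightarrow> nat \<Rightarrow> nat" where
  "total_time n B = setup_time n B + (distances_time n B + table_time n B)"

context bcmd
begin

definition tables :: "state \<Rightarrow> bool" where
  "tables s \<longleftrightarrow> input s \<and> fst s ''p'' = 2 ^ B \<and> fst s ''q'' = 3 ^ B \<and>
     is_splits B (snd s ''L'') (snd s ''R'') \<and>
     (\<forall>b\<le>B. snd s ''X'' b = b * (n * 2 ^ B)) \<and> (\<forall>v<n. snd s ''Y'' v = v * 2 ^ B)"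

text \<open>The counter and the arrays that the dynamic program and \<open>collect\<close> expect to
  be still zero.\<close>

definition clean :: "state \<Rightarrow> bool" where
  "clean s \<longleftrightarrow> fst s ''g'' = 0 \<and> (\<forall>k. snd s ''N'' k = 0) \<and> (\<forall>k. snd s ''F'' k = 0) \<and> (\<forall>k. snd s ''m'' k = 0)"

lemma tables_same:
  assumes "tables s" "same W A s t" "W \<inter> {''n'', ''B'', ''p'', ''q''} = {}"
    "A \<inter> {''E'', ''w'', ''c'', ''M'', ''L'', ''R'', ''X'', ''Y''} = {}"
  shows "tables t"
  using assms by (simp add: tables_def input_def same_def)

lemma clean_same:
  assumes "clean s" "same W A s t" "''g'' \<notin> W" "A \<inter> {''N'', ''F'', ''m''} = {}"
  shows "clean t"
  using assms by (simp add: clean_def same_def)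

lemma ok_setup_tables:
  "ok setup_tables (bcmd_input n E w c B) (setup_time n B) (\<lambda>t. tables t \<and> clean t)"
proof -
  let ?s = "bcmd_input n E w c B"
  let ?R1 = "\<lambda>t. input t \<and> clean t \<and> snd t ''L'' 0 = 0 \<and> snd t ''R'' 0 = 0"
  let ?R2 = "\<lambda>t. input t \<and> clean t \<and> fst t ''p'' = 2 ^ B \<and> fst t ''q'' = 3 ^ B \<and>
    is_splits B (snd t ''L'') (snd t ''R'')"
  let ?R3 = "\<lambda>t. ?R2 t \<and> fst t ''y'' = n * 2 ^ B \<and> (\<forall>v<n. snd t ''Y'' v = v * 2 ^ B)"
  have 1: "ok (multiples ''M'' ''j'' ''n'' ''v'' (Reg ''n'')) ?s ((n + 1) * 17) ?R1"
    by (rule ok_mono[OF ok_frame[OF ok_multiples[where N = n and k = n]]])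
       (auto simp: same_def bcmd_input_def input_def clean_def)
  have 2: "ok splits t (((B + 1) * ((3 ^ B + 1) * 50 + 18) + 4)) ?R2" if "?R1 t" for t
    by (rule ok_mono[OF ok_frame[OF ok_splits[where B = B]]])
       (use that in \<open>auto simp: same_def input_def clean_def\<close>)
  have 3: "ok (multiples ''Y'' ''y'' ''p'' ''v'' (Reg ''n'')) t ((n + 1) * 17) ?R3" if "?R2 t" for t
    by (rule ok_mono[OF ok_frame[OF ok_multiples[where N = n and k = "2 ^ B"]]])
       (use that in \<open>auto simp: same_def input_def clean_def\<close>)
  have 4: "ok (multiples ''X'' ''k'' ''y'' ''b'' (Reg ''B'' \<oplus> Const 1)) t ((B + 2) * 19)
      (\<lambda>t. tables t \<and> clean t)" if "?R3 t" for t
    by (rule ok_mono[OF ok_frame[OF ok_multiples[where N = "B + 1" and k = "n * 2 ^ B"]]])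
       (use that in \<open>auto simp: same_def input_def clean_def tables_def\<close>)
  show ?thesis
    unfolding setup_tables_def setup_time_def
    by (rule ok_Seq[OF 1 ok_Seq[OF 2 ok_Seq[OF 3 4]]])
qed

lemma ok_distances:
  assumes s: "tables s" "clean s"
  shows "ok distances s (distances_time n B) (\<lambda>t. tables t \<and> clean t \<and> fst t ''z'' = Suc total_weight \<and>
    dist_sound (snd t ''D'') \<and> dist_complete n (snd t ''D'') \<and>
    traversal (snd t ''D'') B (snd t ''U'') (snd t ''t''))"
    (is "ok _ _ _ ?Q")
proof -
  let ?R1 = "\<lambda>t. tables t \<and> clean t \<and> fst t ''z'' = Suc total_weight"
  let ?R2 = "\<lambda>k t. ?R1 t \<and> dist_sound (snd t ''D'') \<and> dist_complete k (snd t ''D'')"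
  have inp: "input t" if "?R1 t" for t
    using that by (simp add: tables_def)
  have 1: "ok sum_weights s ((n + 1) * ((n + 1) * 16 + 8) + 2) ?R1"
  proof (rule ok_mono[OF ok_frame[OF ok_sum_weights] order_refl])
    show "input s"
      using s by (simp add: tables_def)
    fix t
    assume t: "fst t ''z'' = Suc total_weight \<and> effect sum_weights s t"
    show "?R1 t"
      using tables_same[OF s(1) conjunct2[OF t]] clean_same[OF s(2) conjunct2[OF t]] t by simp
  qed
  have 2: "ok init_dist s ((n + 1) * ((n + 1) * 50 + 8)) (?R2 0)" if s: "?R1 s" for s
  proof (rule ok_mono[OF ok_frame[OF ok_init_dist[OF inp[OF s]]] order_refl])
    fix t
    assume t: "(\<forall>v<n. \<forall>u<n. snd t ''D'' (v * n + u) = edge_dist v u) \<and> effect init_dist s t"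
    show "?R2 0 t"
      using tables_same[OF _ conjunct2[OF t]] clean_same[OF _ conjunct2[OF t]] dist_edge_dist[OF conjunct1[OF t]] s t
      by (simp add: same_def)
  qed (use s in simp)
  have 3: "ok floyd s ((n + 1) * ((n + 1) * ((n + 1) * 50 + 8) + 8)) (?R2 n)" if s: "?R2 0 s" for s
  proof (rule ok_mono[OF ok_frame[OF ok_floyd[OF inp]] order_refl])
    fix t
    assume t: "(dist_sound (snd t ''D'') \<and> dist_complete n (snd t ''D'')) \<and> effect floyd s t"
    show "?R2 n t"
      using tables_same[OF _ conjunct2[OF t]] clean_same[OF _ conjunct2[OF t]] s t by (simp add: same_def)
  qed (use s in simp_all)
  have 4: "ok farthest_first s ((n + 1) * 12 + (B + 1) * (2 + ((n + 1) * 30 + (3 + (n + 1) * 30)) + 8)) ?Q"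
    if s: "?R2 n s" for s
  proof (rule ok_mono[OF ok_frame[OF ok_farthest_first[OF inp refl]] order_refl])
    fix t
    assume t: "traversal (snd s ''D'') B (snd t ''U'') (snd t ''t'') \<and> effect farthest_first s t"
    show "?Q t"
      using tables_same[OF _ conjunct2[OF t]] clean_same[OF _ conjunct2[OF t]] s t by (simp add: same_def)
  qed (use s in simp)
  show ?thesis
    unfolding distances_def distances_time_def
    by (rule ok_Seq[OF 1 ok_Seq[OF 2 ok_Seq[OF 3 4]]])
qed

lemma ok_table:
  assumes s: "tables s" "clean s" "fst s ''z'' = Suc total_weight"
    and A: "dist_sound (snd s ''D'')" "dist_complete n (snd s ''D'')"
    and tr: "traversal (snd s ''D'') B (snd s ''U'') (snd s ''t'')"
  shows "ok (init_table ;; rounds ;; collect) s (table_time n B)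
    (\<lambda>t. bcmd_approx_solution 1 4 {..<n} E w c B (bcmd_output n t))"
    (is "ok _ _ _ ?Q")
proof -
  \<comment> \<open>Distances and terminals are the actual array contents, which the remaining parts
    of the program do not change.\<close>
  interpret bcmd_table n E w c B "\<lambda>v u. snd s ''D'' (v * n + u)" "snd s ''U''"
  proof
    show "snd s ''U'' i < n" if "i < B" for i
      using tr that by (simp add: traversal_def)
    show "enat (snd s ''D'' (u * n + v)) \<le> graph_dist {..<n} E w u v" for u v
      using A(2) by (rule dist_complete_n)
    show "graph_dist {..<n} E w u v \<le> enat (snd s ''D'' (u * n + v))"
      if "u < n" "v < n" "snd s ''D'' (u * n + v) \<le> total_weight" for u v
      using A(1) that by (simp add: dist_sound_def)
  qed
  let ?R1 = "\<lambda>t. dp_input t \<and> clean t \<and> filled (snd t ''H'')"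
  let ?R2 = "\<lambda>t. dp_input t \<and> dp_inv t \<and> reached (B + B + B) (snd t ''H'') \<and>
    fst t ''g'' \<le> rounds_time n B \<and> (\<forall>k. snd t ''F'' k = 0 \<and> snd t ''m'' k = 0)"
  have dp: "dp_input s"
    using s(1) by (simp add: dp_input_def tables_def)
  have 1: "ok init_table s ((B + 2) * ((n + 1) * ((2 ^ B + 1) * 17 + (2 + (B + 1) * 26) + 8) + 10)) ?R1"
  proof (rule ok_mono[OF ok_frame[OF ok_init_table[OF dp s(3) refl]] order_refl])
    fix t
    assume t: "filled (snd t ''H'') \<and> effect init_table s t"
    show "?R1 t"
      using dp_input_same[OF dp conjunct2[OF t]] clean_same[OF s(2) conjunct2[OF t]] t by simp
  qed
  have 2: "ok rounds u (rounds_time n B) ?R2" if u: "?R1 u" for u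
  proof -
    have u': "fst u ''g'' = 0" "dp_inv u" "reached 0 (snd u ''H'')"
      using u filled_dp_inv[of u] by (simp_all add: clean_def)
    have "ok rounds u (rounds_time n B) (\<lambda>t. dp_inv t \<and> reached (B + B + B) (snd t ''H''))"
      using ok_rounds[OF conjunct1[OF u] u'(2,3)] by (simp only: rounds_time_def merges_time_def paths_time_def)
    then show ?thesis
    proof (rule ok_mono[OF ok_frame[OF ok_counts_in[OF _ counts_in_rounds]] order_refl])
      fix t
      assume t: "((dp_inv t \<and> reached (B + B + B) (snd t ''H'')) \<and> fst t ''g'' \<le> fst u ''g'' + rounds_time n B) \<and>
        effect rounds u t"
      show "?R2 t"
        using dp_input_same[OF _ conjunct2[OF t]] u u' t by (simp add: same_def clean_def)
    qed
  qed
  have 3: "ok collect u (16 + (rounds_time n B + 1) * 48) ?Q" if u: "?R2 u" for u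
  proof (rule ok_mono[OF ok_collect])
    fix t
    assume F: "sol B 0 {..<B} (snd u ''H'' (entry B 0 {..<B})) (bcmd_output n t)"
    show "?Q t"
    proof (rule approx_solution)
      show "reached (B + B + B) (snd u ''H'')"
        using u by blast
      show "\<exists>x\<in>centres (snd s ''U'') B. enat (snd s ''D'' (x * n + v)) \<le> D_opt {..<n} E w c B"
        if "v < n" for v
        using tr A(2) that by (rule traversal_radius)
    qed (rule F)
  qed (use u in simp_all)
  show ?thesis
    unfolding table_time_def by (rule ok_Seq[OF 1 ok_Seq[OF 2 3]])
qed

lemma ok_algorithm:
  "ok algorithm (bcmd_input n E w c B) (total_time n B)
    (\<lambda>t. bcmd_approx_solution 1 4 {..<n} E w c B (bcmd_output n t))"
  unfolding algorithm_def total_time_def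
proof (rule ok_Seq[OF ok_setup_tables])
  fix t1
  assume t1: "tables t1 \<and> clean t1"
  show "ok (distances ;; init_table ;; rounds ;; collect) t1 (distances_time n B + table_time n B)
    (\<lambda>t. bcmd_approx_solution 1 4 {..<n} E w c B (bcmd_output n t))"
    by (rule ok_Seq[OF ok_distances]) (use t1 in \<open>blast intro: ok_table\<close>)+
qed

end


section \<open>Asymptotic estimate of the running time\<close>

definition dominated :: "(nat \<Rightarrow> nat \<Rightarrow> nat) \<Rightarrow> (nat \<Rightarrow> nat \<Rightarrow> nat) \<Rightarrow> bool" where
  "dominated f g \<longleftrightarrow> (\<exists>k. \<forall>n\<ge>1. \<forall>B\<ge>1. f n B \<le> k * g n B)"

lemma dominated_le: "(\<And>n B. n \<ge> 1 \<Longrightarrow> B \<ge> 1 \<Longrightarrow> f n B \<le> g n B) \<Longrightarrow> dominated f g"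
  unfolding dominated_def by (rule exI[of _ 1]) simp

lemma dominated_const: "(\<And>n B. n \<ge> 1 \<Longrightarrow> B \<ge> 1 \<Longrightarrow> 1 \<le> g n B) \<Longrightarrow> dominated (\<lambda>n B. k) g"
  unfolding dominated_def by (rule exI[of _ k]) (simp add: Suc_le_eq)

lemma dominated_add:
  assumes "dominated f g" "dominated f' g"
  shows "dominated (\<lambda>n B. f n B + f' n B) g"
proof -
  obtain k k' where "\<forall>n\<ge>1. \<forall>B\<ge>1. f n B \<le> k * g n B" "\<forall>n\<ge>1. \<forall>B\<ge>1. f' n B \<le> k' * g n B"
    using assms by (auto simp: dominated_def)
  then show ?thesis
    unfolding dominated_def by (intro exI[of _ "k + k'"]) (auto simp: add_mult_distrib intro: add_mono)
qed

lemma dominated_mult: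
  assumes "dominated f g" "dominated f' g'"
  shows "dominated (\<lambda>n B. f n B * f' n B) (\<lambda>n B. g n B * g' n B)"
proof -
  obtain k k' where k: "\<forall>n\<ge>1. \<forall>B\<ge>1. f n B \<le> k * g n B" "\<forall>n\<ge>1. \<forall>B\<ge>1. f' n B \<le> k' * g' n B"
    using assms by (auto simp: dominated_def)
  have "f n B * f' n B \<le> (k * k') * (g n B * g' n B)" if "n \<ge> 1" "B \<ge> 1" for n B
    using mult_le_mono[of "f n B" "k * g n B" "f' n B" "k' * g' n B"] k that by (simp add: mult_ac)
  then show ?thesis
    unfolding dominated_def by blast
qed

lemma dominated_cmult: "dominated f g \<Longrightarrow> dominated (\<lambda>n B. f n B * k) g"
  using dominated_mult[of f g "\<lambda>n B. k" "\<lambda>n B. 1"] dominated_const[of "\<lambda>n B. 1" k] by simp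

lemma dominated_trans:
  assumes "dominated f g" "dominated g h"
  shows "dominated f h"
proof -
  obtain k k' where k: "\<forall>n\<ge>1. \<forall>B\<ge>1. f n B \<le> k * g n B" "\<forall>n\<ge>1. \<forall>B\<ge>1. g n B \<le> k' * h n B"
    using assms by (auto simp: dominated_def)
  have "f n B \<le> (k * k') * h n B" if "n \<ge> 1" "B \<ge> 1" for n B
    using order_trans[of "f n B" "k * g n B" "k * (k' * h n B)"] k that by (simp add: mult_ac)
  then show ?thesis
    unfolding dominated_def by blast
qed

text \<open>The claimed bound without its logarithm, which is nonnegative for n, B \<ge> 1. Expanded
  it is 3 ^ B * B ^ 4 * n ^ 2 + B * n ^ 3.\<close>

definition time_bound :: "nat \<Rightarrow> nat \<Rightarrow> nat" where
  "time_bound n B = (3 ^ B * B ^ 3 + n) * B * n ^ 2"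

text \<open>For factors g of the first monomial; the cofactor h is at least 1.\<close>

lemma dominated_time_bound:
  assumes "\<And>n B. 3 ^ B * B ^ 4 * n ^ 2 = g n B * h n B" "\<And>n B. n \<ge> 1 \<Longrightarrow> B \<ge> 1 \<Longrightarrow> 1 \<le> h n B"
  shows "dominated g time_bound"
proof (rule dominated_le)
  fix n B :: nat
  assume "n \<ge> 1" "B \<ge> 1"
  then have "g n B * 1 \<le> g n B * h n B"
    by (intro mult_le_mono assms(2)) simp_all
  also have "\<dots> \<le> time_bound n B"
    unfolding assms(1)[symmetric] time_bound_def by (simp add: algebra_simps power_eq_if)
  finally show "g n B \<le> time_bound n B"
    by simp
qed

lemma power_2_le_3: "(2 :: nat) ^ B \<le> 3 ^ B"
  by (rule power_mono) simp_all

lemmas dominated_loop = dominated_add[OF dominated_mult] dominated_add[OF dominated_cmult] dominated_const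

lemma dominated_total_time: "dominated total_time time_bound"
proof -
  have n: "dominated (\<lambda>n B. n) time_bound"
    by (rule dominated_time_bound[where h = "\<lambda>n B. 3 ^ B * B ^ 4 * n"]) (simp_all add: power2_eq_square)
  have B: "dominated (\<lambda>n B. B) time_bound"
    by (rule dominated_time_bound[where h = "\<lambda>n B. 3 ^ B * B ^ 3 * n ^ 2"]) (simp_all add: eval_nat_numeral)
  have nn: "dominated (\<lambda>n B. n * n) time_bound"
    by (rule dominated_time_bound[where h = "\<lambda>n B. 3 ^ B * B ^ 4"]) (simp_all add: power2_eq_square)
  have Bn: "dominated (\<lambda>n B. B * n) time_bound"
    by (rule dominated_time_bound[where h = "\<lambda>n B. 3 ^ B * B ^ 3 * n"]) (simp_all add: eval_nat_numeral)
  have B3: "dominated (\<lambda>n B. B * 3 ^ B) time_bound"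
    by (rule dominated_time_bound[where h = "\<lambda>n B. B ^ 3 * n ^ 2"]) (simp_all add: eval_nat_numeral)
  have Bn3: "dominated (\<lambda>n B. B * (n * 3 ^ B)) time_bound"
    by (rule dominated_time_bound[where h = "\<lambda>n B. B ^ 3 * n"]) (simp_all add: eval_nat_numeral)
  have merges: "dominated (\<lambda>n B. B * (3 ^ B * (B * (B * n)))) time_bound"
    by (rule dominated_time_bound[where h = "\<lambda>n B. B * n"]) (simp_all add: eval_nat_numeral)
  have paths: "dominated (\<lambda>n B. B * (3 ^ B * (B * (n * n)))) time_bound"
    by (rule dominated_time_bound[where h = "\<lambda>n B. B * B"]) (simp_all add: eval_nat_numeral)
  \<comment> \<open>The cubic time of the distance computation is the term that falls under the
    second monomial.\<close>
  have nnn: "dominated (\<lambda>n B. n * (n * n)) time_bound"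
  proof (rule dominated_le)
    fix n B :: nat
    assume "B \<ge> 1"
    then have "n * (n * n) * 1 \<le> n * (n * n) * B"
      by (intro mult_le_mono) simp_all
    also have "\<dots> \<le> time_bound n B"
      unfolding time_bound_def by (simp add: algebra_simps power2_eq_square)
    finally show "n * (n * n) \<le> time_bound n B"
      by simp
  qed
  have const: "dominated (\<lambda>n B. k) time_bound" for k
    using dominated_trans[OF _ B, of "\<lambda>n B. k"] dominated_const[of "\<lambda>n B. B" k] by simp
  have dom_n: "dominated (\<lambda>n B. n + k) (\<lambda>n B. n)" and dom_B: "dominated (\<lambda>n B. B + k) (\<lambda>n B. B)"
    and dom_3: "dominated (\<lambda>n B. 3 ^ B + k) (\<lambda>n B. 3 ^ B)"
    and dom_2: "dominated (\<lambda>n B. 2 ^ B + k) (\<lambda>n B. 3 ^ B)"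
    and dom_BBB: "dominated (\<lambda>n B. B + B + B + 1) (\<lambda>n B. B)" for k
    by (intro dominated_add dominated_const dominated_le; simp add: power_2_le_3)+
  have round: "dominated rounds_time time_bound"
  proof -
    have "dominated (\<lambda>n B. (B + B + B + 1) *
       ((3 ^ B + 1) * ((B + 2) * ((B + 2) * ((n + 1) * 158 + 12) + 10) + 8))) (\<lambda>n B. B * (3 ^ B * (B * (B * n))))"
      by (intro dominated_mult dom_BBB dom_3 dominated_loop dom_B dom_n; simp)
    moreover have "dominated (\<lambda>n B. (B + B + B + 1) *
       ((2 ^ B + 1) * ((B + 2) * ((n + 1) * ((n + 1) * 258 + 8) + 10) + 8))) (\<lambda>n B. B * (3 ^ B * (B * (n * n))))"
      by (intro dominated_mult dom_BBB dom_2 dominated_loop dom_B dom_n; simp)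
    moreover have "dominated (\<lambda>n B. (B + B + B + 1) * 12) (\<lambda>n B. B)"
      by (intro dominated_cmult dom_BBB)
    ultimately have "dominated (\<lambda>n B. (B + B + B + 1) *
       ((3 ^ B + 1) * ((B + 2) * ((B + 2) * ((n + 1) * 158 + 12) + 10) + 8)) +
       (B + B + B + 1) * ((2 ^ B + 1) * ((B + 2) * ((n + 1) * ((n + 1) * 258 + 8) + 10) + 8)) +
       (B + B + B + 1) * 12) time_bound"
      by (intro dominated_add) (blast intro: dominated_trans merges paths B)+
    then show ?thesis
      unfolding rounds_time_def distrib_left .
  qed
  have "dominated setup_time time_bound"
  proof -
    have "dominated (\<lambda>n B. (n + 1) * 17) time_bound"
      by (intro dominated_trans[OF _ n] dominated_cmult dom_n)
    moreover have "dominated (\<lambda>n B. (B + 2) * 19) time_bound"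
      by (intro dominated_trans[OF _ B] dominated_cmult dom_B)
    moreover have "dominated (\<lambda>n B. (B + 1) * ((3 ^ B + 1) * 50 + 18)) time_bound"
      by (intro dominated_trans[OF _ B3] dominated_mult dom_B dominated_add[OF dominated_cmult] dom_3 dominated_const; simp)
    ultimately show ?thesis
      unfolding setup_time_def by (intro dominated_add const)
  qed
  moreover have "dominated distances_time time_bound"
  proof -
    have "dominated (\<lambda>n B. (n + 1) * ((n + 1) * 16 + 8)) time_bound" "dominated (\<lambda>n B. (n + 1) * ((n + 1) * 50 + 8)) time_bound"
      by (intro dominated_trans[OF _ nn] dominated_mult dom_n dominated_add[OF dominated_cmult] dominated_const; simp)+
    moreover have "dominated (\<lambda>n B. (n + 1) * ((n + 1) * ((n + 1) * 50 + 8) + 8)) time_bound"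
      by (intro dominated_trans[OF _ nnn] dominated_mult dom_n dominated_loop; simp)
    moreover have "dominated (\<lambda>n B. (n + 1) * 12) time_bound"
      by (intro dominated_trans[OF _ n] dominated_cmult dom_n)
    moreover have "dominated (\<lambda>n B. (B + 1) * (2 + ((n + 1) * 30 + (3 + (n + 1) * 30)) + 8)) time_bound"
      by (intro dominated_trans[OF _ Bn] dominated_mult dom_B dominated_add dominated_cmult dominated_const dominated_le; simp)
    ultimately show ?thesis
      unfolding distances_time_def by (intro dominated_add const)
  qed
  moreover have "dominated table_time time_bound"
  proof -
    \<comment> \<open>Filling a row takes time of order 2 ^ B + B, and both summands are at most 3 ^
      B.\<close>
    have "dominated (\<lambda>n B. B) (\<lambda>n B. 3 ^ B)"
      by (rule dominated_le) (metis less_exp less_imp_le order_trans power_2_le_3)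
    then have "dominated (\<lambda>n B. (B + 2) * ((n + 1) * ((2 ^ B + 1) * 17 + (2 + (B + 1) * 26) + 8) + 10)) time_bound"
      by (intro dominated_trans[OF _ Bn3] dominated_mult dom_B dom_n dominated_add[OF dominated_mult]
          dominated_add dominated_cmult dominated_trans[OF dom_B] dom_2 dominated_const; simp)
    moreover have "dominated (\<lambda>n B. (rounds_time n B + 1) * 48) time_bound"
      by (intro dominated_cmult dominated_add const round)
    ultimately show ?thesis
      unfolding table_time_def using round by (intro dominated_add const)
  qed
  ultimately show ?thesis
    unfolding total_time_def by (intro dominated_add)
qed

theorem theorem2:
  shows "\<exists>p. bcmd_approx_algorithm 1 4 p \<and>
    bcmd_running_time p
      (\<lambda>n B. (3 ^ B * real B ^ 3 + real n + log 2 (real B * real n)) * real B * real n ^ 2)"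
proof (intro exI conjI)
  show "bcmd_approx_algorithm 1 4 algorithm"
    unfolding bcmd_approx_algorithm_def
  proof (intro conjI allI impI)
    fix n B :: nat and E w c
    assume "bcmd_instance {..<n} E w c"
    then interpret bcmd n E w c B
      by unfold_locales
    show "\<exists>t s. exec algorithm (bcmd_input n E w c B) t s \<and>
      bcmd_approx_solution 1 4 {..<n} E w c B (bcmd_output n s)"
      using ok_algorithm unfolding ok_def by blast
  qed simp_all
  obtain k where k: "\<And>n B. n \<ge> 1 \<Longrightarrow> B \<ge> 1 \<Longrightarrow> total_time n B \<le> k * time_bound n B"
    using dominated_total_time unfolding dominated_def by blast
  show "bcmd_running_time algorithm
      (\<lambda>n B. (3 ^ B * real B ^ 3 + real n + log 2 (real B * real n)) * real B * real n ^ 2)"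
    unfolding bcmd_running_time_def
  proof (intro exI allI impI)
    fix n B t :: nat and E w c s
    assume inst: "bcmd_instance {..<n} E w c" and B: "1 \<le> B" and ex: "exec algorithm (bcmd_input n E w c B) t s"
    interpret bcmd n E w c B
      using inst by unfold_locales
    obtain t' s' where "exec algorithm (bcmd_input n E w c B) t' s'" "t' \<le> total_time n B"
      using ok_algorithm unfolding ok_def by blast
    \<comment> \<open>\<open>bcmd_running_time\<close> speaks of a given run and
      \<open>ok_algorithm\<close> of some run; determinism identifies them.\<close>
    then have "t \<le> total_time n B"
      using exec_deterministic[OF ex] by simp
    also have "\<dots> \<le> k * time_bound n B"
      using k n_pos B by simp
    finally have "real t \<le> real (k * time_bound n B)"
      by (rule of_nat_mono)
    also have "\<dots> = real k * ((3 ^ B * real B ^ 3 + real n) * real B * real n ^ 2)"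
      by (simp add: time_bound_def)
    also have "\<dots> \<le> real k * ((3 ^ B * real B ^ 3 + real n + log 2 (real B * real n)) * real B * real n ^ 2)"
    proof -
      have "1 \<le> real B * real n"
        using B n_pos by (metis Suc_leI of_nat_1 of_nat_le_iff of_nat_mult One_nat_def mult_le_mono mult_1)
      then have "0 \<le> log 2 (real B * real n)"
        by (simp add: zero_le_log_cancel_iff)
      then show ?thesis
        by (intro mult_left_mono mult_right_mono) simp_all
    qed
    finally show "real t \<le> real k * ((3 ^ B * real B ^ 3 + real n + log 2 (real B * real n)) * real B * real n ^ 2)" .
  qed
qed

end
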